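(* Let $T$ be a basic trigraph in $\mathcal F$ that contains no odd prism and no antihole (of any length $\ge 5$). Then: (1) $T$ is either complete or has an even pair; (2) if $T$ is favorable, then $T$ has an even pair disjoint from its switchable component.
   Context: A trigraph $T$ consists of a finite set $V(T)$ and a map $\theta:\binom{V(T)}{2}\to\{-1,0,1\}$. Two distinct vertices $u,v$ are strongly adjacent if $\theta(uv)=1$, strongly antiadjacent if $\theta(uv)=-1$, and semiadjacent (a switchable pair) if $\theta(uv)=0$; they are adjacent if $\theta(uv)\in\{0,1\}$ and antiadjacent if $\theta(uv)\in\{0,-1\}$. $N(v)$ is the set of vertices adjacent to $v$. An edge (antiedge) is an adjacent (antiadjacent) pair; a strong edge (strong antiedge) is a strongly adjacent (strongly antiadjacent) pair. A vertex/set is strongly complete (strongly anticomplete, complete, anticomplete) to a disjoint set if every pair between them is strongly adjacent (strongly antiadjacent, adjacent, antiadjacent). The complement $\overline T$ has vertex set $V(T)$ and adjacency function $-\theta$. For $X\subseteq V(T)$, $T|X$ is the trigraph on $X$ with $\theta$ restricted, and $T\setminus X=T|(V(T)\setminus X)$; $T$ contains $H$ if $H$ is isomorphic to some $T|X$. A clique (strong clique) is a set of pairwise adjacent (strongly adjacent) vertices; a stable set (strongly stable set) is a set of pairwise antiadjacent (strongly antiadjacent) vertices; $T$ is complete if $V(T)$ is a clique. $T$ is a graph if it has no switchable pair. A realization of $T$ is a graph on $V(T)$ in which every strong edge is an edge and every strong antiedge is a non-edge; the full realization is the realization in which all switchable pairs are edges. A set $X$ is connected if the full realization of $T|X$ is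 connected, and anticonnected if the graph on $X$ whose edges are the antiadjacent pairs of $T|X$ is connected; components (anticomponents) are maximal connected (anticonnected) subsets. A path is a sequence of distinct vertices $p_1,\dots,p_k$ such that $p_i,p_j$ are adjacent when $|i-j|=1$ and antiadjacent when $|i-j|>1$; its length is $k-1$, and it is even or odd according to its length. A hole of length $k\ge5$ consists of vertices $h_1,\dots,h_k$ with $h_i,h_j$ adjacent if $|i-j|\in\{1,k-1\}$ and antiadjacent otherwise; an antihole is an induced subtrigraph whose complement is a hole of $\overline T$ (length = number of vertices). $T$ is Berge if it contains no hole of odd length and no antihole of odd length. A prism is an induced subtrigraph whose full realization consists of two vertex-disjoint triangles $\{a_1,a_2,a_3\}$, $\{b_1,b_2,b_3\}$ and three vertex-disjoint paths $P_i$ from $a_i$ to $b_i$ ($i=1,2,3$) with no other edges; it is odd if all three $P_i$ have odd length. An even pair of $T$ is a strongly antiadjacent pair $\{u,v\}$ such that every path from $u$ to $v$ in $T$ has even length. $\Sigma(T)$ is the graph on $V(T)$ whose edges are the switchable pairs of $T$; a switchable component is a connected component of $\Sigma(T)$ with at least two vertices. $\mathcal F$ is the class of Berge trigraphs $T$ such that: (1) $T$ has at most one switchable component, and it has at most two edges; (2) if the switchable component has exactly one edge $xy$, then $N(x)\cap N(y)=\emptyset$ (it is called small); (3) if it has two edges, with $v$ the vertex of degree two in $\Sigma(T)$ and $x,y$ its neighbours, then $v$ is strongly anticomplete to $V(T)\setminus\{v,x,y\}$, $x$ is strongly antiadjacent to $y$, and $N(x)\cap N(y)=\{v\}$ (it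 is called light). For $T\in\mathcal F$, $D$ denotes the vertex set of its switchable component ($D=\emptyset$ if $T$ has no switchable pair). A pair $\{u,v\}$ is disjoint from the switchable component if $\{u,v\}\cap D=\emptyset$. A trigraph $T\in\mathcal F$ is favorable if (1) $|V(T)|\ge5$; (2) $T$ has a strongly antiadjacent pair $\{u,v\}$ disjoint from $D$; and (3) if $D=\{x,y\}$ is small, then at least one of $V(T)\setminus(D\cup N(x))$, $V(T)\setminus(D\cup N(y))$ is not a clique. $T$ is bipartite if $V(T)$ can be partitioned into two strongly stable sets. $T$ is a line trigraph if its full realization is the line graph of a bipartite graph and every clique of size at least $3$ in $T$ is a strong clique. $T$ is a doubled graph if it has a good partition: a partition $(X,Y)$ of $V(T)$ such that every component of $T|X$ and every anticomponent of $T|Y$ has at most two vertices, no switchable pair has one end in $X$ and the other in $Y$, and for every component $C_x$ of $T|X$ and every anticomponent $C_y$ of $T|Y$, every vertex of $C_x\cup C_y$ is incident with at most one strong edge and at most one strong antiedge between $C_x$ and $C_y$. $T$ is basic if it is bipartite, the complement of a bipartite trigraph, a line trigraph, the complement of a line trigraph, or a doubled graph. *)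

theory Defs
  imports Main
begin

text \<open>A trigraph is given by a finite vertex set V and a map theta on pairs of
  distinct vertices with values in {-1,0,1}; theta is symmetric (it is really a map
  on unordered pairs). Values of theta on u u or outside V are irrelevant.\<close>

definition trigraph :: "'a set \<Rightarrow> ('a \<Rightarrow> 'a \<Rightarrow> int) \<Rightarrow> bool" where
  "trigraph V \<theta> \<longleftrightarrow> finite V \<and>
     (\<forall>u\<in>V. \<forall>v\<in>V. u \<noteq> v \<longrightarrow> \<theta> u v = \<theta> v u \<and> \<theta> u v \<in> {-1, 0, 1})"

definition compl :: "('a \<Rightarrow> 'a \<Rightarrow> int) \<Rightarrow> ('a \<Rightarrow> 'a \<Rightarrow> int)" where
  "compl \<theta> = (\<lambda>u v. - \<theta> u v)"

definition sadj :: "('a \<Rightarrow> 'a \<Rightarrow> int) \<Rightarrow> 'a \<Rightarrow> 'a \<Rightarrow> bool" where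
  "sadj \<theta> u v \<longleftrightarrow> u \<noteq> v \<and> \<theta> u v = 1"

definition santi :: "('a \<Rightarrow> 'a \<Rightarrow> int) \<Rightarrow> 'a \<Rightarrow> 'a \<Rightarrow> bool" where
  "santi \<theta> u v \<longleftrightarrow> u \<noteq> v \<and> \<theta> u v = -1"

definition semiadj :: "('a \<Rightarrow> 'a \<Rightarrow> int) \<Rightarrow> 'a \<Rightarrow> 'a \<Rightarrow> bool" where
  "semiadj \<theta> u v \<longleftrightarrow> u \<noteq> v \<and> \<theta> u v = 0"

definition adj :: "('a \<Rightarrow> 'a \<Rightarrow> int) \<Rightarrow> 'a \<Rightarrow> 'a \<Rightarrow> bool" where
  "adj \<theta> u v \<longleftrightarrow> u \<noteq> v \<and> \<theta> u v \<in> {0, 1}"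

definition antiadj :: "('a \<Rightarrow> 'a \<Rightarrow> int) \<Rightarrow> 'a \<Rightarrow> 'a \<Rightarrow> bool" where
  "antiadj \<theta> u v \<longleftrightarrow> u \<noteq> v \<and> \<theta> u v \<in> {0, -1}"

definition nbhd :: "'a set \<Rightarrow> ('a \<Rightarrow> 'a \<Rightarrow> int) \<Rightarrow> 'a \<Rightarrow> 'a set" where
  "nbhd V \<theta> v = {u \<in> V. adj \<theta> u v}"

definition clique :: "('a \<Rightarrow> 'a \<Rightarrow> int) \<Rightarrow> 'a set \<Rightarrow> bool" where
  "clique \<theta> X \<longleftrightarrow> (\<forall>u\<in>X. \<forall>v\<in>X. u \<noteq> v \<longrightarrow> adj \<theta> u v)"

definition strong_clique :: "('a \<Rightarrow> 'a \<Rightarrow> int) \<Rightarrow> 'a set \<Rightarrow> bool" where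
  "strong_clique \<theta> X \<longleftrightarrow> (\<forall>u\<in>X. \<forall>v\<in>X. u \<noteq> v \<longrightarrow> sadj \<theta> u v)"

definition strongly_stable :: "('a \<Rightarrow> 'a \<Rightarrow> int) \<Rightarrow> 'a set \<Rightarrow> bool" where
  "strongly_stable \<theta> X \<longleftrightarrow> (\<forall>u\<in>X. \<forall>v\<in>X. u \<noteq> v \<longrightarrow> santi \<theta> u v)"

definition complete_tg :: "'a set \<Rightarrow> ('a \<Rightarrow> 'a \<Rightarrow> int) \<Rightarrow> bool" where
  "complete_tg V \<theta> \<longleftrightarrow> clique \<theta> V"

definition is_path :: "'a set \<Rightarrow> ('a \<Rightarrow> 'a \<Rightarrow> int) \<Rightarrow> 'a list \<Rightarrow> bool" where
  "is_path V \<theta> p \<longleftrightarrow> p \<noteq> [] \<and> distinct p \<and> set p \<subseteq> V \<and>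
     (\<forall>i < length p. \<forall>j < length p.
        (Suc i = j \<longrightarrow> adj \<theta> (p ! i) (p ! j)) \<and>
        (Suc i < j \<longrightarrow> antiadj \<theta> (p ! i) (p ! j)))"

definition path_len :: "'a list \<Rightarrow> nat" where
  "path_len p = length p - 1"

definition is_hole :: "'a set \<Rightarrow> ('a \<Rightarrow> 'a \<Rightarrow> int) \<Rightarrow> 'a list \<Rightarrow> bool" where
  "is_hole V \<theta> h \<longleftrightarrow> length h \<ge> 5 \<and> distinct h \<and> set h \<subseteq> V \<and>
     (\<forall>i < length h. \<forall>j < length h. i < j \<longrightarrow>
        ((j - i = 1 \<or> j - i = length h - 1) \<longrightarrow> adj \<theta> (h ! i) (h ! j)) \<and>
        (\<not> (j - i = 1 \<or> j - i = length h - 1) \<longrightarrow> antiadj \<theta> (h ! i) (h ! j)))"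

definition is_antihole :: "'a set \<Rightarrow> ('a \<Rightarrow> 'a \<Rightarrow> int) \<Rightarrow> 'a list \<Rightarrow> bool" where
  "is_antihole V \<theta> h \<longleftrightarrow> is_hole V (compl \<theta>) h"

definition berge :: "'a set \<Rightarrow> ('a \<Rightarrow> 'a \<Rightarrow> int) \<Rightarrow> bool" where
  "berge V \<theta> \<longleftrightarrow>
     \<not> (\<exists>h. is_hole V \<theta> h \<and> odd (length h)) \<and>
     \<not> (\<exists>h. is_antihole V \<theta> h \<and> odd (length h))"

definition consec :: "'a list \<Rightarrow> 'a \<Rightarrow> 'a \<Rightarrow> bool" where
  "consec P x y \<longleftrightarrow> (\<exists>i. Suc i < length P \<and> {P ! i, P ! Suc i} = {x, y})"

text \<open>A prism: vertex set X = set P1 \<union> set P2 \<union> set P3, where P_i is the list of vertices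
  of the path from a_i = hd P_i to b_i = last P_i; the full realization of T|X consists
  exactly of the triangles {a1,a2,a3}, {b1,b2,b3} and the path edges.\<close>
definition is_prism :: "'a set \<Rightarrow> ('a \<Rightarrow> 'a \<Rightarrow> int) \<Rightarrow> 'a list \<Rightarrow> 'a list \<Rightarrow> 'a list \<Rightarrow> bool" where
  "is_prism V \<theta> P1 P2 P3 \<longleftrightarrow>
     length P1 \<ge> 2 \<and> length P2 \<ge> 2 \<and> length P3 \<ge> 2 \<and>
     distinct (P1 @ P2 @ P3) \<and> set (P1 @ P2 @ P3) \<subseteq> V \<and>
     (\<forall>x \<in> set (P1 @ P2 @ P3). \<forall>y \<in> set (P1 @ P2 @ P3). x \<noteq> y \<longrightarrow>
        (adj \<theta> x y \<longleftrightarrow>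
           consec P1 x y \<or> consec P2 x y \<or> consec P3 x y \<or>
           {x, y} \<subseteq> {hd P1, hd P2, hd P3} \<or>
           {x, y} \<subseteq> {last P1, last P2, last P3}))"

definition has_odd_prism :: "'a set \<Rightarrow> ('a \<Rightarrow> 'a \<Rightarrow> int) \<Rightarrow> bool" where
  "has_odd_prism V \<theta> \<longleftrightarrow> (\<exists>P1 P2 P3. is_prism V \<theta> P1 P2 P3 \<and>
     odd (path_len P1) \<and> odd (path_len P2) \<and> odd (path_len P3))"

definition has_antihole :: "'a set \<Rightarrow> ('a \<Rightarrow> 'a \<Rightarrow> int) \<Rightarrow> bool" where
  "has_antihole V \<theta> \<longleftrightarrow> (\<exists>h. is_antihole V \<theta> h)"

definition even_pair :: "'a set \<Rightarrow> ('a \<Rightarrow> 'a \<Rightarrow> int) \<Rightarrow> 'a \<Rightarrow> 'a \<Rightarrow> bool" where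
  "even_pair V \<theta> u v \<longleftrightarrow> u \<in> V \<and> v \<in> V \<and> santi \<theta> u v \<and>
     (\<forall>p. is_path V \<theta> p \<and> hd p = u \<and> last p = v \<longrightarrow> even (path_len p))"

definition sigma_rel :: "'a set \<Rightarrow> ('a \<Rightarrow> 'a \<Rightarrow> int) \<Rightarrow> ('a \<times> 'a) set" where
  "sigma_rel V \<theta> = {(u, v). u \<in> V \<and> v \<in> V \<and> semiadj \<theta> u v}"

definition sigma_comp :: "'a set \<Rightarrow> ('a \<Rightarrow> 'a \<Rightarrow> int) \<Rightarrow> 'a \<Rightarrow> 'a set" where
  "sigma_comp V \<theta> v = {u. (v, u) \<in> (sigma_rel V \<theta>)\<^sup>*}"

definition switchable_components :: "'a set \<Rightarrow> ('a \<Rightarrow> 'a \<Rightarrow> int) \<Rightarrow> 'a set set" where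
  "switchable_components V \<theta> =
     {C. \<exists>v \<in> V. C = sigma_comp V \<theta> v \<and> card C \<ge> 2}"

definition sw_edges :: "('a \<Rightarrow> 'a \<Rightarrow> int) \<Rightarrow> 'a set \<Rightarrow> 'a set set" where
  "sw_edges \<theta> C = {{u, v} | u v. u \<in> C \<and> v \<in> C \<and> semiadj \<theta> u v}"

text \<open>D: vertex set of the switchable component (empty if there is none).\<close>
definition swD :: "'a set \<Rightarrow> ('a \<Rightarrow> 'a \<Rightarrow> int) \<Rightarrow> 'a set" where
  "swD V \<theta> = \<Union> (switchable_components V \<theta>)"

definition in_F :: "'a set \<Rightarrow> ('a \<Rightarrow> 'a \<Rightarrow> int) \<Rightarrow> bool" where
  "in_F V \<theta> \<longleftrightarrow> trigraph V \<theta> \<and> berge V \<theta> \<and>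
     card (switchable_components V \<theta>) \<le> 1 \<and>
     (\<forall>C \<in> switchable_components V \<theta>.
        card (sw_edges \<theta> C) \<le> 2 \<and>
        (\<forall>x y. sw_edges \<theta> C = {{x, y}} \<longrightarrow> nbhd V \<theta> x \<inter> nbhd V \<theta> y = {}) \<and>
        (\<forall>v x y. x \<noteq> y \<and> sw_edges \<theta> C = {{v, x}, {v, y}} \<longrightarrow>
           (\<forall>w \<in> V - {v, x, y}. santi \<theta> v w) \<and> santi \<theta> x y \<and>
           nbhd V \<theta> x \<inter> nbhd V \<theta> y = {v}))"

definition favorable :: "'a set \<Rightarrow> ('a \<Rightarrow> 'a \<Rightarrow> int) \<Rightarrow> bool" where
  "favorable V \<theta> \<longleftrightarrow> in_F V \<theta> \<and> card V \<ge> 5 \<and>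
     (\<exists>u \<in> V. \<exists>v \<in> V. santi \<theta> u v \<and> u \<notin> swD V \<theta> \<and> v \<notin> swD V \<theta>) \<and>
     (\<forall>x y. x \<noteq> y \<and> swD V \<theta> = {x, y} \<longrightarrow>
        \<not> clique \<theta> (V - (swD V \<theta> \<union> nbhd V \<theta> x)) \<or>
        \<not> clique \<theta> (V - (swD V \<theta> \<union> nbhd V \<theta> y)))"

definition bipartite_tg :: "'a set \<Rightarrow> ('a \<Rightarrow> 'a \<Rightarrow> int) \<Rightarrow> bool" where
  "bipartite_tg V \<theta> \<longleftrightarrow> (\<exists>A B. A \<union> B = V \<and> A \<inter> B = {} \<and>
     strongly_stable \<theta> A \<and> strongly_stable \<theta> B)"

text \<open>Line graph of a bipartite graph H: the edges of H are encoded as pairs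
  (left endpoint, right endpoint) with both sides indexed by nat; two edges of H
  are adjacent in the line graph iff they share an endpoint. The map f is a bijection
  between V and the edge set f ` V of H.\<close>
definition line_trigraph :: "'a set \<Rightarrow> ('a \<Rightarrow> 'a \<Rightarrow> int) \<Rightarrow> bool" where
  "line_trigraph V \<theta> \<longleftrightarrow>
     (\<exists>f :: 'a \<Rightarrow> nat \<times> nat. inj_on f V \<and>
        (\<forall>u\<in>V. \<forall>v\<in>V. u \<noteq> v \<longrightarrow>
           (adj \<theta> u v \<longleftrightarrow> fst (f u) = fst (f v) \<or> snd (f u) = snd (f v)))) \<and>
     (\<forall>X \<subseteq> V. clique \<theta> X \<and> card X \<ge> 3 \<longrightarrow> strong_clique \<theta> X)"

definition comp_of :: "('a \<Rightarrow> 'a \<Rightarrow> bool) \<Rightarrow> 'a set \<Rightarrow> 'a \<Rightarrow> 'a set" where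
  "comp_of R X v = {u. (v, u) \<in> {(a, b). a \<in> X \<and> b \<in> X \<and> R a b}\<^sup>*}"

definition components :: "('a \<Rightarrow> 'a \<Rightarrow> int) \<Rightarrow> 'a set \<Rightarrow> 'a set set" where
  "components \<theta> X = comp_of (adj \<theta>) X ` X"

definition anticomponents :: "('a \<Rightarrow> 'a \<Rightarrow> int) \<Rightarrow> 'a set \<Rightarrow> 'a set set" where
  "anticomponents \<theta> X = comp_of (antiadj \<theta>) X ` X"

definition good_partition :: "'a set \<Rightarrow> ('a \<Rightarrow> 'a \<Rightarrow> int) \<Rightarrow> 'a set \<Rightarrow> 'a set \<Rightarrow> bool" where
  "good_partition V \<theta> X Y \<longleftrightarrow> X \<union> Y = V \<and> X \<inter> Y = {} \<and>
     (\<forall>C \<in> components \<theta> X. card C \<le> 2) \<and>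
     (\<forall>C \<in> anticomponents \<theta> Y. card C \<le> 2) \<and>
     (\<forall>x\<in>X. \<forall>y\<in>Y. \<not> semiadj \<theta> x y) \<and>
     (\<forall>Cx \<in> components \<theta> X. \<forall>Cy \<in> anticomponents \<theta> Y.
        (\<forall>w \<in> Cx. card {z \<in> Cy. sadj \<theta> w z} \<le> 1 \<and> card {z \<in> Cy. santi \<theta> w z} \<le> 1) \<and>
        (\<forall>w \<in> Cy. card {z \<in> Cx. sadj \<theta> w z} \<le> 1 \<and> card {z \<in> Cx. santi \<theta> w z} \<le> 1))"

definition doubled_graph :: "'a set \<Rightarrow> ('a \<Rightarrow> 'a \<Rightarrow> int) \<Rightarrow> bool" where
  "doubled_graph V \<theta> \<longleftrightarrow> (\<exists>X Y. good_partition V \<theta> X Y)"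

definition basic :: "'a set \<Rightarrow> ('a \<Rightarrow> 'a \<Rightarrow> int) \<Rightarrow> bool" where
  "basic V \<theta> \<longleftrightarrow> bipartite_tg V \<theta> \<or> bipartite_tg V (compl \<theta>) \<or>
     line_trigraph V \<theta> \<or> line_trigraph V (compl \<theta>) \<or> doubled_graph V \<theta>"

end

theory Submission
  imports Defs
begin

text \<open>
  Bipartite trigraphs: two vertices on the same side form an even pair. For complements of bipartite
  trigraphs and of line trigraphs every odd path has length 3, and a maximal anticonnected set whose set
  of common neighbours is not a clique yields, by induction inside those neighbours, an antiadjacent pair
  not joined by a path of length 3. Doubled graphs are handled by inspecting the good partition.

  The main case is the line graph of a bipartite graph H. Disjoint edges pb and aq of H, with p and a on
  the same side, form an even pair as soon as H - {b,q} has no path from p to a and H - {p,a} has no path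
  from b to q. Absence of an odd prism means that no two vertices on the same side of H are joined by three
  internally disjoint paths. Hence, for a cycle of H, its bridges attach to it at most twice, at vertices of
  opposite sides, and no two of them cross. So a minimal segment of the cycle cut off by a bridge contains
  four consecutive vertices p, b, a, q as above; without bridges any four will do, and in a forest any path
  on four vertices will do. The vertices of degree two that carry the switchable component can be kept out
  of the segment, except when every cycle has length 4 and passes through such a vertex; there the favorable
  condition supplies the pair.
\<close>

section \<open>Walks, ears and cycles in bipartite relations\<close>

text \<open>Sides are Boolean, so among any three vertices of H two agree in side; this is why a
  bridge of a cycle has at most two attachments and why crossing bridges always create a forbidden
  theta. An induced odd path between two edges of H uses shared ends that alternate between the
  sides, so the first and the last of them lie on the same side, and the path traces a walk that
  avoids the other ends of the two edges: this is the origin of the two separation conditions. A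
  switchable pair meets in a vertex of degree two of H, since a third edge there would put the pair
  into a triangle, and triangles are strong. Avoiding the switchable component thus means avoiding
  one vertex (small) or two adjacent vertices (light) of degree two. The obstacle is the 4-cycle,
  which is too short once such a vertex is removed. In the light case it would produce an edge of H
  meeting both outer members of the component, which their neighbourhoods exclude; in the small case
  it is overcome with two edges that are disjoint from one member of the pair.\<close>

text \<open>A shortest walk works. \<open>R\<close> need not be symmetric, so only chords from an
  earlier to a later entry are excluded. The lemma serves for paths of H with deleted vertices and
  for induced antipaths.\<close>

lemma rtranclp_induced_path:
  assumes "R\<^sup>*\<^sup>* a b"
  obtains xs where "xs \<noteq> []" "hd xs = a" "last xs = b" "successively R xs" "distinct xs"
    "\<And>i j. Suc i < j \<Longrightarrow> j < length xs \<Longrightarrow> \<not> R (xs ! i) (xs ! j)"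
proof -
  define W where "W xs \<longleftrightarrow> xs \<noteq> [] \<and> hd xs = a \<and> last xs = b \<and> successively R xs" for xs
  from assms have "\<exists>xs. xs \<noteq> [] \<and> hd xs = a \<and> last xs = b \<and> successively R xs"
  proof (induction rule: rtranclp_induct)
    case base
    show ?case by (rule exI[of _ "[a]"]) simp
  next
    case (step y z)
    then obtain xs where "xs \<noteq> []" "hd xs = a" "last xs = y" "successively R xs" by auto
    with step show ?case
      by (intro exI[of _ "xs @ [z]"]) (auto simp: successively_append_iff)
  qed
  then have "\<exists>xs. W xs" by (simp add: W_def)
  then obtain xs where W: "W xs" and min: "\<And>ys. W ys \<Longrightarrow> length xs \<le> length ys"
    using arg_min_nat_lemma[of W _ length] by metis
  have cut: "W (take (Suc i) xs @ drop j xs)"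
    if "i < j" "j < length xs" "R (xs ! i) (xs ! j)" for i j
  proof -
    have "successively R (take (Suc i) xs @ drop j xs)"
      using W that unfolding W_def successively_append_iff
      by (metis append_take_drop_id hd_drop_conv_nth last_snoc successively_append_iff take_Suc_conv_app_nth
          less_trans)
    thus ?thesis using W that by (auto simp: W_def hd_append)
  qed
  have "distinct xs"
  proof (rule ccontr)
    assume "\<not> distinct xs"
    then obtain i j where ij: "i < j" "j < length xs" "xs ! i = xs ! j"
      by (metis distinct_conv_nth linorder_neqE_nat)
    \<comment> \<open>A repeated vertex is removed by jumping from \<open>i\<close> straight to
      \<open>Suc j\<close>; if \<open>j\<close> is the last position, the prefix up to
      \<open>i\<close> already ends correctly.\<close>
    show False
    proof (cases "Suc j < length xs")
      case True
      have "R (xs ! j) (xs ! Suc j)"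
        using W True by (simp add: W_def successively_conv_nth)
      with ij True have "W (take (Suc i) xs @ drop (Suc j) xs)" by (intro cut) auto
      from min[OF this] ij True show False by simp
    next
      case False
      hence j: "j = length xs - 1" using ij by simp
      have "W (take (Suc i) xs)"
        using W ij j unfolding W_def
        by (auto simp: last_conv_nth min_def nth_take intro: successively_if_sorted_wrt)
           (metis append_take_drop_id successively_append_iff)
      from min[OF this] ij show False by simp
    qed
  qed
  moreover have "\<not> R (xs ! i) (xs ! j)" if "Suc i < j" "j < length xs" for i j
  proof
    assume "R (xs ! i) (xs ! j)"
    with that have "W (take (Suc i) xs @ drop j xs)" by (intro cut) auto
    from min[OF this] that show False by simp
  qed
  ultimately show thesis using that W unfolding W_def by blast
qed

lemma successively_map_upt:
  "(\<And>k. i \<le> k \<Longrightarrow> Suc k < j \<Longrightarrow> P (c k) (c (Suc k))) \<Longrightarrow> successively P (map c [i..<j])"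
  by (simp add: successively_conv_nth)

section \<open>Reachability after deleting vertices, and ears\<close>

locale bipartite_relation =
  fixes E :: "'v \<Rightarrow> 'v \<Rightarrow> bool" and side :: "'v \<Rightarrow> bool"
  assumes sym: "E u w \<Longrightarrow> E w u" and bip: "E u w \<Longrightarrow> side u \<noteq> side w"
begin

text \<open>The vertices of S are deleted; note that \<open>reach S u u\<close> holds even if u lies in S.\<close>
definition reach :: "'v set \<Rightarrow> 'v \<Rightarrow> 'v \<Rightarrow> bool" where
  "reach S = (\<lambda>u w. E u w \<and> u \<notin> S \<and> w \<notin> S)\<^sup>*\<^sup>*"

lemma reach_refl [simp]: "reach S u u"
  by (simp add: reach_def)

lemma reach_trans: "reach S u v \<Longrightarrow> reach S v w \<Longrightarrow> reach S u w"
  by (auto simp: reach_def)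

lemma reach_sym: "reach S u w \<Longrightarrow> reach S w u"
proof -
  have "symp (\<lambda>u w. E u w \<and> u \<notin> S \<and> w \<notin> S)" by (auto intro!: sympI sym)
  hence "symp (reach S)" unfolding reach_def by (rule symp_rtranclp)
  thus "reach S u w \<Longrightarrow> reach S w u" by (rule sympD)
qed

lemma reach_step: "E u w \<Longrightarrow> u \<notin> S \<Longrightarrow> w \<notin> S \<Longrightarrow> reach S u w"
  unfolding reach_def by (rule r_into_rtranclp) simp

lemma reach_mono: "reach S u w \<Longrightarrow> S' \<subseteq> S \<Longrightarrow> reach S' u w"
  unfolding reach_def by (erule rtranclp_mono[THEN predicate2D, rotated]) auto

lemma reach_list:
  assumes "successively E xs" "set xs \<inter> S = {}" "a \<in> set xs" "b \<in> set xs"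
  shows "reach S a b"
proof -
  have "reach S (hd xs) a" if "successively E xs" "set xs \<inter> S = {}" "a \<in> set xs" for a
    using that
  proof (induction xs)
    case (Cons x xs)
    show ?case
    proof (cases "a = x")
      case False
      with Cons have "reach S (hd xs) a" "xs \<noteq> []" by (auto simp: successively_Cons)
      moreover have "reach S x (hd xs)"
        using Cons.prems \<open>xs \<noteq> []\<close> hd_in_set[OF \<open>xs \<noteq> []\<close>] by (intro reach_step) (auto simp: successively_Cons disjoint_iff)
      ultimately show ?thesis by (auto intro: reach_trans)
    qed simp
  qed simp
  with assms show ?thesis by (meson reach_sym reach_trans)
qed

text \<open>Since \<open>u \<noteq> w\<close>, the walk has at least one step, so even its ends lie
  outside \<open>S\<close>, which \<open>reach\<close> alone does not promise.\<close>

lemma reach_path: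
  assumes "reach S u w" "u \<noteq> w"
  obtains I where "successively E (u # I @ [w])" "distinct (u # I @ [w])" "set (u # I @ [w]) \<inter> S = {}"
proof -
  from assms(1) obtain xs where xs: "xs \<noteq> []" "hd xs = u" "last xs = w"
    "successively (\<lambda>u w. E u w \<and> u \<notin> S \<and> w \<notin> S) xs" "distinct xs"
    unfolding reach_def by (rule rtranclp_induced_path)
  then obtain I where I: "xs = u # I @ [w]" using assms(2)
    by (metis append_butlast_last_id hd_Cons_tl last_ConsL last_tl)
  have s: "successively E xs" using xs(4) by (rule successively_mono) auto
  have "set xs \<inter> S = {}"
  proof -
    have "x \<notin> S" if "x \<in> set xs" for x
    proof -
      from that obtain i where i: "i < length xs" "xs ! i = x" by (auto simp: in_set_conv_nth)
      show ?thesis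
      proof (cases i)
        case 0
        with i xs(4) I show ?thesis by (auto simp: successively_Cons)
      next
        case (Suc j)
        with i xs(4) show ?thesis by (auto simp: successively_conv_nth)
      qed
    qed
    thus ?thesis by auto
  qed
  with s xs(5) I that show thesis by auto
qed

lemma successively_rev: "successively E xs \<Longrightarrow> successively E (rev xs)"
  by (auto simp: successively_rev intro: successively_mono sym)

text \<open>\<open>I\<close> may be empty: chords of a cycle are ears, and so are the edges of the
  cycle itself, which is why neighbouring positions have to be excluded by hand later on.\<close>

definition ear :: "'v set \<Rightarrow> 'v \<Rightarrow> 'v \<Rightarrow> 'v list \<Rightarrow> bool" where
  "ear C u w I \<longleftrightarrow> u \<in> C \<and> w \<in> C \<and> u \<noteq> w \<and> successively E (u # I @ [w]) \<and> distinct I \<and> set I \<inter> C = {}"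

text \<open>Follow the walk from \<open>u\<close> up to its first return to \<open>C\<close>. The
  end \<open>z\<close> of the ear may differ from \<open>w\<close>, but like the whole walk it
  avoids \<open>S\<close>.\<close>

lemma ear_of_reach:
  assumes "reach S u w" "u \<noteq> w" "u \<in> C" "w \<in> C"
  obtains z I where "z \<notin> S" "ear C u z I"
proof -
  from assms(1,2) obtain J where J: "successively E (u # J @ [w])" "distinct (u # J @ [w])"
    "set (u # J @ [w]) \<inter> S = {}" by (rule reach_path)
  define I where "I = takeWhile (\<lambda>v. v \<notin> C) (J @ [w])"
  define K where "K = dropWhile (\<lambda>v. v \<notin> C) (J @ [w])"
  have IK: "J @ [w] = I @ K" by (simp add: I_def K_def)
  have "K \<noteq> []" using assms(4) by (auto simp: K_def)
  then obtain z L where K: "K = z # L" by (cases K) auto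
  have "z \<in> C" using K unfolding K_def by (metis hd_dropWhile list.sel(1) list.discI)
  have "successively E ((u # I @ [z]) @ L)" using J(1) IK K by simp
  hence "successively E (u # I @ [z])" unfolding successively_append_iff by blast
  moreover have "set I \<inter> C = {}" by (auto simp: I_def dest: set_takeWhileD)
  moreover have "distinct I" "u \<noteq> z" "z \<notin> S" using J(2,3) IK K by auto
  ultimately show thesis using that \<open>z \<in> C\<close> assms(3) unfolding ear_def by blast
qed

end

section \<open>Cycles and their bridges without thetas\<close>

locale theta_free = bipartite_relation +
  assumes no_theta: "p \<noteq> q \<Longrightarrow> side p = side q \<Longrightarrow>
    successively E (p # A @ [q]) \<Longrightarrow> successively E (p # B @ [q]) \<Longrightarrow> successively E (p # I @ [q]) \<Longrightarrow>
    \<not> distinct (p # q # A @ B @ I)"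
begin

text \<open>The third path only has to be known as reachability off the first two interiors, so it
  can be pieced together from several walks.\<close>

lemma no_third_path:
  assumes "p \<noteq> q" "side p = side q" "successively E (p # A @ [q])" "successively E (p # B @ [q])"
    "distinct (p # q # A @ B)" "reach (set A \<union> set B) p q"
  shows False
proof -
  from assms(6,1) obtain I where "successively E (p # I @ [q])" "distinct (p # I @ [q])"
    "set (p # I @ [q]) \<inter> (set A \<union> set B) = {}" by (rule reach_path)
  with no_theta[OF assms(1-4), of I] assms(5) show False by auto
qed

text \<open>A function on indices instead of a list: arcs become \<open>map c [i..<j]\<close>, and
  rotation becomes arithmetic modulo \<open>n\<close>.\<close>

definition cycle :: "(nat \<Rightarrow> 'a) \<Rightarrow> nat \<Rightarrow> bool" where
  "cycle c n \<longleftrightarrow> 3 \<le> n \<and> inj_on c {..<n} \<and> (\<forall>i. Suc i < n \<longrightarrow> E (c i) (c (Suc i))) \<and> E (c (n - 1)) (c 0)"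

lemma cycle_eq_iff: "cycle c n \<Longrightarrow> i < n \<Longrightarrow> j < n \<Longrightarrow> c i = c j \<longleftrightarrow> i = j"
  by (auto simp: cycle_def inj_on_def)

lemma cycle_arc: "cycle c n \<Longrightarrow> k \<le> n \<Longrightarrow> successively E (map c [i..<k])"
  by (rule successively_map_upt) (auto simp: cycle_def)

lemma cycle_side: "cycle c n \<Longrightarrow> i < n \<Longrightarrow> side (c i) = (side (c 0) = even i)"
proof (induction i)
  case (Suc i)
  hence "E (c i) (c (Suc i))" by (auto simp: cycle_def)
  from bip[OF this] Suc show ?case by auto
qed simp

lemma cycle_even: assumes "cycle c n" shows "even n" "4 \<le> n"
proof -
  have "3 \<le> n" "E (c (n - 1)) (c 0)" using assms by (auto simp: cycle_def)
  with cycle_side[OF assms, of "n - 1"] bip[of "c (n - 1)" "c 0"] show "even n" by auto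
  moreover have "n \<noteq> 3 \<Longrightarrow> 3 \<le> n \<Longrightarrow> 4 \<le> n" by linarith
  ultimately show "4 \<le> n" using \<open>3 \<le> n\<close> by (cases "n = 3") auto
qed

lemma cycle_wrap:
  assumes "cycle c n" "i \<le> n" "k < n"
  shows "successively E (map c [k..<n] @ map c [0..<i])"
  using assms cycle_arc[OF assms(1)] unfolding successively_append_iff
  by (cases i) (auto simp: cycle_def last_map hd_map simp del: upt_Suc)

text \<open>The second arc runs backwards from \<open>c i\<close> through positions 0 and
  \<open>n - 1\<close> to \<open>c k\<close>, hence the two reversed pieces.\<close>

lemma wrap_arcs:
  assumes c: "cycle c n" and ik: "i < k" "k < n"
  shows "successively E (c i # map c [Suc i..<k] @ [c k])"
    "successively E (c i # (rev (map c [0..<i]) @ rev (map c [Suc k..<n])) @ [c k])"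
proof -
  have *: "c i # map c [Suc i..<k] @ [c k] = map c [i..<Suc k]"
    using ik by (simp add: upt_conv_Cons)
  show "successively E (c i # map c [Suc i..<k] @ [c k])"
    unfolding * by (rule cycle_arc[OF c]) (use ik in simp)
  have "c i # (rev (map c [0..<i]) @ rev (map c [Suc k..<n])) @ [c k]
     = rev (map c [k..<n] @ map c [0..<Suc i])"
    using ik by (simp add: upt_conv_Cons)
  thus "successively E (c i # (rev (map c [0..<i]) @ rev (map c [Suc k..<n])) @ [c k])"
    using successively_rev[OF cycle_wrap[OF c, of "Suc i" k]] ik by simp
qed

lemma distinct_arc: "cycle c n \<Longrightarrow> k \<le> n \<Longrightarrow> distinct (map c [i..<k])"
  by (auto simp: distinct_map cycle_def inj_on_def)

text \<open>With ends on the same side, the ear and the two arcs of the cycle would be a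
  theta.\<close>

lemma ear_sides_less:
  assumes c: "cycle c n" and ik: "i < k" "k < n" and ear: "ear (c ` {..<n}) (c i) (c k) I"
  shows "side (c i) \<noteq> side (c k)"
proof
  assume side: "side (c i) = side (c k)"
  have I: "successively E (c i # I @ [c k])" "distinct I" "set I \<inter> c ` {..<n} = {}" "c i \<noteq> c k"
    using ear by (auto simp: ear_def)
  have *: "c x = c y \<longleftrightarrow> x = y" if "x < n" "y < n" for x y using that cycle_eq_iff[OF c] by auto
  have "distinct (c i # c k # map c [Suc i..<k] @ (rev (map c [0..<i]) @ rev (map c [Suc k..<n])) @ I)"
    using I ik distinct_arc[OF c] by (auto simp: *)
  with no_theta[OF I(4) side wrap_arcs[OF c ik] I(1)] show False by simp
qed

lemma ear_sym: "ear C u w I \<Longrightarrow> ear C w u (rev I)"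
  unfolding ear_def using successively_rev[of "u # I @ [w]"] by auto

lemma ear_sides:
  assumes c: "cycle c n" and ik: "i < n" "k < n" and ear: "ear (c ` {..<n}) (c i) (c k) I"
  shows "side (c i) \<noteq> side (c k)"
proof -
  have "c i \<noteq> c k" using ear by (simp add: ear_def)
  hence "i < k \<or> k < i" by (metis linorder_neqE_nat)
  thus ?thesis using ear_sides_less[OF c _ _ ear] ear_sides_less[OF c _ _ ear_sym[OF ear]] ik by metis
qed

text \<open>Ears with a common inner vertex lie in the same bridge, which therefore contains an ear
  from \<open>c j\<close> to \<open>c i\<close> as well. As there are only two sides, no bridge has
  three attachments.\<close>

lemma ears_meet:
  assumes c: "cycle c n" and ik: "i < n" "k < n" "j < n" "i \<noteq> j"
    and A: "ear (c ` {..<n}) (c i) (c k) A" and B: "ear (c ` {..<n}) (c j) (c l) B"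
    and z: "z \<in> set A" "z \<in> set B"
  shows "side (c j) \<noteq> side (c i)"
proof -
  \<comment> \<open>Every cycle vertex except these two is deleted, so the first return to the cycle
    can only be at \<open>c i\<close>.\<close>
  define S where "S = c ` {..<n} - {c i, c j}"
  have "successively E (c i # A)" "successively E (c j # B)"
    using A B unfolding ear_def by (metis append_Cons successively_append_iff)+
  moreover have "set (c i # A) \<inter> S = {}" "set (c j # B) \<inter> S = {}"
    using A B unfolding ear_def S_def by auto
  ultimately have "reach S (c j) z" "reach S z (c i)"
    using z reach_list[of "c j # B" S "c j" z] reach_list[of "c i # A" S z "c i"] by auto
  hence "reach S (c j) (c i)" by (rule reach_trans)
  moreover have "c j \<noteq> c i" using ik cycle_eq_iff[OF c] by auto
  moreover have "c j \<in> c ` {..<n}" "c i \<in> c ` {..<n}" using ik by auto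
  ultimately obtain y I where "y \<notin> S" "ear (c ` {..<n}) (c j) y I" by (rule ear_of_reach)
  moreover from this have "y = c i" by (auto simp: ear_def S_def)
  ultimately have "ear (c ` {..<n}) (c j) (c i) I" by simp
  from ear_sides[OF c _ _ this] ik show ?thesis by simp
qed

lemma path_glue:
  "successively E (u # X @ [w]) \<Longrightarrow> successively E (w # Y @ [z]) \<Longrightarrow> successively E (u # (X @ w # Y) @ [z])"
  by (induction X arbitrary: u) (auto simp: successively_Cons)

text \<open>If the ears share a vertex, \<open>c i\<close>, \<open>c j\<close> and
  \<open>c k\<close> would have pairwise opposite sides. If they are disjoint, \<open>c j\<close>
  agrees in side with \<open>c i\<close> or \<open>c k\<close>, and the cycle with both ears
  contains a theta between these two.\<close>

lemma no_crossing_ears: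
  assumes c: "cycle c n" and ik: "i < j" "j < k" "k < n" and l: "l < n" "l < i \<or> k < l"
    and A: "ear (c ` {..<n}) (c i) (c k) A" and B: "ear (c ` {..<n}) (c j) (c l) B"
  shows False
proof -
  have sides: "side (c i) \<noteq> side (c k)" "side (c j) \<noteq> side (c l)"
    using ear_sides[OF c _ _ A] ear_sides[OF c _ _ B] ik l by auto
  have eq: "c x = c y \<longleftrightarrow> x = y" if "x < n" "y < n" for x y using that cycle_eq_iff[OF c] by auto
  show False
  proof (cases "set A \<inter> set B = {}")
    case False
    then obtain z where z: "z \<in> set A" "z \<in> set B" by auto
    have "side (c j) \<noteq> side (c i)" using ears_meet[OF c _ _ _ _ A B z] ik by auto
    moreover have "side (c j) \<noteq> side (c k)"
      using ears_meet[OF c _ _ _ _ ear_sym[OF A] B, of z] z ik by auto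
    ultimately show False using sides by auto
  next
    case True
    have A': "successively E (c i # A @ [c k])" "distinct A" "set A \<inter> c ` {..<n} = {}"
      and B': "successively E (c j # B @ [c l])" "distinct B" "set B \<inter> c ` {..<n} = {}"
      using A B by (auto simp: ear_def)
    define P where "P = map c [Suc i..<j]"
    define Q where "Q = map c [Suc j..<k]"
    have PQ: "distinct P" "distinct Q" "set P = c ` {i<..<j}" "set Q = c ` {j<..<k}"
      using distinct_arc[OF c] ik by (auto simp: P_def Q_def)
    have "P @ [c j] @ Q = map c [Suc i..<k]"
    proof -
      have "[Suc i..<k] = [Suc i..<j] @ j # [Suc j..<k]"
        using ik by (metis Suc_leI less_imp_le_nat upt_add_eq_append upt_conv_Cons le_add_diff_inverse)
      thus ?thesis by (simp add: P_def Q_def)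
    qed
    have iPj: "successively E (c i # P @ [c j])" and jQk: "successively E (c j # Q @ [c k])"
      unfolding P_def Q_def using wrap_arcs(1)[OF c] ik by auto
    show False
    proof (cases "side (c j) = side (c i)")
      \<comment> \<open>Three routes from \<open>c j\<close> to \<open>c i\<close>: back along the
        cycle; forward to \<open>c k\<close> and through \<open>A\<close>; through \<open>B\<close>
        to \<open>c l\<close> and along the part of the cycle outside positions \<open>i\<close> to
        \<open>k\<close>.\<close>
      case s: True
      have p1: "successively E (c j # rev P @ [c i])"
        using successively_rev[OF iPj] by simp
      have p2: "successively E (c j # (Q @ c k # rev A) @ [c i])"
        using path_glue[OF jQk, of "rev A" "c i"] successively_rev[OF A'(1)] by simp
      let ?S = "set (rev P) \<union> set (Q @ c k # rev A)"
      have d: "distinct (c j # c i # rev P @ (Q @ c k # rev A))"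
        using A' PQ ik by (auto simp: eq)
      have r1: "reach ?S (c j) (c l)"
        using B' A'(3) True PQ ik l by (intro reach_list[OF B'(1)]) (auto simp: eq)
      have r2: "reach ?S (c l) (c i)"
      proof (cases "l < i")
        case True
        show ?thesis
          by (rule reach_list[of "map c [l..<Suc i]"])
             (use True A' PQ ik in \<open>auto simp: eq simp del: upt_Suc intro!: cycle_arc[OF c]\<close>)
      next
        case False
        hence "k < l" using l by simp
        show ?thesis
          by (rule reach_list[of "map c [l..<n] @ map c [0..<Suc i]"])
             (use \<open>k < l\<close> l A' PQ ik in \<open>auto simp: eq simp del: upt_Suc intro!: cycle_wrap[OF c]\<close>)
      qed
      show False
        using no_third_path[OF _ s p1 p2 d reach_trans[OF r1 r2]] ik by (auto simp: eq)
    next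
      case False
      \<comment> \<open>The mirror image, with three routes from \<open>c j\<close> to
        \<open>c k\<close>.\<close>
      hence s: "side (c j) = side (c k)" using sides by auto
      have p2: "successively E (c j # (rev P @ c i # A) @ [c k])"
        using path_glue[OF _ A'(1), of "c j" "rev P"] successively_rev[OF iPj] by simp
      let ?S = "set Q \<union> set (rev P @ c i # A)"
      have d: "distinct (c j # c k # Q @ (rev P @ c i # A))"
        using A' PQ ik by (auto simp: eq)
      have r1: "reach ?S (c j) (c l)"
        using B' A'(3) True PQ ik l by (intro reach_list[OF B'(1)]) (auto simp: eq)
      have r2: "reach ?S (c l) (c k)"
      proof (cases "l < i")
        case True
        show ?thesis
          by (rule reach_list[of "map c [k..<n] @ map c [0..<Suc l]"])
             (use True l A' PQ ik in \<open>auto simp: eq simp del: upt_Suc intro!: cycle_wrap[OF c]\<close>)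
      next
        case False
        hence "k < l" using l by simp
        show ?thesis
          by (rule reach_list[of "map c [k..<Suc l]"])
             (use \<open>k < l\<close> l A' PQ ik in \<open>auto simp: eq simp del: upt_Suc intro!: cycle_arc[OF c]\<close>)
      qed
      show False
        using no_third_path[OF _ s jQk p2 d reach_trans[OF r1 r2]] ik by (auto simp: eq)
    qed
  qed
qed

section \<open>Good quadruples on cycles\<close>

text \<open>These are the walks that an odd path between the edges \<open>p b\<close> and
  \<open>a q\<close> would trace in H. Deleting \<open>b\<close> and \<open>q\<close>, or
  \<open>p\<close> and \<open>a\<close>, also keeps the walk off the cycle edges when the four
  vertices are consecutive on a cycle.\<close>

definition good :: "'a \<Rightarrow> 'a \<Rightarrow> 'a \<Rightarrow> 'a \<Rightarrow> bool" where
  "good p b a q \<longleftrightarrow> \<not> reach {b, q} p a \<and> \<not> reach {p, a} b q"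

text \<open>Induction on the length of the segment. If its first four vertices are not good, some
  ear starts at position \<open>s + 2\<close> or \<open>s + 1\<close>. By \<open>closed\<close> its
  other end stays in the segment, and the shorter segment it cuts off is closed again because ears
  do not cross.\<close>

lemma good_in_segment:
  assumes c: "cycle c n" and "s + 3 \<le> t" "t < n"
    and closed: "\<And>j l I. s < j \<Longrightarrow> j < t \<Longrightarrow> l < n \<Longrightarrow> l < s \<or> t < l \<Longrightarrow> \<not> ear (c ` {..<n}) (c j) (c l) I"
  shows "\<exists>i. s \<le> i \<and> i + 3 \<le> t \<and> good (c i) (c (i + 1)) (c (i + 2)) (c (i + 3))"
  using assms(2-)
proof (induction "t - s" arbitrary: s t rule: less_induct)
  case less
  let ?C = "c ` {..<n}"
  have eq: "c x = c y \<longleftrightarrow> x = y" if "x < n" "y < n" for x y using that cycle_eq_iff[OF c] by auto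
  have sub: ?case if "s < s'" "s' + 2 \<le> t'" "t' \<le> t" and ear: "ear ?C (c s') (c t') I" for s' t' I
  proof -
    have "side (c s') \<noteq> side (c t')" using ear_sides[OF c _ _ ear] that less.prems by auto
    \<comment> \<open>Parity makes room: the ends of an ear have opposite sides, so a cut-off
      segment of length at least two has length at least three.\<close>
    hence "t' \<noteq> s' + 2" using cycle_side[OF c, of s'] cycle_side[OF c, of t'] that less.prems by auto
    hence "s' + 3 \<le> t'" using that by auto
    have "\<exists>i. s' \<le> i \<and> i + 3 \<le> t' \<and> good (c i) (c (i + 1)) (c (i + 2)) (c (i + 3))"
    proof (rule less.hyps)
      show "t' - s' < t - s" using that by auto
      show "s' + 3 \<le> t'" "t' < n" using \<open>s' + 3 \<le> t'\<close> that less.prems by auto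
      show "\<not> ear ?C (c j) (c l) J" if "s' < j" "j < t'" "l < n" "l < s' \<or> t' < l" for j l J
        using no_crossing_ears[OF c that(1,2) _ that(3,4) ear] \<open>t' \<le> t\<close> less.prems by auto
    qed
    thus ?thesis using that by (meson le_trans less_imp_le_nat)
  qed
  show ?case
  proof (cases "good (c s) (c (s + 1)) (c (s + 2)) (c (s + 3))")
    case True
    thus ?thesis using less.prems by blast
  next
    case False
    \<comment> \<open>The first walk is read from \<open>s + 2\<close> because \<open>closed\<close>
      speaks about ears at interior positions only, and \<open>s\<close> is not one.\<close>
    then consider "reach {c (s + 1), c (s + 3)} (c (s + 2)) (c s)" | "reach {c s, c (s + 2)} (c (s + 1)) (c (s + 3))"
      unfolding good_def using reach_sym by blast
    thus ?thesis
    proof cases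
      case 1
      then obtain z I where z: "z \<notin> {c (s + 1), c (s + 3)}" "ear ?C (c (s + 2)) z I"
        using less.prems by (elim ear_of_reach[of _ _ _ ?C]) (auto simp: eq)
      then obtain k where k: "k < n" "z = c k" by (auto simp: ear_def)
      have "side (c (s + 2)) \<noteq> side (c k)" using ear_sides[OF c _ _ z(2)[unfolded k(2)]] k less.prems by auto
      hence "k \<noteq> s" "k \<noteq> s + 2" using cycle_side[OF c, of s] cycle_side[OF c, of "s + 2"] less.prems by auto
      moreover have "s \<le> k" "k \<le> t" using less.prems(3)[of "s + 2" k I] z k less.prems by force+
      moreover have "k \<noteq> s + 1" "k \<noteq> s + 3" using z k by auto
      ultimately have "s + 2 + 2 \<le> k" by linarith
      with sub[of "s + 2" k I] z k \<open>k \<le> t\<close> show ?thesis by auto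
    next
      case 2
      then obtain z I where z: "z \<notin> {c s, c (s + 2)}" "ear ?C (c (s + 1)) z I"
        using less.prems by (elim ear_of_reach[of _ _ _ ?C]) (auto simp: eq)
      then obtain k where k: "k < n" "z = c k" by (auto simp: ear_def)
      have "s \<le> k" "k \<le> t" using less.prems(3)[of "s + 1" k I] z k less.prems by force+
      moreover have "k \<noteq> s + 1" using z k by (auto simp: ear_def)
      moreover have "k \<noteq> s" "k \<noteq> s + 2" using z k by auto
      ultimately have "s + 1 + 2 \<le> k" by linarith
      with sub[of "s + 1" k I] z k \<open>k \<le> t\<close> show ?thesis by auto
    qed
  qed
qed

end

section \<open>Pairs of edges joined by even paths only\<close>

context theta_free
begin

definition good_avoiding :: "'a set \<Rightarrow> bool" where
  "good_avoiding M \<longleftrightarrow> (\<exists>p b a q. distinct [p, b, a, q] \<and> E p b \<and> E a q \<and> side p = side a \<and>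
     good p b a q \<and> {p, b, a, q} \<inter> M = {})"

text \<open>Meant for cycles numbered so that the vertices to be avoided come last, beyond position
  \<open>t\<close>.\<close>

lemma cycle_good:
  assumes c: "cycle c n" and t: "3 \<le> t" "t < n" and M: "c ` {..t} \<inter> M = {}"
    and closed: "\<And>j l I. 0 < j \<Longrightarrow> j < t \<Longrightarrow> t < l \<Longrightarrow> l < n \<Longrightarrow> \<not> ear (c ` {..<n}) (c j) (c l) I"
  shows "good_avoiding M"
proof -
  have "\<exists>i. 0 \<le> i \<and> i + 3 \<le> t \<and> good (c i) (c (i + 1)) (c (i + 2)) (c (i + 3))"
    using t closed by (intro good_in_segment[OF c]) auto
  then obtain i where i: "i + 3 \<le> t" "good (c i) (c (i + 1)) (c (i + 2)) (c (i + 3))" by blast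
  have "E (c i) (c (i + 1))" "E (c (i + 2)) (c (i + 3))"
    using c i t by (auto simp: cycle_def numeral_3_eq_3)
  moreover have "distinct [c i, c (i + 1), c (i + 2), c (i + 3)]"
    using i t by (auto simp: cycle_eq_iff[OF c])
  moreover have "side (c i) = side (c (i + 2))"
    using i t cycle_side[OF c, of i] cycle_side[OF c, of "i + 2"] by auto
  moreover have "{c i, c (i + 1), c (i + 2), c (i + 3)} \<inter> M = {}"
    using M i by (auto simp: disjoint_iff)
  ultimately show ?thesis using i(2) unfolding good_avoiding_def by blast
qed

lemma cycle_good_disjoint: "cycle c n \<Longrightarrow> c ` {..<n} \<inter> M = {} \<Longrightarrow> good_avoiding M"
  by (rule cycle_good[of c n "n - 1"]) (use cycle_even[of c n] in \<open>auto simp: disjoint_iff\<close>)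

lemma cycle_rotate:
  assumes "cycle c n"
  shows "cycle (\<lambda>i. c ((i + k) mod n)) n"
proof -
  have n: "3 \<le> n" using assms by (simp add: cycle_def)
  have "inj_on (\<lambda>i. c ((i + k) mod n)) {..<n}"
  proof (rule linorder_inj_onI)
    fix i j assume ij: "i < j" "i \<in> {..<n}" "j \<in> {..<n}"
    have "(j + k) mod n \<noteq> (i + k) mod n"
    proof
      assume "(j + k) mod n = (i + k) mod n"
      hence "n dvd j - i" using ij mod_eq_dvd_iff_nat[of "i + k" "j + k" n] by simp
      thus False using ij by (auto dest: dvd_imp_le)
    qed
    thus "c ((i + k) mod n) \<noteq> c ((j + k) mod n)" using cycle_eq_iff[OF assms] n by auto
  qed auto
  moreover have step: "E (c (i mod n)) (c (Suc i mod n))" for i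
  proof (cases "Suc (i mod n) < n")
    case True
    thus ?thesis using assms by (auto simp: cycle_def mod_Suc)
  next
    case False
    moreover have "i mod n < n" using n by simp
    ultimately have "Suc (i mod n) = n" by linarith
    moreover from this have "i mod n = n - 1" by linarith
    ultimately show ?thesis using assms by (auto simp: cycle_def mod_Suc)
  qed
  moreover have "E (c ((n - 1 + k) mod n)) (c ((0 + k) mod n))"
  proof -
    have "Suc (n - 1 + k) = n + k" using n by simp
    thus ?thesis using step[of "n - 1 + k"] by simp
  qed
  ultimately show ?thesis using n unfolding cycle_def by simp
qed

lemma cycle_rotate_last:
  assumes "cycle c n" "m \<in> c ` {..<n}"
  obtains c' where "cycle c' n" "c' (n - 1) = m" "c' ` {..<n} = c ` {..<n}"
proof -
  obtain i where i: "i < n" "m = c i" using assms by auto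
  have n: "3 \<le> n" using assms by (simp add: cycle_def)
  let ?c = "\<lambda>j. c ((j + Suc i) mod n)"
  have c': "cycle ?c n" by (rule cycle_rotate[OF assms(1)])
  have "?c ` {..<n} = c ` {..<n}"
  proof (rule card_subset_eq)
    show "?c ` {..<n} \<subseteq> c ` {..<n}" using n by auto
    show "card (?c ` {..<n}) = card (c ` {..<n})"
      using c' assms(1) unfolding cycle_def by (simp add: card_image)
  qed simp
  moreover have "?c (n - 1) = m"
  proof -
    have "n - 1 + Suc i = i + n" using n by simp
    thus ?thesis using i by simp
  qed
  ultimately show thesis using that[OF c'] by simp
qed

text \<open>The walk avoids \<open>m\<close> and so closes up to a cycle through \<open>m\<close>.
  In a forest this cannot happen, which is how acyclicity enters below.\<close>

lemma cycle_at:
  assumes "E m u" "E m w" "u \<noteq> w" "reach S u w" "m \<in> S"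
  obtains c n where "cycle c n" "c (n - 1) = m" "c 0 = u" "c (n - 2) = w" "c ` {..<n - 1} \<inter> S = {}"
proof -
  obtain I where I: "successively E (u # I @ [w])" "distinct (u # I @ [w])" "set (u # I @ [w]) \<inter> S = {}"
    using reach_path[OF assms(4,3)] .
  define xs where "xs = u # I @ [w, m]"
  have xs: "xs = (u # I @ [w]) @ [m]" by (simp add: xs_def)
  let ?n = "length xs"
  have s: "successively E xs" unfolding xs successively_append_iff using I(1) sym[OF assms(2)] by simp
  have d: "distinct xs" unfolding xs using I(2,3) assms(5) by auto
  have "cycle ((!) xs) ?n"
    unfolding cycle_def
  proof (intro conjI allI impI)
    show "3 \<le> ?n" by (simp add: xs_def)
    show "inj_on ((!) xs) {..<?n}" using d by (auto simp: inj_on_def nth_eq_iff_index_eq)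
    show "E (xs ! i) (xs ! Suc i)" if "Suc i < ?n" for i
      using s that by (simp add: successively_conv_nth)
    show "E (xs ! (?n - 1)) (xs ! 0)" using assms(1) by (simp add: xs_def nth_append)
  qed
  moreover have "xs ! (?n - 1) = m" "xs ! 0 = u" "xs ! (?n - 2) = w"
    by (auto simp: xs_def nth_append)
  moreover have "(!) xs ` {..<?n - 1} \<inter> S = {}"
  proof -
    have "xs ! i \<in> set (u # I @ [w])" if "i < ?n - 1" for i
      using that unfolding xs by (metis One_nat_def Suc_pred add_diff_cancel_right' length_append
        length_append_singleton nth_append nth_mem diff_Suc_1)
    thus ?thesis using I(3) by blast
  qed
  ultimately show thesis using that by blast
qed

lemma path_side: "successively E hs \<Longrightarrow> i < length hs \<Longrightarrow> side (hs ! i) = (side (hs ! 0) = even i)"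
proof (induction i)
  case (Suc i)
  hence "E (hs ! i) (hs ! Suc i)" by (simp add: successively_conv_nth)
  from bip[OF this] Suc show ?case by auto
qed simp

lemma path_neighbours:
  assumes "successively E hs" "1 \<le> k" "k + 1 < length hs"
  shows "E (hs ! k) (hs ! (k - 1))" "E (hs ! k) (hs ! (k + 1))"
proof -
  show "E (hs ! k) (hs ! (k - 1))" using assms sym by (cases k) (auto simp: successively_conv_nth)
  show "E (hs ! k) (hs ! (k + 1))" using assms by (auto simp: successively_conv_nth)
qed

lemma reach_nth_upto:
  assumes "successively E hs" "i \<le> j" "j < length hs" "\<And>k. i \<le> k \<Longrightarrow> k \<le> j \<Longrightarrow> hs ! k \<notin> S"
  shows "reach S (hs ! i) (hs ! j)"
proof (rule reach_list[of "map ((!) hs) [i..<Suc j]"])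
  show "successively E (map ((!) hs) [i..<Suc j])"
    using assms by (intro successively_map_upt) (auto simp: successively_conv_nth)
qed (use assms in \<open>auto simp del: upt_Suc\<close>)

section \<open>Good quadruples in forests\<close>

lemma good_or_cycle:
  assumes hs: "successively E hs" "distinct hs" and ab: "a + 2 \<le> b" "b + 1 < length hs"
  shows "good (hs ! a) (hs ! (a + 1)) (hs ! b) (hs ! (b + 1)) \<or> (\<exists>c n. cycle c n)"
proof -
  have eq: "hs ! i = hs ! j \<longleftrightarrow> i = j" if "i < length hs" "j < length hs" for i j
    using hs(2) that by (simp add: nth_eq_iff_index_eq)
  have step: "E (hs ! i) (hs ! (i + 1))" "E (hs ! (i + 1)) (hs ! i)" if "i + 1 < length hs" for i
    using hs(1) that sym by (auto simp: successively_conv_nth)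
  \<comment> \<open>The walk bypasses \<open>hs ! (a + 1)\<close>: with the rest of the path it
    joins the two path neighbours of that vertex and so closes a cycle through it. The other
    condition is treated in the same way at \<open>hs ! b\<close>.\<close>
  have False if "reach {hs ! (a + 1), hs ! (b + 1)} (hs ! a) (hs ! b)" "\<nexists>c n. cycle c n"
  proof -
    have "reach {hs ! (a + 1)} (hs ! a) (hs ! b)" using that(1) by (rule reach_mono) simp
    moreover have "reach {hs ! (a + 1)} (hs ! (a + 2)) (hs ! b)"
      using ab by (intro reach_nth_upto[OF hs(1)]) (auto simp: eq)
    ultimately have "reach {hs ! (a + 1)} (hs ! a) (hs ! (a + 2))" by (meson reach_sym reach_trans)
    moreover have "E (hs ! (a + 1)) (hs ! a)" "E (hs ! (a + 1)) (hs ! (a + 2))"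
      using step[of a] step[of "a + 1"] ab by auto
    moreover have "hs ! a \<noteq> hs ! (a + 2)" using ab by (simp add: eq)
    ultimately show False using that(2) cycle_at by (metis insertI1)
  qed
  moreover have False if "reach {hs ! a, hs ! b} (hs ! (a + 1)) (hs ! (b + 1))" "\<nexists>c n. cycle c n"
  proof -
    have "reach {hs ! b} (hs ! (a + 1)) (hs ! (b + 1))" using that(1) by (rule reach_mono) simp
    moreover have "reach {hs ! b} (hs ! (a + 1)) (hs ! (b - 1))"
      using ab by (intro reach_nth_upto[OF hs(1)]) (auto simp: eq)
    ultimately have "reach {hs ! b} (hs ! (b - 1)) (hs ! (b + 1))" by (meson reach_sym reach_trans)
    moreover have "E (hs ! b) (hs ! (b - 1))" "E (hs ! b) (hs ! (b + 1))"
      using step[of "b - 1"] step[of b] ab by auto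
    moreover have "hs ! (b - 1) \<noteq> hs ! (b + 1)" using ab by (simp add: eq)
    ultimately show False using that(2) cycle_at by (metis insertI1)
  qed
  ultimately show ?thesis unfolding good_def by blast
qed

lemma good_avoiding_on_path:
  assumes hs: "successively E hs" "distinct hs" and ab: "a + 2 \<le> b" "b + 1 < length hs" "even (b - a)"
    and M: "{hs ! a, hs ! (a + 1), hs ! b, hs ! (b + 1)} \<inter> M = {}" and "\<nexists>c n. cycle c n"
  shows "good_avoiding M"
proof -
  have "good (hs ! a) (hs ! (a + 1)) (hs ! b) (hs ! (b + 1))"
    using good_or_cycle[OF hs ab(1,2)] assms(7) by blast
  moreover have "E (hs ! a) (hs ! (a + 1))" "E (hs ! b) (hs ! (b + 1))"
    using hs(1) ab by (auto simp: successively_conv_nth)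
  moreover have "distinct [hs ! a, hs ! (a + 1), hs ! b, hs ! (b + 1)]"
    using hs(2) ab by (auto simp: nth_eq_iff_index_eq)
  moreover have "side (hs ! a) = side (hs ! b)"
    using path_side[OF hs(1), of a] path_side[OF hs(1), of b] ab by auto
  ultimately show ?thesis using M unfolding good_avoiding_def by blast
qed

text \<open>A walk violating \<open>good\<close> joins one end of each edge and avoids the other two
  ends; adding both edges gives a path. The joined ends agree in side, so the number of vertices is
  odd. Only the union of the end edges is recorded, because either pair of ends may be the joined
  one.\<close>

lemma good_or_path:
  assumes e: "E p b" "E a q" "distinct [p, b, a, q]" and side: "side p = side a" and M: "{p, b, a, q} \<inter> M = {}"
  shows "good_avoiding M \<or> (\<exists>hs. successively E hs \<and> distinct hs \<and> 5 \<le> length hs \<and> odd (length hs) \<and>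
     {hs ! 0, hs ! 1} \<union> {hs ! (length hs - 2), hs ! (length hs - 1)} = {p, b, a, q})"
proof -
  have main: "\<exists>hs. successively E hs \<and> distinct hs \<and> 5 \<le> length hs \<and> odd (length hs) \<and>
     {hs ! 0, hs ! 1} \<union> {hs ! (length hs - 2), hs ! (length hs - 1)} = {p, b, a, q}"
    if "E p b" "E a q" "distinct [p, b, a, q]" "side p = side a" "reach {b, q} p a" for p b a q
  proof -
    have "p \<noteq> a" using that(3) by simp
    with that(5) obtain I where I: "successively E (p # I @ [a])" "distinct (p # I @ [a])"
      "set (p # I @ [a]) \<inter> {b, q} = {}" by (rule reach_path)
    let ?hs = "b # p # I @ [a, q]"
    have s: "successively E ?hs"
      using path_glue[OF I(1), of "[]" q] sym[OF that(1)] that(2) by (simp add: successively_Cons)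
    moreover have "distinct ?hs" using I that(3) by auto
    moreover have "odd (length ?hs)"
      using path_side[OF s, of 1] path_side[OF s, of "length I + 2"] that(4) by (auto simp: nth_append)
    moreover from this have "I \<noteq> []" by auto
    hence "5 \<le> length ?hs" by (cases I) auto
    moreover have "{?hs ! 0, ?hs ! 1} \<union> {?hs ! (length ?hs - 2), ?hs ! (length ?hs - 1)} = {p, b, a, q}"
      by (auto simp: nth_append)
    ultimately show ?thesis by blast
  qed
  show ?thesis
  proof (cases "good p b a q")
    case True
    thus ?thesis using assms unfolding good_avoiding_def by blast
  next
    case False
    then consider "reach {b, q} p a" | "reach {p, a} b q" unfolding good_def by blast
    thus ?thesis
    proof cases
      case 1
      with main[OF e(1,2,3) side] show ?thesis by blast
    next
      case 2
      have "side b = side q" using bip[OF e(1)] bip[OF e(2)] side by auto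
      with main[of b p q a] 2 e sym show ?thesis by (simp add: insert_commute) blast
    qed
  qed
qed

lemma disjoint_edges_same_side:
  assumes "E p b" "E a q" "distinct [p, b, a, q]" "{p, b, a, q} \<inter> M = {}"
  obtains a' q' where "E p b" "E a' q'" "distinct [p, b, a', q']" "side p = side a'" "{p, b, a', q'} = {p, b, a, q}"
proof (cases "side p = side a")
  case True
  thus thesis using that assms by blast
next
  case False
  hence "side p = side q" using bip[OF assms(2)] by auto
  moreover have "E q a" "distinct [p, b, q, a]" "{p, b, q, a} = {p, b, a, q}" using assms sym by auto
  ultimately show thesis using that assms(1) by blast
qed

theorem good_pair_exists:
  assumes "E p b" "E a q" "distinct [p, b, a, q]"
  shows "good_avoiding {}"
proof (cases "\<exists>c n. cycle c n")
  case True
  thus ?thesis using cycle_good_disjoint by blast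
next
  case False
  obtain a' q' where e: "E p b" "E a' q'" "distinct [p, b, a', q']" "side p = side a'"
    by (rule disjoint_edges_same_side[OF assms, of "{}"]) auto
  from good_or_path[OF this, of "{}"] show ?thesis
  proof
    assume "\<exists>hs. successively E hs \<and> distinct hs \<and> 5 \<le> length hs \<and> odd (length hs) \<and>
      {hs ! 0, hs ! 1} \<union> {hs ! (length hs - 2), hs ! (length hs - 1)} = {p, b, a', q'}"
    then obtain hs where "successively E hs" "distinct hs" "5 \<le> length hs" by blast
    \<comment> \<open>The first and the third edge of the path; without cycles they are
      automatically good.\<close>
    with good_avoiding_on_path[of hs 0 2] False show ?thesis by auto
  qed auto
qed

section \<open>Avoiding vertices of degree two\<close>

lemma no_ear_at_degree_two:
  assumes c: "cycle c n" and "0 < j" "j < t" "t < l" "l < n"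
    and deg: "\<And>z. E (c l) z \<Longrightarrow> z = c (l - 1) \<or> z = c (Suc l mod n)"
  shows "\<not> ear (c ` {..<n}) (c j) (c l) I"
proof
  assume ear: "ear (c ` {..<n}) (c j) (c l) I"
  have n: "Suc l mod n < n" using assms by simp
  have C: "c (l - 1) \<in> c ` {..<n}" "c (Suc l mod n) \<in> c ` {..<n}" using assms n by auto
  have s: "successively E (c j # I @ [c l])" "set I \<inter> c ` {..<n} = {}" using ear by (auto simp: ear_def)
  \<comment> \<open>The edge of the ear at \<open>c l\<close> leads to a cycle neighbour of
    \<open>c l\<close>, so it is the whole ear. But neither neighbour of position \<open>l\<close>
    lies strictly between 0 and \<open>t\<close>.\<close>
  show False
  proof (cases "I = []")
    case True
    hence "E (c l) (c j)" using s sym by auto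
    hence "j = l - 1 \<or> j = Suc l mod n"
      using deg[of "c j"] cycle_eq_iff[OF c, of j "l - 1"] cycle_eq_iff[OF c, of j "Suc l mod n"] assms n by auto
    moreover have "Suc l mod n = 0 \<or> Suc l mod n = Suc l" using assms by (auto simp: mod_Suc)
    ultimately show False using assms by linarith
  next
    case False
    have "successively E ((c j # I) @ [c l])" using s by simp
    hence "E (last I) (c l)" using False unfolding successively_append_iff by simp
    with deg[OF sym[OF this]] C s(2) last_in_set[OF False] show False by auto
  qed
qed

lemma reach_exit:
  assumes "reach {} p c" "p \<notin> C" "c \<in> C"
  obtains d c' where "reach C p d" "d \<notin> C" "c' \<in> C" "E d c'"
proof -
  from assms(1,2) have "\<exists>d c'. reach C p d \<and> d \<notin> C \<and> c' \<in> C \<and> E d c'"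
    unfolding reach_def[of "{}"]
  proof (induction rule: converse_rtranclp_induct)
    case base
    with assms(3) show ?case by simp
  next
    case (step y z)
    show ?case
    proof (cases "z \<in> C")
      case True
      with step show ?thesis by (intro exI[of _ y] exI[of _ z]) auto
    next
      case False
      with step obtain d c' where "reach C z d" "d \<notin> C" "c' \<in> C" "E d c'" by blast
      moreover have "reach C y z" using step False by (intro reach_step) auto
      ultimately show ?thesis by (meson reach_trans)
    qed
  qed
  thus thesis using that by blast
qed

text \<open>A cycle missing \<open>m\<close> already contains a good quadruple. On a cycle through
  \<open>m\<close>, put \<open>m\<close> last: having degree two it receives no ear from inside, so
  the other \<open>n - 1\<close> positions form a closed segment, which is long enough unless
  \<open>n = 4\<close>.\<close>

lemma short_cycle_through:
  assumes c: "cycle c n" and avoid: "\<not> good_avoiding {m}"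
    and m: "E m u" "E m w" "\<And>z. E m z \<Longrightarrow> z = u \<or> z = w"
  shows "n = 4 \<and> {m, u, w} \<subseteq> c ` {..<n}"
proof -
  have "m \<in> c ` {..<n}" using cycle_good_disjoint[OF c, of "{m}"] avoid by auto
  then obtain d where d: "cycle d n" "d (n - 1) = m" "d ` {..<n} = c ` {..<n}"
    using cycle_rotate_last[OF c] by metis
  have n: "even n" "4 \<le> n" using cycle_even[OF c] .
  have "E (d (n - 2)) (d (Suc (n - 2)))" "E (d (n - 1)) (d 0)"
    using d(1) n unfolding cycle_def by auto
  moreover have "Suc (n - 2) = n - 1" using n by simp
  ultimately have nb: "E m (d (n - 2))" "E m (d 0)" using d(2) sym by auto
  have "d (n - 2) \<noteq> d 0" using cycle_eq_iff[OF d(1), of "n - 2" 0] n by auto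
  hence uw: "{u, w} = {d (n - 2), d 0}" using m(3)[OF nb(1)] m(3)[OF nb(2)] by auto
  have "n < 6"
  proof (rule ccontr)
    assume "\<not> n < 6"
    hence "good_avoiding {m}"
    proof (intro cycle_good[OF d(1), of "n - 2"])
      show "d ` {..n - 2} \<inter> {m} = {}"
        using d(2) cycle_eq_iff[OF d(1), of _ "n - 1"] n by fastforce
      fix j l I assume jl: "0 < j" "j < n - 2" "n - 2 < l" "l < n"
      hence l: "l = n - 1" by simp
      show "\<not> ear (d ` {..<n}) (d j) (d l) I"
      proof (rule no_ear_at_degree_two[OF d(1) jl])
        fix z assume "E (d l) z"
        hence "z \<in> {d (n - 2), d 0}" using l d(2) m(3) uw by auto
        thus "z = d (l - 1) \<or> z = d (Suc l mod n)" using l n by (auto simp: numeral_2_eq_2)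
      qed
    qed auto
    with avoid show False by simp
  qed
  with n have "n = 4" by presburger
  moreover have "{m, u, w} \<subseteq> d ` {..<n}"
  proof -
    have "d (n - 1) \<in> d ` {..<n}" "d (n - 2) \<in> d ` {..<n}" "d 0 \<in> d ` {..<n}" using n by auto
    moreover have "u \<in> {d (n - 2), d 0}" "w \<in> {d (n - 2), d 0}" unfolding uw[symmetric] by simp_all
    ultimately show ?thesis unfolding d(2)[symmetric] by auto
  qed
  ultimately show ?thesis using d(3) by simp
qed

text \<open>The walk yields a cycle through \<open>b\<close> and its neighbours \<open>p\<close> and
  \<open>a\<close>, which must be a 4-cycle through \<open>m\<close>, \<open>u\<close>,
  \<open>w\<close>; \<open>z\<close> is its fourth vertex, the only free place.\<close>

lemma no_third_route:
  assumes avoid: "\<not> good_avoiding {m}"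
    and m: "E m u" "E m w" "\<And>z. E m z \<Longrightarrow> z = u \<or> z = w" "u \<noteq> w"
    and b: "E b p" "E b a" "p \<noteq> a" and reach: "reach S p a" "b \<in> S"
  shows "\<exists>z. {m, u, w} \<subseteq> {p, z, a, b}"
proof -
  obtain c n where c: "cycle c n" "c (n - 1) = b" "c 0 = p" "c (n - 2) = a"
    using cycle_at[OF b reach] by metis
  have n: "n = 4" and sub: "{m, u, w} \<subseteq> c ` {..<n}"
    using short_cycle_through[OF c(1) avoid m(1-3)] by auto
  have "{..<n} = {0, 1, 2, 3}" using n by auto
  hence "c ` {..<n} = {p, c 1, a, b}" using c n by simp
  with sub show ?thesis by auto
qed

text \<open>The given edges avoid \<open>u\<close> besides \<open>m\<close>, but may use
  \<open>w\<close>. In a forest they provide a path with enough room around \<open>m\<close>.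
  Otherwise every cycle is a 4-cycle containing \<open>m\<close>, \<open>u\<close>,
  \<open>w\<close>, and the given edges are located relative to one of these.\<close>

theorem good_pair_avoiding_degree_two:
  assumes m: "E m u" "E m w" "u \<noteq> w" "\<And>z. E m z \<Longrightarrow> z = u \<or> z = w"
    and e: "E p b" "E a q" "distinct [p, b, a, q]" "{p, b, a, q} \<inter> {m, u} = {}"
  shows "good_avoiding {m}"
proof (rule ccontr)
  assume avoid: "\<not> good_avoiding {m}"
  note short = short_cycle_through[OF _ avoid m(1,2,4)]
  have route: "\<exists>z. {m, u, w} \<subseteq> {p, z, a, b}"
    if "E b p" "E b a" "p \<noteq> a" "reach S p a" "b \<in> S" for b p a S
    using no_third_route[OF avoid m(1,2) _ m(3) that] m(4) by blast
  have mu: "m \<noteq> u" "m \<noteq> w" using m bip by auto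
  show False
  proof (cases "\<exists>c n. cycle c n")
    case False
    obtain a' q' where e': "E p b" "E a' q'" "distinct [p, b, a', q']" "side p = side a'"
      "{p, b, a', q'} = {p, b, a, q}" using disjoint_edges_same_side[OF e] .
    have "{p, b, a', q'} \<inter> {m} = {}" using e(4) e'(5) by auto
    from good_or_path[OF e'(1-4) this] avoid obtain hs where
      hs: "successively E hs" "distinct hs" "5 \<le> length hs" "odd (length hs)" and
      ends: "{hs ! 0, hs ! 1} \<union> {hs ! (length hs - 2), hs ! (length hs - 1)} = {p, b, a, q}"
      unfolding e'(5) by blast
    have eq: "hs ! i = hs ! j \<longleftrightarrow> i = j" if "i < length hs" "j < length hs" for i j
      using hs(2) that by (simp add: nth_eq_iff_index_eq)
    note pair = good_avoiding_on_path[OF hs(1,2) _ _ _ _ False, of _ _ "{m}"]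
    have mu_ends: "{m, u} \<inter> {hs ! 0, hs ! 1, hs ! (length hs - 2), hs ! (length hs - 1)} = {}"
      using ends e(4) by auto
    have "m \<in> {hs ! 0, hs ! 1, hs ! 2, hs ! 3}"
      using pair[of 0 2] avoid hs(3) by (auto simp: eval_nat_numeral)
    then obtain k where "k \<in> {0, 1, 2, 3}" "m = hs ! k" by blast
    hence k: "k < 4" "m = hs ! k" by auto
    have "hs ! k \<notin> {hs ! 0, hs ! 1, hs ! (length hs - 2), hs ! (length hs - 1)}" using mu_ends k by auto
    hence "k \<noteq> 0" "k \<noteq> 1" "k \<noteq> length hs - 2" "k \<noteq> length hs - 1" by (metis insertCI)+
    hence k2: "k = 2 \<or> k = 3" "k + 2 < length hs" using k hs(3) by linarith+
    have "E m (hs ! (k - 1))" "E m (hs ! (k + 1))"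
      using path_neighbours[OF hs(1), of k] k2 k(2) by auto
    moreover have "hs ! (k - 1) \<noteq> hs ! (k + 1)" using k2 by (auto simp: eq)
    ultimately have "u = hs ! (k - 1) \<or> u = hs ! (k + 1)" using m(4) by metis
    \<comment> \<open>On five vertices \<open>m\<close> would be in the middle and its path
      neighbour \<open>u\<close> would lie on an end edge.\<close>
    with mu_ends k2 hs(3,4) have "length hs \<noteq> 5" by auto
    hence "7 \<le> length hs" "hs \<noteq> []" using hs(3,4) by (presburger, auto)
    \<comment> \<open>\<open>m\<close> has position 2 or 3; the edges starting at positions 0 and 4
      step around it.\<close>
    hence "m \<in> {hs ! 0, hs ! 1, hs ! 4, hs ! 5}"
      using pair[of 0 4] avoid by auto
    thus False using k k2 \<open>7 \<le> length hs\<close> \<open>hs \<noteq> []\<close> by (auto simp: eq)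
  next
    case True
    then obtain c0 n0 where c0: "cycle c0 n0" by blast
    have "n0 = 4" "m \<in> c0 ` {..<n0}" using short[OF c0] by auto
    with c0 obtain c where c: "cycle c 4" "c (4 - 1) = m" by (metis cycle_rotate_last)
    hence c: "cycle c 4" "c 3 = m" by auto
    have cE: "E (c 0) (c 1)" "E (c 1) (c 2)" "E (c 2) m" "E m (c 0)"
      using c unfolding cycle_def by (auto simp: numeral_2_eq_2 numeral_3_eq_3)
    have "c 0 \<noteq> c 2" "c 1 \<noteq> m" using cycle_eq_iff[OF c(1)] c(2) by auto
    \<comment> \<open>The vertex opposite \<open>m\<close> on the 4-cycle.\<close>
    define z where "z = c 1"
    have uw: "{u, w} = {c 0, c 2}" using m(4) cE sym \<open>c 0 \<noteq> c 2\<close> by blast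
    hence zE: "E u z" "E w z" using cE sym unfolding z_def by (auto simp: doubleton_eq_iff)
    have z: "z \<noteq> m" "z \<noteq> u" "z \<noteq> w" using \<open>c 1 \<noteq> m\<close> zE bip unfolding z_def by auto
    define C where "C = {u, w, z, m}"
    \<comment> \<open>If the edge lies in another component than \<open>u z\<close>, these two edges
      are good. Otherwise some walk enters \<open>C\<close> by an edge \<open>d c'\<close>, where
      \<open>d\<close> has a neighbour \<open>d'\<close> off \<open>C\<close>; then
      \<open>d' d\<close> and an edge \<open>c' x\<close> of the path \<open>u z w\<close> are good,
      since a violation would give a 4-cycle without room for all of \<open>m\<close>,
      \<open>u\<close>, \<open>w\<close>.\<close>
    have outside: False if g: "E g g'" "g \<notin> C" "g' \<notin> C" for g g'
    proof -
      have conn: "reach {} g u" if g: "E g g'" "g \<notin> C" "g' \<notin> C" "side g = side u" for g g'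
      proof (rule ccontr)
        assume *: "\<not> reach {} g u"
        have "\<not> reach {g', z} g u" using * reach_mono by blast
        moreover have "\<not> reach {g, u} g' z"
        proof
          assume "reach {g, u} g' z"
          hence "reach {} g' z" by (rule reach_mono) simp
          with * show False using reach_step[OF g(1), of "{}"] reach_step[OF zE(1), of "{}"]
            by (meson reach_sym reach_trans empty_iff)
        qed
        ultimately have "good_avoiding {m}"
          unfolding good_avoiding_def good_def using g zE z mu
          by (intro exI[of _ g] exI[of _ g'] exI[of _ u] exI[of _ z]) (auto simp: C_def dest: bip)
        with avoid show False ..
      qed
      have "reach {} g u"
      proof (cases "side g = side u")
        case False
        hence "side g' = side u" using bip[OF g(1)] by auto
        with conn[OF sym[OF g(1)] g(3,2)] have "reach {} g' u" by simp
        thus ?thesis using reach_step[OF g(1), of "{}"] by (meson reach_trans empty_iff)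
      qed (use conn[OF g] in simp)
      then obtain d c' where d: "reach C g d" "d \<notin> C" "c' \<in> C" "E d c'"
        using g(2) by (rule reach_exit[of g u C]) (auto simp: C_def)
      have "\<exists>d'. E d d' \<and> d' \<notin> C"
      proof (cases "g = d")
        case True
        thus ?thesis using g by auto
      next
        case False
        with d(1) show ?thesis unfolding reach_def by (metis (mono_tags, lifting) rtranclp.cases sym)
      qed
      then obtain d' where d': "E d d'" "d' \<notin> C" by blast
      have "c' \<noteq> m" using m(4) d sym by (auto simp: C_def)
      then have "c' = u \<or> c' = w \<or> c' = z" using d(3) by (auto simp: C_def)
      hence "\<exists>x. E c' x \<and> x \<in> C \<and> x \<noteq> m \<and> ({x, c'} = {u, z} \<or> {x, c'} = {w, z})"
        using zE z mu sym[OF zE(1)] unfolding C_def by (elim disjE) (metis insertCI insert_commute)+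
      then obtain x where x: "E c' x" "x \<in> C" "x \<noteq> m" "{x, c'} = {u, z} \<or> {x, c'} = {w, z}" by blast
      have "\<not> reach {d, x} d' c'"
      proof
        assume "reach {d, x} d' c'"
        from route[OF d'(1) d(4) _ this] d(2,3) d'(2) show False
          using \<open>c' \<noteq> m\<close> mu m(3) by (auto simp: C_def)
      qed
      moreover have "\<not> reach {d', c'} d x"
      proof
        assume "reach {d', c'} d x"
        from route[OF sym[OF d(4)] x(1) _ this] d(2,3) d'(2) x show False
          using \<open>c' \<noteq> m\<close> mu m(3) z by (auto simp: C_def doubleton_eq_iff)
      qed
      moreover have "side d' = side c'" using bip[OF d'(1)] bip[OF d(4)] by auto
      moreover have "distinct [d', d, c', x]" using d d' x bip[OF d'(1)] bip[OF x(1)] by auto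
      moreover have "m \<in> C" by (simp add: C_def)
      hence "{d', d, c', x} \<inter> {m} = {}" using \<open>c' \<noteq> m\<close> x d d' by auto
      ultimately have "good_avoiding {m}"
        unfolding good_avoiding_def good_def using sym[OF d'(1)] x(1) by blast
      with avoid show False ..
    qed
    \<comment> \<open>A violating walk would give a 4-cycle in which \<open>m\<close> and
      \<open>u\<close> compete for a single free place.\<close>
    have final: False if s: "E w s" "E z s'" "distinct [s, w, z, s']" "{s, s'} \<inter> {m, u} = {}" for s s'
    proof -
      have "\<not> reach {w, s'} s z"
      proof
        assume "reach {w, s'} s z"
        from route[OF s(1) zE(2) _ this] s mu m(3) z show False by auto
      qed
      moreover have "\<not> reach {s, z} w s'"
      proof
        assume "reach {s, z} w s'"
        from route[OF sym[OF zE(2)] s(2) _ this] s mu m(3) z show False by auto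
      qed
      moreover have "side s = side z" using bip[OF s(1)] bip[OF zE(2)] by auto
      moreover have "{s, w, z, s'} \<inter> {m} = {}" using s mu z by auto
      ultimately have "good_avoiding {m}"
        unfolding good_avoiding_def good_def using sym[OF s(1)] s(2,3) by blast
      with avoid show False ..
    qed
    \<comment> \<open>Both edges meet \<open>C\<close> by \<open>outside\<close> but avoid
      \<open>m\<close> and \<open>u\<close>; being disjoint, one of them contains \<open>w\<close>
      and the other \<open>z\<close>, which is the situation of \<open>final\<close>.\<close>
    have meet1: "p \<in> {w, z} \<or> b \<in> {w, z}" and meet2: "a \<in> {w, z} \<or> q \<in> {w, z}"
      using outside[OF e(1)] outside[OF e(2)] e(4) by (auto simp: C_def)
    have oriented: False
      if "E p b" "E a q" "distinct [p, b, a, q]" "{p, b, a, q} \<inter> {m, u} = {}" "p \<in> {w, z}" "a \<in> {w, z}" for p b a q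
      using that final[of b q] final[of q b] by auto
    note e' = sym[OF e(1)] sym[OF e(2)]
    from meet1 meet2 show False
      using oriented[OF e] oriented[of b p a q] oriented[of p b q a] oriented[of b p q a] e e'
      by (elim disjE) auto
  qed
qed

text \<open>Suppose there is no such quadruple. A cycle through \<open>m\<close> or
  \<open>m'\<close> contains both, and without them it is a closed segment of \<open>n - 2\<close>
  vertices, long enough because \<open>n = 4\<close> would make \<open>u\<close> and
  \<open>w\<close> adjacent. So there are no cycles at all, and two edges must be placed on a path
  around two consecutive vertices.\<close>

theorem good_pair_avoiding_degree_two_edge:
  assumes m: "E m u" "E m m'" "\<And>z. E m z \<Longrightarrow> z = u \<or> z = m'" "u \<noteq> m'"
    and m': "E m' w" "\<And>z. E m' z \<Longrightarrow> z = w \<or> z = m" "w \<noteq> m" "\<not> E u w"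
    and e: "E p b" "E a q" "distinct [p, b, a, q]" "{p, b, a, q} \<inter> {m, m'} = {}"
  shows "good_avoiding {m, m'}"
proof (rule ccontr)
  assume avoid: "\<not> good_avoiding {m, m'}"
  have no_cycle: False if c: "cycle c n" "m = c (n - 1) \<and> m' = c (n - 2) \<or> m' = c (n - 1) \<and> m = c (n - 2)" for c n
  proof -
    have n: "even n" "4 \<le> n" using cycle_even[OF c(1)] .
    have E: "E (c i) (c (Suc i))" if "Suc i < n" for i using c(1) that by (auto simp: cycle_def)
    have Ew: "E (c (n - 1)) (c 0)" using c(1) by (auto simp: cycle_def)
    have s: "Suc (n - 2) = n - 1" "Suc (n - 3) = n - 2" using n by auto
    have E3: "E (c (n - 2)) (c (n - 3))" using E[of "n - 3"] s n sym by auto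
    have ne: "c 0 \<noteq> c (n - 2)" "c (n - 3) \<noteq> c (n - 1)"
      using cycle_eq_iff[OF c(1)] n by auto
    have nbr1: "z = c (n - 2) \<or> z = c 0" if "E (c (n - 1)) z" for z
      using c(2) m(3)[of z] m(3)[of "c 0"] m'(2)[of z] m'(2)[of "c 0"] Ew ne that by metis
    have nbr2: "z = c (n - 1) \<or> z = c (n - 3)" if "E (c (n - 2)) z" for z
      using c(2) m(3)[of z] m(3)[of "c (n - 3)"] m'(2)[of z] m'(2)[of "c (n - 3)"] E3 ne that by metis
    have "{c 0, c (n - 3)} = {u, w}"
      using c(2) m(3)[of "c 0"] m'(2)[of "c 0"] m(3)[of "c (n - 3)"] m'(2)[of "c (n - 3)"] Ew E3 ne by auto
    hence "n \<noteq> 4" using E[of 0] m'(4) sym by (auto simp: doubleton_eq_iff)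
    hence "6 \<le> n" using n by presburger
    have "good_avoiding {m, m'}"
    proof (rule cycle_good[OF c(1), of "n - 3"])
      show "c ` {..n - 3} \<inter> {m, m'} = {}"
        using c(2) cycle_eq_iff[OF c(1), of _ "n - 1"] cycle_eq_iff[OF c(1), of _ "n - 2"] n by fastforce
      fix j l I assume jl: "0 < j" "j < n - 3" "n - 3 < l" "l < n"
      hence l: "l = n - 1 \<or> l = n - 2" by linarith
      show "\<not> ear (c ` {..<n}) (c j) (c l) I"
      proof (rule no_ear_at_degree_two[OF c(1) jl])
        fix z assume "E (c l) z"
        from l show "z = c (l - 1) \<or> z = c (Suc l mod n)"
        proof
          assume l: "l = n - 1"
          hence "l - 1 = n - 2" "Suc l mod n = 0" using n by auto
          with nbr1 \<open>E (c l) z\<close> l show ?thesis by auto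
        next
          assume l: "l = n - 2"
          hence "l - 1 = n - 3" "Suc l mod n = n - 1" using n s by auto
          with nbr2 \<open>E (c l) z\<close> l show ?thesis by auto
        qed
      qed
    qed (use \<open>6 \<le> n\<close> in auto)
    with avoid show False ..
  qed
  \<comment> \<open>With \<open>x\<close> in the last place its partner has position
    \<open>n - 2\<close> or 0; in the latter case one more rotation brings both to the last two
    places.\<close>
  have no_m: False if c0: "cycle c0 n" and x: "x \<in> c0 ` {..<n}"
    and nbr: "E x y" "E x y'" "\<And>z. E x z \<Longrightarrow> z = y \<or> z = y'" "{x, y'} = {m, m'}" for c0 n x y y'
  proof -
    obtain c where c: "cycle c n" "c (n - 1) = x" using cycle_rotate_last[OF c0 x] by metis
    have n: "4 \<le> n" using cycle_even[OF c(1)] by simp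
    have s: "Suc (n - 2) = n - 1" using n by auto
    have E: "E x (c (n - 2))" "E x (c 0)"
      using c n sym s unfolding cycle_def by (auto simp: Suc_diff_Suc) (metis diff_less less_le_trans zero_less_numeral s Suc_1 One_nat_def diff_less_Suc lessI)
    have "c 0 \<noteq> c (n - 2)" using cycle_eq_iff[OF c(1)] n by auto
    hence "y' = c (n - 2) \<or> y' = c 0" using nbr(3)[OF E(1)] nbr(3)[OF E(2)] by auto
    thus False
    proof
      assume "y' = c (n - 2)"
      with no_cycle[OF c(1)] c(2) nbr(4) show False by (auto simp: doubleton_eq_iff)
    next
      assume y': "y' = c 0"
      let ?d = "\<lambda>i. c ((i + 1) mod n)"
      have "(n - 1 + 1) mod n = 0" "(n - 2 + 1) mod n = n - 1" using n s by auto
      hence "?d (n - 1) = y'" "?d (n - 2) = x" using y' c(2) by auto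
      with no_cycle[OF cycle_rotate[OF c(1), of 1]] nbr(4) show False by (auto simp: doubleton_eq_iff)
    qed
  qed
  have False: "\<nexists>c n. cycle c n"
  proof
    assume "\<exists>c n. cycle c n"
    then obtain c n where c: "cycle c n" by blast
    with cycle_good_disjoint[of c n "{m, m'}"] avoid have "m \<in> c ` {..<n} \<or> m' \<in> c ` {..<n}" by auto
    thus False using no_m[OF c, of m u m'] no_m[OF c, of m' w m] m m' sym by (auto simp: insert_commute)
  qed
  obtain a' q' where e': "E p b" "E a' q'" "distinct [p, b, a', q']" "side p = side a'"
    "{p, b, a', q'} = {p, b, a, q}" using disjoint_edges_same_side[OF e] .
  have "{p, b, a', q'} \<inter> {m, m'} = {}" using e(4) e'(5) by auto
  from good_or_path[OF e'(1-4) this] avoid obtain hs where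
    hs: "successively E hs" "distinct hs" "5 \<le> length hs" "odd (length hs)" and
    ends: "{hs ! 0, hs ! 1} \<union> {hs ! (length hs - 2), hs ! (length hs - 1)} = {p, b, a, q}"
    unfolding e'(5) by blast
  have eq: "hs ! i = hs ! j \<longleftrightarrow> i = j" if "i < length hs" "j < length hs" for i j
    using hs(2) that by (simp add: nth_eq_iff_index_eq)
  note pair = good_avoiding_on_path[OF hs(1,2) _ _ _ _ False, of _ _ "{m, m'}"]
  have m_ends: "{m, m'} \<inter> {hs ! 0, hs ! 1, hs ! (length hs - 2), hs ! (length hs - 1)} = {}"
    using ends e(4) by auto
  have interior: "2 \<le> k \<and> k + 2 < length hs" if "k < length hs" "hs ! k \<in> {m, m'}" for k
  proof -
    have "hs ! k \<notin> {hs ! 0, hs ! 1, hs ! (length hs - 2), hs ! (length hs - 1)}" using m_ends that by auto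
    hence "k \<noteq> 0" "k \<noteq> 1" "k \<noteq> length hs - 2" "k \<noteq> length hs - 1" by (metis insertCI)+
    thus ?thesis using that hs(3) by linarith
  qed
  have next_to: "y' = hs ! (k - 1) \<or> y' = hs ! (k + 1)"
    if "k < length hs" "hs ! k = x" "x \<in> {m, m'}" "\<And>z. E x z \<Longrightarrow> z = y \<or> z = y'" for k x y y'
  proof -
    have k: "2 \<le> k" "k + 2 < length hs" using interior[of k] that by auto
    have "Suc (k - 1) = k" using k by simp
    hence "E x (hs ! (k - 1))" "E x (hs ! (k + 1))"
      using path_neighbours[OF hs(1), of k] k that(2) by auto
    moreover have "hs ! (k - 1) \<noteq> hs ! (k + 1)" using k by (auto simp: eq)
    ultimately show ?thesis using that(4) by metis
  qed
  have "\<exists>k. k + 1 < length hs \<and> {hs ! k, hs ! (k + 1)} = {m, m'}"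
  proof -
    have "{m, m'} \<inter> {hs ! 0, hs ! 1, hs ! 2, hs ! 3} \<noteq> {}"
      using pair[of 0 2] avoid hs(3) by (auto simp: eval_nat_numeral)
    then obtain k where "k \<in> {0, 1, 2, 3}" "hs ! k \<in> {m, m'}" by blast
    hence k: "k < 4" "hs ! k \<in> {m, m'}" by auto
    have kl: "k < length hs" using k hs(3) by simp
    note int = interior[OF kl k(2)]
    have "hs ! k = m \<Longrightarrow> m' = hs ! (k - 1) \<or> m' = hs ! (k + 1)"
      using next_to[OF kl _ _ m(3)] by simp
    moreover have "hs ! k = m' \<Longrightarrow> m = hs ! (k - 1) \<or> m = hs ! (k + 1)"
      using next_to[OF kl _ _ m'(2)] by simp
    ultimately have "{hs ! k, hs ! (k + 1)} = {m, m'} \<or> {hs ! (k - 1), hs ! k} = {m, m'}" using k by auto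
    moreover have "k - 1 + 1 = k" using int by simp
    ultimately show ?thesis using int by (metis add_lessD1 one_add_one add.assoc kl)
  qed
  then obtain k where k: "k + 1 < length hs" "{hs ! k, hs ! (k + 1)} = {m, m'}" by blast
  have m_k: "hs ! k \<in> {m, m'}" "hs ! (k + 1) \<in> {m, m'}" unfolding k(2)[symmetric] by simp_all
  have k2: "2 \<le> k" "k + 3 < length hs" using interior[of k] interior[of "k + 1"] k(1) m_k by auto
  hence len: "7 \<le> length hs" "hs \<noteq> []" using hs(3,4) by (presburger, auto)
  have M: "hs ! i \<in> {m, m'} \<longleftrightarrow> i = k \<or> i = k + 1" if "i < length hs" for i
    using that k by (auto simp: eq simp flip: k(2))
  \<comment> \<open>The pair occupies positions \<open>k\<close> and \<open>k + 1\<close>. The edges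
    chosen start at 0 and 4, at 1 and 5, or at 0 and 2: always at even distance and missing the
    pair.\<close>
  consider "k = 2" | "k = 3" | "4 \<le> k" using k2 by linarith
  hence "good_avoiding {m, m'}"
  proof cases
    case 1
    thus ?thesis using pair[of 0 4] len M[of 0] M[of 1] M[of 4] M[of 5] by auto
  next
    case 2
    thus ?thesis using pair[of 1 5] len M[of 1] M[of "Suc (Suc 0)"] M[of 5] M[of 6] by auto
  next
    case 3
    thus ?thesis using pair[of 0 2] len M[of 0] M[of 1] M[of 2] M[of 3] by (auto simp: eval_nat_numeral)
  qed
  with avoid show False ..
qed

end

section \<open>Trigraphs\<close>

lemma adj_iff: "adj \<theta> u v \<longleftrightarrow> sadj \<theta> u v \<or> semiadj \<theta> u v"
  by (auto simp: adj_def sadj_def semiadj_def)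

lemma antiadj_iff: "antiadj \<theta> u v \<longleftrightarrow> santi \<theta> u v \<or> semiadj \<theta> u v"
  by (auto simp: antiadj_def santi_def semiadj_def)

lemma adj_compl [simp]: "adj (compl \<theta>) u v \<longleftrightarrow> antiadj \<theta> u v"
  by (auto simp: adj_def antiadj_def compl_def)

lemma antiadj_compl [simp]: "antiadj (compl \<theta>) u v \<longleftrightarrow> adj \<theta> u v"
  by (auto simp: adj_def antiadj_def compl_def)

lemma sadj_compl [simp]: "sadj (compl \<theta>) u v \<longleftrightarrow> santi \<theta> u v"
  by (auto simp: sadj_def santi_def compl_def)

lemma santi_compl [simp]: "santi (compl \<theta>) u v \<longleftrightarrow> sadj \<theta> u v"
  by (auto simp: sadj_def santi_def compl_def)

lemma exclusive:
  "sadj \<theta> u v \<Longrightarrow> \<not> santi \<theta> u v" "sadj \<theta> u v \<Longrightarrow> \<not> semiadj \<theta> u v" "santi \<theta> u v \<Longrightarrow> \<not> semiadj \<theta> u v"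
  by (auto simp: sadj_def santi_def semiadj_def)

lemma irreflexive [simp]:
  "\<not> sadj \<theta> u u" "\<not> santi \<theta> u u" "\<not> semiadj \<theta> u u" "\<not> adj \<theta> u u" "\<not> antiadj \<theta> u u"
  by (auto simp: sadj_def santi_def semiadj_def adj_def antiadj_def)

lemma path_adj: "is_path V \<theta> p \<Longrightarrow> Suc i < length p \<Longrightarrow> adj \<theta> (p ! i) (p ! Suc i)"
  by (auto simp: is_path_def)

lemma path_antiadj: "is_path V \<theta> p \<Longrightarrow> Suc i < j \<Longrightarrow> j < length p \<Longrightarrow> antiadj \<theta> (p ! i) (p ! j)"
  by (auto simp: is_path_def)

lemma path_mem: "is_path V \<theta> p \<Longrightarrow> i < length p \<Longrightarrow> p ! i \<in> V"
  by (auto simp: is_path_def)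

lemma path_eq: "is_path V \<theta> p \<Longrightarrow> i < length p \<Longrightarrow> j < length p \<Longrightarrow> p ! i = p ! j \<longleftrightarrow> i = j"
  by (auto simp: is_path_def nth_eq_iff_index_eq)

text \<open>Length 1 is impossible for strongly antiadjacent ends, so an odd path has length at
  least 3.\<close>

lemma even_pairI:
  assumes "u \<in> V" "v \<in> V" "santi \<theta> u v"
    and "\<And>p n. is_path V \<theta> p \<Longrightarrow> length p = Suc n \<Longrightarrow> p ! 0 = u \<Longrightarrow> p ! n = v \<Longrightarrow> odd n \<Longrightarrow> 3 \<le> n \<Longrightarrow> False"
  shows "even_pair V \<theta> u v"
  unfolding even_pair_def
proof (intro conjI allI impI)
  fix p assume p: "is_path V \<theta> p \<and> hd p = u \<and> last p = v"
  hence ne: "p \<noteq> []" by (simp add: is_path_def)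
  show "even (path_len p)"
  proof (rule ccontr)
    assume odd: "odd (path_len p)"
    define n where "n = path_len p"
    have n: "length p = Suc n" "p ! 0 = u" "p ! n = v"
      using p ne by (auto simp: n_def path_len_def hd_conv_nth last_conv_nth)
    have "n \<noteq> 1"
      using path_adj[of V \<theta> p 0] p n assms(3) by (auto simp: adj_iff dest: exclusive)
    hence "3 \<le> n" using odd n_def by presburger
    with assms(4) p n odd n_def show False by blast
  qed
qed (use assms in auto)

locale finite_trigraph =
  fixes V :: "'a set" and \<theta> :: "'a \<Rightarrow> 'a \<Rightarrow> int"
  assumes tg: "trigraph V \<theta>"
begin

lemma finite_V: "finite V"
  using tg by (simp add: trigraph_def)

lemma symm:
  assumes "u \<in> V" "v \<in> V"
  shows "sadj \<theta> u v \<longleftrightarrow> sadj \<theta> v u" "santi \<theta> u v \<longleftrightarrow> santi \<theta> v u" "semiadj \<theta> u v \<longleftrightarrow> semiadj \<theta> v u"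
    "adj \<theta> u v \<longleftrightarrow> adj \<theta> v u" "antiadj \<theta> u v \<longleftrightarrow> antiadj \<theta> v u"
  using tg assms by (auto simp: trigraph_def sadj_def santi_def semiadj_def adj_def antiadj_def)

lemma trichotomy:
  assumes "u \<in> V" "v \<in> V" "u \<noteq> v"
  shows "sadj \<theta> u v \<or> santi \<theta> u v \<or> semiadj \<theta> u v"
  using tg assms by (auto simp: trigraph_def sadj_def santi_def semiadj_def)

lemma not_adj: "u \<in> V \<Longrightarrow> v \<in> V \<Longrightarrow> u \<noteq> v \<Longrightarrow> \<not> adj \<theta> u v \<longleftrightarrow> santi \<theta> u v"
  using trichotomy[of u v] by (auto simp: adj_iff dest: exclusive)

lemma not_antiadj: "u \<in> V \<Longrightarrow> v \<in> V \<Longrightarrow> u \<noteq> v \<Longrightarrow> \<not> antiadj \<theta> u v \<longleftrightarrow> sadj \<theta> u v"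
  using trichotomy[of u v] by (auto simp: antiadj_iff dest: exclusive)

lemma trigraph_compl: "trigraph V (compl \<theta>)"
  using tg by (auto simp: trigraph_def compl_def)

text \<open>On an odd path the vertex before \<open>v\<close> is a neighbour of \<open>v\<close>
  that is antiadjacent to \<open>u\<close>.\<close>

lemma even_pair_dominated:
  assumes uv: "u \<in> V" "v \<in> V" "santi \<theta> u v" and dom: "\<And>t. t \<in> V \<Longrightarrow> adj \<theta> t v \<Longrightarrow> t \<noteq> u \<Longrightarrow> sadj \<theta> u t"
  shows "even_pair V \<theta> u v"
proof (rule even_pairI[OF uv])
  fix p n assume p: "is_path V \<theta> p" "length p = Suc n" "p ! 0 = u" "p ! n = v" "odd n" "3 \<le> n"
  have "Suc (n - 1) = n" using p by simp
  hence "adj \<theta> (p ! (n - 1)) v" using path_adj[OF p(1), of "n - 1"] p by simp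
  moreover have "p ! (n - 1) \<noteq> u" using path_eq[OF p(1), of "n - 1" 0] p by simp
  moreover have "p ! (n - 1) \<in> V" using path_mem[OF p(1)] p by simp
  ultimately have "sadj \<theta> u (p ! (n - 1))" by (rule dom[rotated])
  moreover have "antiadj \<theta> u (p ! (n - 1))" using path_antiadj[OF p(1), of 0 "n - 1"] p by simp
  ultimately show False by (auto simp: antiadj_iff dest: exclusive)
qed

text \<open>\<open>length p\<close> counts vertices: paths have length at most 4, so 3 is the only
  odd length left to exclude.\<close>

lemma even_pair_short:
  assumes uv: "u \<in> V" "v \<in> V" "santi \<theta> u v"
    and short: "\<And>p. is_path V \<theta> p \<Longrightarrow> length p \<le> 5"
    and no_P4: "\<And>a b. a \<in> V \<Longrightarrow> b \<in> V \<Longrightarrow> adj \<theta> u a \<Longrightarrow> adj \<theta> a b \<Longrightarrow> adj \<theta> b v \<Longrightarrow> antiadj \<theta> u b \<Longrightarrow> antiadj \<theta> a v \<Longrightarrow> False"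
  shows "even_pair V \<theta> u v"
proof (rule even_pairI[OF uv])
  fix p n assume p: "is_path V \<theta> p" "length p = Suc n" "p ! 0 = u" "p ! n = v" "odd n" "3 \<le> n"
  have "n \<le> 4" "n \<noteq> 4" using short[OF p(1)] p by auto
  hence n: "n = 3" using p by simp
  have l: "length p = 4" using p n by simp
  have "adj \<theta> u (p ! 1)" "adj \<theta> (p ! 1) (p ! 2)" "adj \<theta> (p ! 2) v" "antiadj \<theta> u (p ! 2)" "antiadj \<theta> (p ! 1) v"
    using path_adj[OF p(1), of 0] path_adj[OF p(1), of 1] path_adj[OF p(1), of 2]
      path_antiadj[OF p(1), of 0 2] path_antiadj[OF p(1), of 1 3] l p n
    by (auto simp: numeral_2_eq_2 numeral_3_eq_3)
  with no_P4[of "p ! 1" "p ! 2"] path_mem[OF p(1)] l show False by auto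
qed

lemma not_complete:
  assumes "\<not> complete_tg V \<theta>"
  obtains u v where "u \<in> V" "v \<in> V" "santi \<theta> u v"
  using assms not_adj unfolding complete_tg_def clique_def by blast

lemma semiadj_reach:
  assumes "(x, u) \<in> (sigma_rel V \<theta>)\<^sup>*" "x \<in> S" "\<And>a b. a \<in> S \<Longrightarrow> a \<in> V \<Longrightarrow> b \<in> V \<Longrightarrow> semiadj \<theta> a b \<Longrightarrow> b \<in> S"
  shows "u \<in> S"
  using assms(1,2) by (induction rule: rtrancl_induct) (auto simp: sigma_rel_def assms(3))

text \<open>Replaces components and edge sets of the switchable graph by three explicit
  configurations, each listing all switchable pairs.\<close>

lemma in_F_cases:
  assumes F: "in_F V \<theta>"
  obtains (none) "\<And>u v. u \<in> V \<Longrightarrow> v \<in> V \<Longrightarrow> \<not> semiadj \<theta> u v" "swD V \<theta> = {}"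
  | (small) x y where "x \<in> V" "y \<in> V" "x \<noteq> y" "semiadj \<theta> x y" "swD V \<theta> = {x, y}"
      "nbhd V \<theta> x \<inter> nbhd V \<theta> y = {}"
      "\<And>u v. u \<in> V \<Longrightarrow> v \<in> V \<Longrightarrow> semiadj \<theta> u v \<Longrightarrow> {u, v} = {x, y}"
  | (light) v x y where "v \<in> V" "x \<in> V" "y \<in> V" "v \<noteq> x" "v \<noteq> y" "x \<noteq> y" "semiadj \<theta> v x" "semiadj \<theta> v y"
      "swD V \<theta> = {v, x, y}" "\<And>w. w \<in> V - {v, x, y} \<Longrightarrow> santi \<theta> v w" "santi \<theta> x y"
      "nbhd V \<theta> x \<inter> nbhd V \<theta> y = {v}"
      "\<And>a b. a \<in> V \<Longrightarrow> b \<in> V \<Longrightarrow> semiadj \<theta> a b \<Longrightarrow> {a, b} = {v, x} \<or> {a, b} = {v, y}"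
proof (cases "\<exists>x\<in>V. \<exists>y\<in>V. semiadj \<theta> x y")
  case False
  have "sigma_comp V \<theta> v = {v}" for v
  proof -
    have "sigma_rel V \<theta> = {}" using False by (auto simp: sigma_rel_def)
    thus ?thesis by (auto simp: sigma_comp_def)
  qed
  hence "swD V \<theta> = {}" by (auto simp: swD_def switchable_components_def)
  with False none show thesis by blast
next
  case True
  then obtain x y where xy: "x \<in> V" "y \<in> V" "semiadj \<theta> x y" by blast
  have comp_V: "sigma_comp V \<theta> v \<subseteq> V" if "v \<in> V" for v
    using semiadj_reach[of v _ V] that by (auto simp: sigma_comp_def)
  have comp: "sigma_comp V \<theta> u \<in> switchable_components V \<theta>" if "u \<in> V" "v \<in> V" "semiadj \<theta> u v" for u v
  proof -
    have "{u, v} \<subseteq> sigma_comp V \<theta> u" using that by (auto simp: sigma_comp_def sigma_rel_def)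
    moreover have "card {u, v} = 2" using that by (auto simp: semiadj_def)
    ultimately have "2 \<le> card (sigma_comp V \<theta> u)"
      using comp_V[OF that(1)] finite_V by (metis card_mono finite_subset)
    thus ?thesis using that by (auto simp: switchable_components_def)
  qed
  define C where "C = sigma_comp V \<theta> x"
  \<comment> \<open>Needed to use the bound on the number of components, since \<open>card\<close>
    of an infinite set is 0.\<close>
  have "finite (switchable_components V \<theta>)"
    by (rule finite_subset[of _ "Pow V"]) (use comp_V finite_V in \<open>auto simp: switchable_components_def\<close>)
  moreover have "card (switchable_components V \<theta>) \<le> 1" using F by (simp add: in_F_def)
  ultimately have sc: "switchable_components V \<theta> = {C}"
    using comp[OF xy] unfolding C_def
    by (metis One_nat_def card_le_Suc0_iff_eq is_singletonI' is_singleton_the_elem empty_iff singletonD)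
  have D: "swD V \<theta> = C" by (simp add: swD_def sc)
  have inC: "u \<in> C" if "u \<in> V" "v \<in> V" "semiadj \<theta> u v" for u v
    using comp[OF that] sc by (auto simp: sigma_comp_def)
  have edge: "{u, v} \<in> sw_edges \<theta> C" if "u \<in> V" "v \<in> V" "semiadj \<theta> u v" for u v
    using inC[OF that] inC[OF that(2,1)] symm(3)[OF that(1,2)] that unfolding sw_edges_def by blast
  have card: "card (sw_edges \<theta> C) \<le> 2"
    and F1: "\<And>x y. sw_edges \<theta> C = {{x, y}} \<Longrightarrow> nbhd V \<theta> x \<inter> nbhd V \<theta> y = {}"
    and F2: "\<And>v x y. x \<noteq> y \<Longrightarrow> sw_edges \<theta> C = {{v, x}, {v, y}} \<Longrightarrow>
           (\<forall>w \<in> V - {v, x, y}. santi \<theta> v w) \<and> santi \<theta> x y \<and> nbhd V \<theta> x \<inter> nbhd V \<theta> y = {v}"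
    using F by (auto simp: in_F_def sc)
  have CV: "C \<subseteq> V" using comp_V xy by (simp add: C_def)
  have finE: "finite (sw_edges \<theta> C)"
    by (rule finite_subset[of _ "Pow V"]) (use CV finite_V in \<open>auto simp: sw_edges_def\<close>)
  have xC: "x \<in> C" by (simp add: C_def sigma_comp_def)
  have yC: "y \<in> C" using inC[of y x] xy symm(3)[of x y] by simp
  have closed: "C \<subseteq> S" if "x \<in> S" "\<And>a b. a \<in> S \<Longrightarrow> a \<in> V \<Longrightarrow> b \<in> V \<Longrightarrow> semiadj \<theta> a b \<Longrightarrow> b \<in> S" for S
    using semiadj_reach[of x _ S] that by (auto simp: C_def sigma_comp_def)
  show thesis
  proof (cases "sw_edges \<theta> C = {{x, y}}")
    case True
    have u: "{u, v} = {x, y}" if "u \<in> V" "v \<in> V" "semiadj \<theta> u v" for u v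
      using edge[OF that] True by simp
    have "C \<subseteq> {x, y}"
    proof (rule closed)
      fix a b assume "a \<in> {x, y}" "a \<in> V" "b \<in> V" "semiadj \<theta> a b"
      with u[of a b] show "b \<in> {x, y}" by auto
    qed simp
    with xC yC have "swD V \<theta> = {x, y}" unfolding D by blast
    moreover have "x \<noteq> y" using xy by (auto simp: semiadj_def)
    ultimately show thesis using small[of x y] xy F1[OF True] u by blast
  next
    case False
    then obtain e where e: "e \<in> sw_edges \<theta> C" "e \<noteq> {x, y}" using edge[OF xy] by blast
    have E2: "sw_edges \<theta> C = {{x, y}, e}"
    proof (rule sym, rule card_seteq[OF finE])
      show "{{x, y}, e} \<subseteq> sw_edges \<theta> C" using e edge[OF xy] by simp
      show "card (sw_edges \<theta> C) \<le> card {{x, y}, e}" using e card by simp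
    qed
    obtain z w where zw: "e = {z, w}" "z \<in> C" "w \<in> C" "semiadj \<theta> z w" using e by (auto simp: sw_edges_def)
    have zwV: "z \<in> V" "w \<in> V" using zw CV by auto
    have u: "{a, b} = {x, y} \<or> {a, b} = {z, w}" if "a \<in> V" "b \<in> V" "semiadj \<theta> a b" for a b
      using edge[OF that] E2 zw by auto
    \<comment> \<open>The component is connected, so its two edges share a vertex, the centre
      \<open>v\<close> of the light case.\<close>
    have meet: "{x, y} \<inter> {z, w} \<noteq> {}"
    proof
      assume disj: "{x, y} \<inter> {z, w} = {}"
      have "C \<subseteq> {x, y}"
      proof (rule closed)
        fix a b assume ab: "a \<in> {x, y}" "a \<in> V" "b \<in> V" "semiadj \<theta> a b"
        from u[OF ab(2-4)] show "b \<in> {x, y}" using disj ab(1) by blast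
      qed simp
      with zw disj show False by blast
    qed
    have fin: thesis if v: "{x, y} = {v, a}" "{z, w} = {v, b}" for v a b
    proof -
      have ab: "a \<noteq> b" using e zw v by auto
      have E3: "sw_edges \<theta> C = {{v, a}, {v, b}}" using E2 zw v by simp
      have "{v, a, b} = {x, y} \<union> {z, w}" using v by blast
      hence "{v, a, b} \<subseteq> V" "{v, a, b} \<subseteq> C" using xy zwV xC yC zw by auto
      hence vab: "v \<in> V" "a \<in> V" "b \<in> V" "v \<in> C" "a \<in> C" "b \<in> C" by auto
      have va: "semiadj \<theta> v a" "semiadj \<theta> v b"
        using v xy zw zwV symm(3)[of x y] symm(3)[of z w] by (auto simp: doubleton_eq_iff)
      hence ne: "v \<noteq> a" "v \<noteq> b" by (auto simp: semiadj_def)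
      have "C \<subseteq> {v, a, b}"
      proof (rule closed)
        show "x \<in> {v, a, b}" using v by blast
        fix a' b' assume "a' \<in> {v, a, b}" "a' \<in> V" "b' \<in> V" "semiadj \<theta> a' b'"
        with u[of a' b'] v show "b' \<in> {v, a, b}" by auto
      qed
      hence "swD V \<theta> = {v, a, b}" using D vab by blast
      with light[of v a b] vab va ne ab F2[OF ab E3] u v show thesis by metis
    qed
    from meet consider "z = x" | "z = y" | "w = x" | "w = y" by blast
    thus thesis by cases (use fin[of x y w] fin[of y x w] fin[of x y z] fin[of y x z] in \<open>auto simp: insert_commute\<close>)
  qed
qed

end

section \<open>Line trigraphs of bipartite graphs\<close>

locale bipartite_line_trigraph = finite_trigraph +
  fixes f :: "'a \<Rightarrow> nat \<times> nat"
  assumes inj: "inj_on f V"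
    and adj_f: "u \<in> V \<Longrightarrow> v \<in> V \<Longrightarrow> u \<noteq> v \<Longrightarrow> adj \<theta> u v \<longleftrightarrow> fst (f u) = fst (f v) \<or> snd (f u) = snd (f v)"
    and big_clique: "X \<subseteq> V \<Longrightarrow> clique \<theta> X \<Longrightarrow> card X \<ge> 3 \<Longrightarrow> strong_clique \<theta> X"
begin

text \<open>Vertices of H carry their side as a tag, so that \<open>fst\<close> is the side function
  and the two numberings cannot clash.\<close>

definition end_of :: "bool \<Rightarrow> 'a \<Rightarrow> bool \<times> nat" where
  "end_of s e = (s, if s then fst (f e) else snd (f e))"

definition E :: "bool \<times> nat \<Rightarrow> bool \<times> nat \<Rightarrow> bool" where
  "E u w \<longleftrightarrow> (\<exists>e\<in>V. \<exists>s. u = end_of s e \<and> w = end_of (\<not> s) e)"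

lemma fst_end [simp]: "fst (end_of s e) = s"
  by (simp add: end_of_def)

lemma end_of_eq: "end_of s e = end_of t e' \<Longrightarrow> s = t"
  by (simp add: end_of_def)

lemma end_inj: "e \<in> V \<Longrightarrow> e' \<in> V \<Longrightarrow> end_of s e = end_of s e' \<Longrightarrow> end_of (\<not> s) e = end_of (\<not> s) e' \<Longrightarrow> e = e'"
  using inj by (cases s) (auto simp: end_of_def inj_on_def prod_eq_iff)

lemma adj_end: "u \<in> V \<Longrightarrow> v \<in> V \<Longrightarrow> u \<noteq> v \<Longrightarrow> adj \<theta> u v \<longleftrightarrow> (\<exists>s. end_of s u = end_of s v)"
  by (auto simp: adj_f end_of_def)

lemma EI: "e \<in> V \<Longrightarrow> E (end_of s e) (end_of (\<not> s) e)"
  unfolding E_def by blast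

sublocale bipartite_relation E fst
proof
  fix u w
  show "E w u" if "E u w"
  proof -
    from that obtain e s where "e \<in> V" "u = end_of s e" "w = end_of (\<not> s) e" unfolding E_def by blast
    thus ?thesis using EI[of e "\<not> s"] by simp
  qed
  show "E u w \<Longrightarrow> fst u \<noteq> fst w" unfolding E_def by auto
qed

lemma strong_triangle:
  assumes "u \<in> V" "v \<in> V" "w \<in> V" "u \<noteq> v" "v \<noteq> w" "u \<noteq> w" "adj \<theta> u v" "adj \<theta> v w" "adj \<theta> u w"
  shows "sadj \<theta> u v" "sadj \<theta> v w" "sadj \<theta> u w"
proof -
  have "clique \<theta> {u, v, w}" using assms symm unfolding clique_def by auto
  moreover have "card {u, v, w} \<ge> 3" using assms by simp
  ultimately have "strong_clique \<theta> {u, v, w}" using big_clique[of "{u, v, w}"] assms(1-3) by simp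
  thus "sadj \<theta> u v" "sadj \<theta> v w" "sadj \<theta> u w" using assms by (auto simp: strong_clique_def)
qed

text \<open>A third edge at the common end would form a triangle with the switchable pair, and
  triangles are strong. Hence that end has degree two in H.\<close>

lemma semi_common_end:
  assumes "u \<in> V" "v \<in> V" "w \<in> V" "semiadj \<theta> u v" "end_of s u = end_of s v" "end_of s w = end_of s u"
  shows "w = u \<or> w = v"
proof (rule ccontr)
  assume "\<not> ?thesis"
  hence ne: "u \<noteq> v" "v \<noteq> w" "u \<noteq> w" using assms(4) by auto
  have "adj \<theta> u v" by (rule adj_end[THEN iffD2, OF assms(1,2) ne(1) exI, OF assms(5)])
  moreover have "adj \<theta> v w" by (rule adj_end[THEN iffD2, OF assms(2,3) ne(2) exI[of _ s]]) (use assms in simp)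
  moreover have "adj \<theta> u w" by (rule adj_end[THEN iffD2, OF assms(1,3) ne(3) exI[of _ s]]) (use assms in simp)
  ultimately have "adj \<theta> u v" "adj \<theta> v w" "adj \<theta> u w" .
  from strong_triangle(1)[OF assms(1-3) ne this] assms(4) show False by (auto dest: exclusive)
qed

lemma semi_share:
  assumes "u \<in> V" "v \<in> V" "semiadj \<theta> u v"
  obtains s where "end_of s u = end_of s v"
proof -
  have "u \<noteq> v" "adj \<theta> u v" using assms by (auto simp: adj_iff)
  with adj_end assms that show thesis by blast
qed

definition edge :: "bool \<times> nat \<Rightarrow> bool \<times> nat \<Rightarrow> 'a" where
  "edge u w = (THE e. e \<in> V \<and> {end_of True e, end_of False e} = {u, w})"

definition ends :: "'a \<Rightarrow> (bool \<times> nat) set" where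
  "ends e = {end_of True e, end_of False e}"

lemma ends_alt: "ends e = {end_of s e, end_of (\<not> s) e}"
  by (cases s) (auto simp: ends_def)

lemma ends_inj: assumes "e \<in> V" "e' \<in> V" "ends e = ends e'" shows "e = e'"
proof -
  have "end_of True e = end_of True e'" "end_of False e = end_of False e'"
    using assms(3) by (auto simp: ends_def doubleton_eq_iff dest: end_of_eq)
  thus ?thesis using end_inj[of e e' True] assms by simp
qed

lemma edge: assumes "E u w" shows "edge u w \<in> V" "ends (edge u w) = {u, w}"
proof -
  obtain e where e: "e \<in> V" "ends e = {u, w}"
    using assms ends_alt unfolding E_def by metis
  have "edge u w \<in> V \<and> {end_of True (edge u w), end_of False (edge u w)} = {u, w}"
    unfolding edge_def by (rule theI[of _ e]) (use e ends_inj in \<open>auto simp flip: ends_def\<close>)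
  thus "edge u w \<in> V" "ends (edge u w) = {u, w}" by (auto simp: ends_def)
qed

lemma edge_end:
  assumes "E u w" shows "end_of (fst u) (edge u w) = u" "end_of (\<not> fst u) (edge u w) = w"
proof -
  have "{end_of (fst u) (edge u w), end_of (\<not> fst u) (edge u w)} = {u, w}"
    using edge(2)[OF assms] ends_alt by metis
  hence "end_of (fst u) (edge u w) \<in> {u, w}" "end_of (\<not> fst u) (edge u w) \<in> {u, w}" by blast+
  moreover have "end_of s (edge u w) \<noteq> w" if "s = fst u" for s using bip[OF assms] that fst_end by metis
  moreover have "end_of s (edge u w) \<noteq> u" if "s = (\<not> fst u)" for s using that fst_end by metis
  ultimately show "end_of (fst u) (edge u w) = u" "end_of (\<not> fst u) (edge u w) = w" by auto
qed

lemma adj_ends: "u \<in> V \<Longrightarrow> v \<in> V \<Longrightarrow> u \<noteq> v \<Longrightarrow> adj \<theta> u v \<longleftrightarrow> ends u \<inter> ends v \<noteq> {}"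
  by (auto simp: adj_end ends_def dest: end_of_eq) (metis (full_types))+

text \<open>A path only guarantees antiadjacency, so switchable chords must be excluded. Such a
  chord has an interior end \<open>p ! k\<close> and meets it in a vertex of H of degree two. Both
  path neighbours of \<open>p ! k\<close> then share its other end, so they form a strong triangle
  with it although they are antiadjacent.\<close>

lemma path_nonadj:
  assumes p: "is_path V \<theta> p" "length p = Suc n" "santi \<theta> (p ! 0) (p ! n)" and ij: "Suc i < j" "j \<le> n"
  shows "\<not> adj \<theta> (p ! i) (p ! j)"
proof
  assume "adj \<theta> (p ! i) (p ! j)"
  moreover have "antiadj \<theta> (p ! i) (p ! j)" using path_antiadj[OF p(1)] ij p(2) by simp
  ultimately have semi: "semiadj \<theta> (p ! i) (p ! j)" by (auto simp: adj_iff antiadj_iff dest: exclusive)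
  have mem: "p ! k \<in> V" if "k \<le> n" for k using path_mem[OF p(1)] p(2) that by simp
  have eq: "p ! k = p ! l \<longleftrightarrow> k = l" if "k \<le> n" "l \<le> n" for k l using path_eq[OF p(1)] p(2) that by simp
  have main: False if k: "0 < k" "k < n" "l \<le> n" "l \<noteq> k" "l \<noteq> k - 1" "l \<noteq> k + 1" "semiadj \<theta> (p ! k) (p ! l)" for k l
  proof -
    have kl: "p ! k \<in> V" "p ! l \<in> V" "p ! (k - 1) \<in> V" "p ! (k + 1) \<in> V" using mem k by auto
    obtain s where s: "end_of s (p ! k) = end_of s (p ! l)" using semi_share[OF kl(1,2) k(7)] .
    have "Suc (k - 1) = k" using k by simp
    hence "adj \<theta> (p ! (k - 1)) (p ! k)" "adj \<theta> (p ! k) (p ! (k + 1))"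
      using path_adj[OF p(1), of "k - 1"] path_adj[OF p(1), of k] p(2) k by auto
    moreover have "p ! (k - 1) \<noteq> p ! k" "p ! k \<noteq> p ! (k + 1)" using eq k by auto
    ultimately obtain t t' where "end_of t (p ! (k - 1)) = end_of t (p ! k)" "end_of t' (p ! k) = end_of t' (p ! (k + 1))"
      using adj_end[OF kl(3,1)] adj_end[OF kl(1,4)] by blast
    hence t: "end_of t (p ! (k - 1)) = end_of t (p ! k)" "end_of t' (p ! (k + 1)) = end_of t' (p ! k)" by simp_all
    have "end_of s (p ! (k - 1)) \<noteq> end_of s (p ! k)" "end_of s (p ! (k + 1)) \<noteq> end_of s (p ! k)"
      using semi_common_end[OF kl(1,2,3) k(7) s] semi_common_end[OF kl(1,2,4) k(7) s] k eq by auto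
    moreover have "t \<noteq> s"
    proof
      assume "t = s"
      with t(1) calculation(1) show False by simp
    qed
    moreover have "t' \<noteq> s"
    proof
      assume "t' = s"
      with t(2) calculation(2) show False by simp
    qed
    ultimately have "end_of t (p ! (k - 1)) = end_of t (p ! (k + 1))" using t by (cases s; cases t; cases t') auto
    moreover have ne: "p ! (k - 1) \<noteq> p ! k" "p ! k \<noteq> p ! (k + 1)" "p ! (k - 1) \<noteq> p ! (k + 1)" using eq k by auto
    ultimately have "adj \<theta> (p ! (k - 1)) (p ! (k + 1))" using adj_end kl by blast
    from strong_triangle(3)[OF kl(3,1,4) ne(1,2,3) _ _ this] \<open>adj \<theta> (p ! (k - 1)) (p ! k)\<close> \<open>adj \<theta> (p ! k) (p ! (k + 1))\<close>
    have "sadj \<theta> (p ! (k - 1)) (p ! (k + 1))" by simp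
    moreover have "antiadj \<theta> (p ! (k - 1)) (p ! (k + 1))" using path_antiadj[OF p(1)] p(2) k by auto
    ultimately show False by (auto simp: antiadj_iff dest: exclusive)
  qed
  show False
  proof (cases "i = 0")
    case False
    hence "0 < i" "i < n" "j \<noteq> i" "j \<noteq> i - 1" "j \<noteq> i + 1" using ij by linarith+
    with main[of i j] semi ij(2) show False by blast
  next
    case True
    \<comment> \<open>The ends of the path are strongly antiadjacent, so a chord at
      \<open>p ! 0\<close> has its other end in the interior.\<close>
    with p(3) semi ij have "j < n" by (metis exclusive(3) le_neq_implies_less)
    moreover have "semiadj \<theta> (p ! j) (p ! i)" using semi symm(3) mem ij by auto
    ultimately show False using main[of j i] True ij by auto
  qed
qed

text \<open>The shared ends of consecutive path vertices alternate in side, since otherwise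
  \<open>p ! i\<close> and \<open>p ! (i + 2)\<close> would be adjacent. For odd \<open>n\<close>
  the first and the last are on the same side \<open>s\<close>. The walk through the shared ends
  avoids the other two ends because the path has no chord.\<close>

lemma odd_path_reach:
  assumes p: "is_path V \<theta> p" "length p = Suc n" "santi \<theta> (p ! 0) (p ! n)" "odd n" "3 \<le> n"
  obtains s where "reach {end_of (\<not> s) (p ! 0), end_of (\<not> s) (p ! n)} (end_of s (p ! 0)) (end_of s (p ! n))"
proof -
  have mem: "p ! k \<in> V" if "k \<le> n" for k using path_mem[OF p(1)] p(2) that by simp
  have eq: "p ! k = p ! l \<longleftrightarrow> k = l" if "k \<le> n" "l \<le> n" for k l using path_eq[OF p(1)] p(2) that by simp
  have nonadj: "end_of s (p ! i) \<noteq> end_of s (p ! j)" if "Suc i < j" "j \<le> n" for i j s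
    using path_nonadj[OF p(1-3) that] adj_end[of "p ! i" "p ! j"] mem[of i] mem[of j] eq[of i j] that by auto
  have "\<exists>s. end_of s (p ! i) = end_of s (p ! Suc i)" if "i < n" for i
    using path_adj[OF p(1), of i] adj_end[of "p ! i" "p ! Suc i"] mem eq[of i "Suc i"] p(2) that by auto
  then obtain t where t: "\<And>i. i < n \<Longrightarrow> end_of (t i) (p ! i) = end_of (t i) (p ! Suc i)" by metis
  have alt: "t (Suc i) = (\<not> t i)" if "Suc i < n" for i
  proof -
    have "t (Suc i) \<noteq> t i"
    proof
      assume *: "t (Suc i) = t i"
      have "end_of (t i) (p ! i) = end_of (t i) (p ! Suc (Suc i))"
        using t[of i] t[of "Suc i"] that unfolding * by simp
      with nonadj[of i "Suc (Suc i)" "t i"] that show False by simp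
    qed
    thus ?thesis by (cases "t i") auto
  qed
  have parity: "t i = (t 0 = even i)" if "i < n" for i
    using that by (induction i) (auto simp: alt)
  define s where "s = t 0"
  define S where "S = {end_of (\<not> s) (p ! 0), end_of (\<not> s) (p ! n)}"
  \<comment> \<open>The end common to \<open>p ! i\<close> and \<open>p ! Suc i\<close>.\<close>
  define g where "g i = end_of (t i) (p ! i)" for i
  have g_notin: "g i \<notin> S" if "i < n" for i
  proof (cases "t i = s")
    case True
    thus ?thesis unfolding g_def S_def by (auto dest: end_of_eq)
  next
    case False
    hence ti: "t i = (\<not> s)" by auto
    hence "odd i" using parity[OF that] by (auto simp: s_def)
    hence "0 < i" "Suc i < n" using that p(4) by presburger+
    hence "g i \<noteq> end_of (\<not> s) (p ! 0)" "g i \<noteq> end_of (\<not> s) (p ! n)"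
      using nonadj[of 0 "Suc i" "\<not> s"] nonadj[of i n "\<not> s"] t[OF that] ti by (auto simp: g_def)
    thus ?thesis by (simp add: S_def)
  qed
  have "reach S (g 0) (g i)" if "i < n" for i
    using that
  proof (induction i)
    case (Suc i)
    have "g i = end_of (t i) (p ! Suc i)" using t[of i] Suc.prems by (simp add: g_def)
    hence "E (g i) (g (Suc i))" using EI[OF mem, of "Suc i" "t i"] alt[of i] Suc.prems by (simp add: g_def)
    hence "reach S (g i) (g (Suc i))" using g_notin Suc.prems by (intro reach_step) auto
    with Suc show ?case by (meson Suc_lessD reach_trans)
  qed simp
  from this[of "n - 1"] have "reach S (g 0) (g (n - 1))" using p(5) by simp
  moreover have "t (n - 1) = s" using parity[of "n - 1"] p(4,5) by (auto simp: s_def)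
  hence "g (n - 1) = end_of s (p ! n)" using t[of "n - 1"] p(5) by (simp add: g_def)
  ultimately show thesis using that[of s] by (simp add: g_def S_def s_def)
qed

text \<open>An odd path would yield a walk between the ends on one side of H; each separation
  hypothesis excludes one side.\<close>

lemma even_pair_if_good:
  assumes e: "E p b" "E a q" "distinct [p, b, a, q]" "fst p = fst a" 
    and "\<not> reach {b, q} p a" "\<not> reach {p, a} b q"
  shows "even_pair V \<theta> (edge p b) (edge a q)"
proof (rule even_pairI)
  have ends: "end_of (fst p) (edge p b) = p" "end_of (\<not> fst p) (edge p b) = b"
    "end_of (fst p) (edge a q) = a" "end_of (\<not> fst p) (edge a q) = q"
    using edge_end[OF e(1)] edge_end[OF e(2)] e(4) by auto
  show V: "edge p b \<in> V" "edge a q \<in> V" using edge(1) e by auto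
  have "ends (edge p b) \<inter> ends (edge a q) = {}" using edge(2) e by auto
  moreover from this have "edge p b \<noteq> edge a q" by (auto simp: ends_def)
  ultimately show sa: "santi \<theta> (edge p b) (edge a q)" using adj_ends not_adj V by blast
  fix h n assume h: "is_path V \<theta> h" "length h = Suc n" "h ! 0 = edge p b" "h ! n = edge a q" "odd n" "3 \<le> n"
  with sa have "santi \<theta> (h ! 0) (h ! n)" by simp
  from odd_path_reach[OF h(1,2) this h(5,6)] obtain s where
    s: "reach {end_of (\<not> s) (edge p b), end_of (\<not> s) (edge a q)} (end_of s (edge p b)) (end_of s (edge a q))"
    unfolding h(3,4) .
  show False
  proof (cases "s = fst p")
    case True
    with s ends assms(5) show False by simp
  next
    case False
    hence "s = (\<not> fst p)" by auto
    with s ends assms(6) show False by simp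
  qed
qed

section \<open>From three disjoint paths of H to an odd prism\<close>

definition edges :: "(bool \<times> nat) list \<Rightarrow> 'a list" where
  "edges hs = map (\<lambda>i. edge (hs ! i) (hs ! Suc i)) [0..<length hs - 1]"

lemma edges_nth:
  assumes "successively E hs" "Suc i < length hs"
  shows "edges hs ! i \<in> V" "ends (edges hs ! i) = {hs ! i, hs ! Suc i}"
proof -
  have "E (hs ! i) (hs ! Suc i)" using assms by (simp add: successively_conv_nth)
  moreover have "i < length hs - 1" using assms(2) by simp
  hence "edges hs ! i = edge (hs ! i) (hs ! Suc i)" by (simp add: edges_def)
  ultimately show "edges hs ! i \<in> V" "ends (edges hs ! i) = {hs ! i, hs ! Suc i}" using edge by simp_all
qed

lemma length_edges [simp]: "length (edges hs) = length hs - 1"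
  by (simp add: edges_def)

lemma distinct_edges: assumes "successively E hs" "distinct hs" shows "distinct (edges hs)"
  unfolding distinct_conv_nth
proof (intro allI impI)
  fix i j assume ij: "i < length (edges hs)" "j < length (edges hs)" "i \<noteq> j"
  hence "{hs ! i, hs ! Suc i} \<noteq> {hs ! j, hs ! Suc j}"
    using assms(2) by (auto simp: doubleton_eq_iff nth_eq_iff_index_eq)
  thus "edges hs ! i \<noteq> edges hs ! j"
    using edges_nth(2)[OF assms(1), of i] edges_nth(2)[OF assms(1), of j] ij by force
qed

lemma edges_meet_same:
  assumes hs: "successively E hs" "distinct hs" and xy: "x \<in> set (edges hs)" "y \<in> set (edges hs)" "x \<noteq> y"
  shows "ends x \<inter> ends y \<noteq> {} \<longleftrightarrow> consec (edges hs) x y"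
proof -
  obtain i j where ij: "i < length hs - 1" "j < length hs - 1" "x = edges hs ! i" "y = edges hs ! j"
    using xy by (auto simp: in_set_conv_nth)
  hence "i \<noteq> j" using xy by auto
  have ex: "ends x = {hs ! i, hs ! Suc i}" "ends y = {hs ! j, hs ! Suc j}"
    using edges_nth(2)[OF hs(1)] ij by auto
  have "ends x \<inter> ends y \<noteq> {} \<longleftrightarrow> j = Suc i \<or> i = Suc j"
    unfolding ex using hs(2) ij \<open>i \<noteq> j\<close> by (auto simp: nth_eq_iff_index_eq)
  also have "\<dots> \<longleftrightarrow> consec (edges hs) x y"
  proof
    assume "j = Suc i \<or> i = Suc j"
    thus "consec (edges hs) x y" unfolding consec_def using ij
      by (elim disjE) (rule exI[of _ i] exI[of _ j], auto)+
  next
    assume "consec (edges hs) x y"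
    then obtain k where k: "Suc k < length hs - 1" "{edges hs ! k, edges hs ! Suc k} = {x, y}"
      unfolding consec_def by auto
    have "edges hs ! a = edges hs ! b \<longleftrightarrow> a = b" if "a < length hs - 1" "b < length hs - 1" for a b
      using distinct_edges[OF hs] that by (simp add: nth_eq_iff_index_eq)
    with k ij show "j = Suc i \<or> i = Suc j" by (auto simp: doubleton_eq_iff)
  qed
  finally show ?thesis .
qed

lemma hd_last_edges:
  assumes "successively E (p # A @ [q])"
  shows "hd (edges (p # A @ [q])) = edges (p # A @ [q]) ! 0"
    "last (edges (p # A @ [q])) = edges (p # A @ [q]) ! length A"
    "p \<in> ends (hd (edges (p # A @ [q])))" "q \<in> ends (last (edges (p # A @ [q])))"
proof -
  let ?h = "p # A @ [q]"
  have ne: "edges ?h \<noteq> []" by (auto simp flip: length_greater_0_conv)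
  show h: "hd (edges ?h) = edges ?h ! 0" using ne by (simp add: hd_conv_nth)
  show l: "last (edges ?h) = edges ?h ! length A" using ne by (simp add: last_conv_nth)
  show "p \<in> ends (hd (edges ?h))" unfolding h using edges_nth(2)[OF assms, of 0] by simp
  show "q \<in> ends (last (edges ?h))" unfolding l using edges_nth(2)[OF assms, of "length A"] by (simp add: nth_append)
qed

text \<open>The paths have only \<open>p\<close> and \<open>q\<close> in common, and on each of them
  only the first edge contains \<open>p\<close> and only the last contains \<open>q\<close>.\<close>

lemma edges_meet_diff:
  assumes h: "successively E (p # A @ [q])" "distinct (p # A @ [q])" and k: "successively E (p # B @ [q])" "distinct (p # B @ [q])"
    and AB: "set A \<inter> set B = {}" and x: "x \<in> set (edges (p # A @ [q]))" and y: "y \<in> set (edges (p # B @ [q]))"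
    and meet: "ends x \<inter> ends y \<noteq> {}"
  shows "x = hd (edges (p # A @ [q])) \<and> y = hd (edges (p # B @ [q])) \<or>
    x = last (edges (p # A @ [q])) \<and> y = last (edges (p # B @ [q]))"
proof -
  have pos: "v = p \<and> x = hd (edges (p # A @ [q])) \<or> v = q \<and> x = last (edges (p # A @ [q])) \<or> v \<in> set A"
    if h: "successively E (p # A @ [q])" "distinct (p # A @ [q])" and x: "x \<in> set (edges (p # A @ [q]))" and v: "v \<in> ends x" for A x v
  proof -
    let ?h = "p # A @ [q]"
    obtain i where i: "i < length ?h - 1" "x = edges ?h ! i" using x by (auto simp: in_set_conv_nth)
    hence "v = ?h ! i \<or> v = ?h ! Suc i" using edges_nth(2)[OF h(1), of i] v by auto
    then obtain j where j: "v = ?h ! j" "j = i \<or> j = Suc i" by blast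
    show ?thesis
    proof (cases "v \<in> set A")
      case False
      hence "v = p \<or> v = q" using j i nth_mem[of j ?h] by auto
      moreover have "?h ! j = p \<longleftrightarrow> j = 0" "?h ! j = q \<longleftrightarrow> j = Suc (length A)"
        using h(2) i j nth_eq_iff_index_eq[OF h(2), of j 0] nth_eq_iff_index_eq[OF h(2), of j "Suc (length A)"]
        by (auto simp: nth_append)
      ultimately have "v = p \<and> i = 0 \<or> v = q \<and> i = length A" using j i by auto
      thus ?thesis using hd_last_edges[OF h(1)] i by auto
    qed simp
  qed
  obtain v where v: "v \<in> ends x" "v \<in> ends y" using meet by blast
  have "p \<noteq> q" "p \<notin> set A" "q \<notin> set A" "p \<notin> set B" "q \<notin> set B" using h k by auto
  with pos[OF h x v(1)] pos[OF k y v(2)] AB show ?thesis by blast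
qed

text \<open>The edges at \<open>p\<close> and those at \<open>q\<close> are the triangles. As
  \<open>p\<close> and \<open>q\<close> agree in side, each path of H has an even number of edges,
  so its edges form a path of odd length in the trigraph.\<close>

lemma theta_gives_odd_prism:
  assumes pq: "p \<noteq> q" "fst p = fst q"
    and P: "successively E (p # A @ [q])" "successively E (p # B @ [q])" "successively E (p # I @ [q])"
    and d: "distinct (p # q # A @ B @ I)"
  shows "has_odd_prism V \<theta>"
proof -
  let ?e = "\<lambda>A. edges (p # A @ [q])"
  have dist: "distinct (p # A @ [q])" "distinct (p # B @ [q])" "distinct (p # I @ [q])"
    and disj: "set A \<inter> set B = {}" "set A \<inter> set I = {}" "set B \<inter> set I = {}" using d by auto
  have mem: "set (?e X) \<subseteq> V" if "successively E (p # X @ [q])" for X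
    using edges_nth(1)[OF that] by (auto simp: in_set_conv_nth)
  have len: "odd (path_len (?e X)) \<and> 2 \<le> length (?e X)" if "successively E (p # X @ [q])" for X
  proof -
    have step: "fst ((p # X @ [q]) ! i) = (fst p = even i)" if "i < length (p # X @ [q])" for i
      using that
    proof (induction i)
      case (Suc i)
      hence "E ((p # X @ [q]) ! i) ((p # X @ [q]) ! Suc i)"
        using \<open>successively E (p # X @ [q])\<close> unfolding successively_conv_nth by blast
      from bip[OF this] Suc show ?case by auto
    qed simp
    have "odd (length X)" using step[of "Suc (length X)"] pq(2) by (auto simp: nth_append)
    thus ?thesis by (auto simp: path_len_def elim: oddE)
  qed
  have sep: "set (?e X) \<inter> set (?e Y) = {}"
    if "successively E (p # X @ [q])" "distinct (p # X @ [q])" "successively E (p # Y @ [q])" "distinct (p # Y @ [q])" "set X \<inter> set Y = {}" for X Y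
  proof (rule ccontr)
    assume "set (?e X) \<inter> set (?e Y) \<noteq> {}"
    then obtain x where x: "x \<in> set (?e X)" "x \<in> set (?e Y)" by blast
    have sub: "ends x \<subseteq> set (p # X @ [q])" if "successively E (p # X @ [q])" "x \<in> set (?e X)" for X
    proof -
      obtain i where i: "i < length (p # X @ [q]) - 1" "x = ?e X ! i" using \<open>x \<in> set (?e X)\<close> by (auto simp: in_set_conv_nth)
      hence "ends x = {(p # X @ [q]) ! i, (p # X @ [q]) ! Suc i}" using edges_nth(2)[OF that(1)] by simp
      moreover have "i < length (p # X @ [q])" "Suc i < length (p # X @ [q])" using i by auto
      ultimately show ?thesis by (metis empty_subsetI insert_subset nth_mem)
    qed
    \<comment> \<open>A common edge would join \<open>p\<close> to \<open>q\<close>, which lie on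
      the same side.\<close>
    have "ends x \<subseteq> {p, q}" using sub[OF that(1) x(1)] sub[OF that(3) x(2)] that(2,4,5) by auto
    hence "fst ` ends x \<subseteq> {fst p}" using pq(2) by auto
    thus False by (auto simp: ends_def)
  qed
  define H where "H = {A, B, I}"
  have H: "successively E (p # X @ [q])" "distinct (p # X @ [q])" if "X \<in> H" for X
    using that P dist by (auto simp: H_def)
  have Hdisj: "set X \<inter> set Y = {}" if "X \<in> H" "Y \<in> H" "X \<noteq> Y" for X Y
    using that disj by (auto simp: H_def)
  let ?X = "set (?e A @ ?e B @ ?e I)"
  have adj: "adj \<theta> x y \<longleftrightarrow> consec (?e A) x y \<or> consec (?e B) x y \<or> consec (?e I) x y \<or>
           {x, y} \<subseteq> {hd (?e A), hd (?e B), hd (?e I)} \<or> {x, y} \<subseteq> {last (?e A), last (?e B), last (?e I)}"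
    if xy: "x \<in> ?X" "y \<in> ?X" "x \<noteq> y" for x y
  proof -
    obtain X Y where XY: "X \<in> H" "Y \<in> H" "x \<in> set (?e X)" "y \<in> set (?e Y)" using xy by (auto simp: H_def)
    have V: "x \<in> V" "y \<in> V" using mem[OF H(1)] XY by blast+
    have consec_mem: "x \<in> set L" "y \<in> set L" if "consec L x y" for L
      using that by (auto simp: consec_def doubleton_eq_iff)
    have same: "ends x \<inter> ends y \<noteq> {}" if "Z \<in> H" "consec (?e Z) x y" for Z
      using edges_meet_same[OF H[OF that(1)] consec_mem[OF that(2)] xy(3)] that by blast
    show ?thesis
      unfolding adj_ends[OF V xy(3)]
    proof
      assume meet: "ends x \<inter> ends y \<noteq> {}"
      show "consec (?e A) x y \<or> consec (?e B) x y \<or> consec (?e I) x y \<or>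
           {x, y} \<subseteq> {hd (?e A), hd (?e B), hd (?e I)} \<or> {x, y} \<subseteq> {last (?e A), last (?e B), last (?e I)}"
      proof (cases "X = Y")
        case True
        hence "consec (?e X) x y" using edges_meet_same[OF H[OF XY(1)] XY(3) _ xy(3)] XY(4) meet by simp
        thus ?thesis using XY(1) by (auto simp: H_def)
      next
        case False
        from edges_meet_diff[OF H[OF XY(1)] H[OF XY(2)] Hdisj[OF XY(1,2) False] XY(3,4) meet]
        show ?thesis using XY(1,2) by (auto simp: H_def)
      qed
    next
      assume "consec (?e A) x y \<or> consec (?e B) x y \<or> consec (?e I) x y \<or>
           {x, y} \<subseteq> {hd (?e A), hd (?e B), hd (?e I)} \<or> {x, y} \<subseteq> {last (?e A), last (?e B), last (?e I)}"
      thus "ends x \<inter> ends y \<noteq> {}"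
      proof (elim disjE)
        assume *: "{x, y} \<subseteq> {hd (?e A), hd (?e B), hd (?e I)}"
        have "p \<in> ends x" "p \<in> ends y" using * hd_last_edges(3)[OF P(1)] hd_last_edges(3)[OF P(2)] hd_last_edges(3)[OF P(3)] by auto
        thus ?thesis by blast
      next
        assume *: "{x, y} \<subseteq> {last (?e A), last (?e B), last (?e I)}"
        have "q \<in> ends x" "q \<in> ends y" using * hd_last_edges(4)[OF P(1)] hd_last_edges(4)[OF P(2)] hd_last_edges(4)[OF P(3)] by auto
        thus ?thesis by blast
      qed (use same in \<open>auto simp: H_def\<close>)
    qed
  qed
  have "is_prism V \<theta> (?e A) (?e B) (?e I)"
    unfolding is_prism_def
  proof (intro conjI ballI impI)
    show "distinct (?e A @ ?e B @ ?e I)"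
      using distinct_edges[OF P(1) dist(1)] distinct_edges[OF P(2) dist(2)] distinct_edges[OF P(3) dist(3)]
        sep[OF P(1) dist(1) P(2) dist(2) disj(1)] sep[OF P(1) dist(1) P(3) dist(3) disj(2)] sep[OF P(2) dist(2) P(3) dist(3) disj(3)]
      by auto
    show "set (?e A @ ?e B @ ?e I) \<subseteq> V" using mem[OF P(1)] mem[OF P(2)] mem[OF P(3)] by simp
    show "2 \<le> length (?e A)" "2 \<le> length (?e B)" "2 \<le> length (?e I)"
      using len[OF P(1)] len[OF P(2)] len[OF P(3)] by simp_all
  qed (rule adj)
  thus ?thesis unfolding has_odd_prism_def using len[OF P(1)] len[OF P(2)] len[OF P(3)] by blast
qed

lemma nonadjacent_ends:
  assumes "u \<in> V" "v \<in> V" "santi \<theta> u v"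
  shows "distinct [end_of True u, end_of False u, end_of True v, end_of False v]" "ends u \<inter> ends v = {}"
proof -
  have "u \<noteq> v" using assms by auto
  thus "ends u \<inter> ends v = {}" using adj_ends[of u v] not_adj[of u v] assms by blast
  thus "distinct [end_of True u, end_of False u, end_of True v, end_of False v]"
    by (auto simp: ends_def dest: end_of_eq)
qed

text \<open>Every member of the switchable component contains one of the degree-two vertices to be
  avoided, so an even pair off these vertices is disjoint from the component.\<close>

theorem line_trigraph_even_pairs:
  assumes F: "in_F V \<theta>" and no_prism: "\<not> has_odd_prism V \<theta>"
  shows "(complete_tg V \<theta> \<or> (\<exists>u v. even_pair V \<theta> u v)) \<and>
    (favorable V \<theta> \<longrightarrow> (\<exists>u v. even_pair V \<theta> u v \<and> u \<notin> swD V \<theta> \<and> v \<notin> swD V \<theta>))"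
proof -
  interpret H: theta_free E fst
    by unfold_locales (use theta_gives_odd_prism no_prism in blast)
  have even: "\<exists>u v. even_pair V \<theta> u v \<and> ends u \<inter> M = {} \<and> ends v \<inter> M = {}" if M: "H.good_avoiding M" for M
  proof -
    from M obtain p b a q where g: "distinct [p, b, a, q]" "E p b" "E a q" "fst p = fst a" "H.good p b a q"
      "{p, b, a, q} \<inter> M = {}" unfolding H.good_avoiding_def by blast
    have "even_pair V \<theta> (edge p b) (edge a q)"
      using even_pair_if_good[OF g(2,3,1,4)] g(5) unfolding H.good_def by blast
    moreover have "ends (edge p b) \<inter> M = {}" "ends (edge a q) \<inter> M = {}" using edge(2) g by auto
    ultimately show ?thesis by blast
  qed
  have some: "\<exists>u v. even_pair V \<theta> u v" if "u \<in> V" "v \<in> V" "santi \<theta> u v" for u v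
  proof -
    have "E (end_of True u) (end_of False u)" "E (end_of True v) (end_of False v)"
      using EI[OF that(1), of True] EI[OF that(2), of True] by auto
    from even[OF H.good_pair_exists[OF this nonadjacent_ends(1)[OF that]]] show ?thesis by blast
  qed
  have "complete_tg V \<theta> \<or> (\<exists>u v. even_pair V \<theta> u v)"
    using some not_complete by metis
  moreover have "\<exists>u v. even_pair V \<theta> u v \<and> u \<notin> swD V \<theta> \<and> v \<notin> swD V \<theta>" if fav: "favorable V \<theta>"
    using F
  proof (cases rule: in_F_cases)
    case none
    with fav some show ?thesis unfolding favorable_def by auto
  next
    case (small x y)
    \<comment> \<open>Two nonadjacent non-neighbours \<open>e\<close>, \<open>g\<close> of
      \<open>x\<close> are edges of H disjoint from \<open>x\<close>, so they avoid not only the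
      shared end \<open>m\<close> but also the other end \<open>u\<close>.\<close>
    have main: ?thesis
      if xy: "x \<in> V" "y \<in> V" "semiadj \<theta> x y" "swD V \<theta> = {x, y}" and nc: "\<not> clique \<theta> (V - (swD V \<theta> \<union> nbhd V \<theta> x))" for x y
    proof -
      obtain e g where eg: "e \<in> V" "g \<in> V" "e \<noteq> x" "g \<noteq> x" "e \<noteq> y" "g \<noteq> y"
        "e \<notin> nbhd V \<theta> x" "g \<notin> nbhd V \<theta> x" "e \<noteq> g" "\<not> adj \<theta> e g"
        using nc xy(4) unfolding clique_def by auto
      hence sa: "santi \<theta> e g" and ex: "\<not> adj \<theta> e x" "\<not> adj \<theta> g x" using not_adj by (auto simp: nbhd_def)
      obtain s where s: "end_of s x = end_of s y" using semi_share[OF xy(1-3)] .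
      define m u w where "m = end_of s x" "u = end_of (\<not> s) x" "w = end_of (\<not> s) y"
      have at_m: "e = x \<or> e = y" if "e \<in> V" "end_of s e = m" for e
        using semi_common_end[OF xy(1,2) that(1) xy(3) s] that(2) by (simp add: m_u_w_def)
      have "H.good_avoiding {m}"
      proof (rule H.good_pair_avoiding_degree_two[of m u w])
        show "E m u" "E m w" using EI[OF xy(1), of s] EI[OF xy(2), of s] s by (auto simp: m_u_w_def)
        have "x \<noteq> y" using xy by auto
        thus "u \<noteq> w" using end_inj[OF xy(1,2) s] by (auto simp: m_u_w_def)
        show "z = u \<or> z = w" if mz: "E m z" for z
        proof -
          obtain e t where e: "e \<in> V" "m = end_of t e" "z = end_of (\<not> t) e" using mz unfolding E_def by blast
          have "t = s" using e(2) by (auto simp: m_u_w_def dest: end_of_eq)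
          thus ?thesis using at_m[of e] e by (auto simp: m_u_w_def)
        qed
        show "E (end_of True e) (end_of False e)" "E (end_of True g) (end_of False g)"
          using EI[OF eg(1), of True] EI[OF eg(2), of True] by auto
        show "distinct [end_of True e, end_of False e, end_of True g, end_of False g]"
          using nonadjacent_ends[OF eg(1,2) sa] by simp
        have "{m, u} = ends x" unfolding m_u_w_def using ends_alt by metis
        moreover have "ends e \<inter> ends x = {}" "ends g \<inter> ends x = {}" using adj_ends eg ex xy by auto
        moreover have "{end_of True e, end_of False e, end_of True g, end_of False g} = ends e \<union> ends g"
          by (auto simp: ends_def)
        ultimately show "{end_of True e, end_of False e, end_of True g, end_of False g} \<inter> {m, u} = {}" by auto
      qed
      then obtain a b where ab: "even_pair V \<theta> a b" "m \<notin> ends a" "m \<notin> ends b" using even by blast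
      have "m \<in> ends x" "m \<in> ends y" using s ends_alt unfolding m_u_w_def by (metis insertI1)+
      hence "a \<notin> {x, y}" "b \<notin> {x, y}" using ab by auto
      thus ?thesis using ab(1) xy(4) by auto
    qed
    from fav small(3,5) have "\<not> clique \<theta> (V - (swD V \<theta> \<union> nbhd V \<theta> x)) \<or> \<not> clique \<theta> (V - (swD V \<theta> \<union> nbhd V \<theta> y))"
      unfolding favorable_def by blast
    thus ?thesis
    proof
      assume "\<not> clique \<theta> (V - (swD V \<theta> \<union> nbhd V \<theta> x))"
      with main[OF small(1,2,4,5)] show ?thesis by simp
    next
      assume "\<not> clique \<theta> (V - (swD V \<theta> \<union> nbhd V \<theta> y))"
      moreover have "semiadj \<theta> y x" using small(4) symm(3)[OF small(1,2)] by simp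
      moreover have "swD V \<theta> = {y, x}" using small(5) by (simp add: insert_commute)
      ultimately show ?thesis using main[OF small(2,1)] by simp
    qed
  next
    case (light v x y)
    obtain s where s: "end_of s v = end_of s x" using semi_share[OF light(1,2,7)] .
    obtain t where t: "end_of t v = end_of t y" using semi_share[OF light(1,3,8)] .
    have "\<not> adj \<theta> x y" using light not_adj by blast
    have "t \<noteq> s"
    proof
      assume "t = s"
      hence "end_of s x = end_of s y" using s t by simp
      with adj_end[OF light(2,3,6)] \<open>\<not> adj \<theta> x y\<close> show False by blast
    qed
    hence "t = (\<not> s)" by (cases s) simp_all
    hence t: "end_of (\<not> s) v = end_of (\<not> s) y" using t by simp
    define m m' u w where "m = end_of s v" "m' = end_of (\<not> s) v" "u = end_of (\<not> s) x" "w = end_of s y"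
    note d = m_m'_u_w_def
    have at_m: "e = v \<or> e = x" if "e \<in> V" "end_of s e = m" for e
      using semi_common_end[OF light(1,2) that(1) light(7) s] that(2) by (simp add: d)
    have at_m': "e = v \<or> e = y" if "e \<in> V" "end_of (\<not> s) e = m'" for e
      using semi_common_end[OF light(1,3) that(1) light(8) t] that(2) by (simp add: d)
    obtain e g where eg: "e \<in> V" "g \<in> V" "santi \<theta> e g" "e \<notin> {v, x, y}" "g \<notin> {v, x, y}"
      using fav light(9) unfolding favorable_def by metis
    have "H.good_avoiding {m, m'}"
    proof (rule H.good_pair_avoiding_degree_two_edge[of m u m' w])
      show "E m u" "E m m'" "E m' w"
        using EI[OF light(1), of s] EI[OF light(2), of s] EI[OF light(3), of "\<not> s"] s t by (auto simp: d)
      show "z = u \<or> z = m'" if mz: "E m z" for z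
      proof -
        obtain e t where e: "e \<in> V" "m = end_of t e" "z = end_of (\<not> t) e" using mz unfolding E_def by blast
        have "t = s" using e(2) by (auto simp: d dest: end_of_eq)
        thus ?thesis using at_m[of e] e by (auto simp: d)
      qed
      show "z = w \<or> z = m" if mz: "E m' z" for z
      proof -
        obtain e t where e: "e \<in> V" "m' = end_of t e" "z = end_of (\<not> t) e" using mz unfolding E_def by blast
        have "t = (\<not> s)" using e(2) by (auto simp: d dest: end_of_eq)
        thus ?thesis using at_m'[of e] e by (auto simp: d)
      qed
      show "u \<noteq> m'" using end_inj[OF light(1,2) s] light(4) by (auto simp: d)
      show "w \<noteq> m" using end_inj[OF light(1,3) t] light(5) by (auto simp: d)
      \<comment> \<open>An edge of H between \<open>u\<close> and \<open>w\<close> would be a common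
        neighbour of \<open>x\<close> and \<open>y\<close> other than \<open>v\<close>.\<close>
      show "\<not> E u w"
      proof
        assume "E u w"
        then obtain k r where k: "k \<in> V" "u = end_of r k" "w = end_of (\<not> r) k" unfolding E_def by blast
        have "r = (\<not> s)" using k(2) by (auto simp: d dest: end_of_eq)
        hence k': "end_of (\<not> s) k = end_of (\<not> s) x" "end_of s k = end_of s y" using k by (auto simp: d)
        have "end_of r x \<noteq> end_of r y" for r using adj_end[OF light(2,3,6)] \<open>\<not> adj \<theta> x y\<close> by blast
        from this[of s] this[of "\<not> s"] have "k \<noteq> x" "k \<noteq> y" using k' by auto
        hence "adj \<theta> k x" "adj \<theta> k y" using adj_end k' k(1) light(2,3) by blast+
        hence "k = v" using light(12) k(1) unfolding nbhd_def by blast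
        thus False using k' end_inj[OF light(1,2) s] light(4) by auto
      qed
      show "E (end_of True e) (end_of False e)" "E (end_of True g) (end_of False g)"
        using EI[OF eg(1), of True] EI[OF eg(2), of True] by auto
      show "distinct [end_of True e, end_of False e, end_of True g, end_of False g]"
        using nonadjacent_ends[OF eg(1-3)] by simp
      have "{m, m'} = ends v" unfolding d using ends_alt by metis
      moreover have "\<not> adj \<theta> e v" "\<not> adj \<theta> g v"
        using light(10)[of e] light(10)[of g] eg light(1) symm(4)[of _ v] not_adj[of v] by auto
      hence "ends e \<inter> ends v = {}" "ends g \<inter> ends v = {}" using adj_ends eg light(1) by auto
      moreover have "{end_of True e, end_of False e, end_of True g, end_of False g} = ends e \<union> ends g"
        by (auto simp: ends_def)
      ultimately show "{end_of True e, end_of False e, end_of True g, end_of False g} \<inter> {m, m'} = {}" by auto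
    qed
    then obtain a b where ab: "even_pair V \<theta> a b" "ends a \<inter> {m, m'} = {}" "ends b \<inter> {m, m'} = {}" using even by blast
    have "m \<in> ends v" "m \<in> ends x" "m' \<in> ends y" using s t ends_alt unfolding d by (metis insertI1 insertI2)+
    hence "a \<notin> {v, x, y}" "b \<notin> {v, x, y}" using ab by auto
    thus ?thesis using ab(1) light(9) by auto
  qed
  ultimately show ?thesis by blast
qed

end

section \<open>Bipartite trigraphs and antihole-free graphs\<close>

context finite_trigraph
begin

definition has_even_pairs :: bool where
  "has_even_pairs \<longleftrightarrow> (complete_tg V \<theta> \<or> (\<exists>u v. even_pair V \<theta> u v)) \<and>
    (favorable V \<theta> \<longrightarrow> (\<exists>u v. even_pair V \<theta> u v \<and> u \<notin> swD V \<theta> \<and> v \<notin> swD V \<theta>))"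

lemma has_even_pairs_if_no_switch:
  assumes "swD V \<theta> = {}" and "\<And>u v. u \<in> V \<Longrightarrow> v \<in> V \<Longrightarrow> santi \<theta> u v \<Longrightarrow> \<exists>u v. even_pair V \<theta> u v"
  shows "has_even_pairs"
proof -
  have "complete_tg V \<theta> \<or> (\<exists>u v. even_pair V \<theta> u v)" using not_complete assms(2) by metis
  moreover have "favorable V \<theta> \<longrightarrow> (\<exists>u v. even_pair V \<theta> u v)" using assms(2) unfolding favorable_def by blast
  ultimately show ?thesis unfolding has_even_pairs_def assms(1) by simp
qed

section \<open>Bipartite trigraphs\<close>

lemma bipartite_even_pair:
  assumes AB: "A \<union> B = V" "A \<inter> B = {}" "strongly_stable \<theta> A" "strongly_stable \<theta> B" and uv: "u \<in> A" "v \<in> A" "u \<noteq> v"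
  shows "even_pair V \<theta> u v"
proof (rule even_pairI)
  show "u \<in> V" "v \<in> V" "santi \<theta> u v" using AB uv by (auto simp: strongly_stable_def)
  fix p n assume p: "is_path V \<theta> p" "length p = Suc n" "p ! 0 = u" "p ! n = v" "odd n"
  have "p ! i \<in> A \<longleftrightarrow> even i" if "i \<le> n" for i
    using that
  proof (induction i)
    case (Suc i)
    have "adj \<theta> (p ! i) (p ! Suc i)" using path_adj[OF p(1)] p(2) Suc.prems by simp
    moreover have "p ! i \<in> V" "p ! Suc i \<in> V" using path_mem[OF p(1)] p(2) Suc.prems by auto
    ultimately have "p ! i \<in> A \<longleftrightarrow> p ! Suc i \<notin> A"
      using AB unfolding strongly_stable_def by (metis UnE adj_iff disjoint_iff exclusive(1,3) irreflexive(4))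
    with Suc show ?case by auto
  qed (use p uv in simp)
  with p uv show False by blast
qed

text \<open>Without a suitable pair each side has at most one eligible vertex. For (1) this leaves
  at most two vertices. For (2) the five vertices force at least three into the switchable
  component, so only the light case remains.\<close>

theorem bipartite_case:
  assumes F: "in_F V \<theta>" and bip: "bipartite_tg V \<theta>"
  shows "has_even_pairs"
proof -
  obtain A B where AB: "A \<union> B = V" "A \<inter> B = {}" "strongly_stable \<theta> A" "strongly_stable \<theta> B"
    using bip unfolding bipartite_tg_def by blast
  have BA: "B \<union> A = V" "B \<inter> A = {}" using AB by auto
  have adj_opp: "u \<in> A \<longleftrightarrow> v \<in> B" if "adj \<theta> u v" "u \<in> V" "v \<in> V" for u v
    using AB that unfolding strongly_stable_def by (metis UnE adj_iff disjoint_iff exclusive(1,3) irreflexive(4))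
  have same: "even_pair V \<theta> u v" if "u \<in> V" "v \<in> V" "u \<noteq> v" "u \<in> A \<longleftrightarrow> v \<in> A" for u v
  proof (cases "u \<in> A")
    case True
    thus ?thesis using bipartite_even_pair[OF AB] that by blast
  next
    case False
    thus ?thesis using bipartite_even_pair[OF BA AB(4,3)] that AB(1) by blast
  qed
  have "complete_tg V \<theta> \<or> (\<exists>u v. even_pair V \<theta> u v)"
  proof (rule ccontr)
    assume *: "\<not> ?thesis"
    then obtain u v where uv: "u \<in> V" "v \<in> V" "santi \<theta> u v" using not_complete by blast
    hence "u \<noteq> v" by auto
    have "even_pair V \<theta> u v"
    proof (rule even_pair_dominated[OF uv])
      fix t assume t: "t \<in> V" "adj \<theta> t v" "t \<noteq> u"
      hence "t \<noteq> v" by auto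
      with same[of t u] same[of t v] same[of u v] uv t \<open>u \<noteq> v\<close> * show "sadj \<theta> u t" by blast
    qed
    with * show False by blast
  qed
  moreover have "\<exists>u v. even_pair V \<theta> u v \<and> u \<notin> swD V \<theta> \<and> v \<notin> swD V \<theta>" if fav: "favorable V \<theta>"
  proof (rule ccontr)
    assume no: "\<not> ?thesis"
    obtain u w where uw: "u \<in> V" "w \<in> V" "santi \<theta> u w" "u \<notin> swD V \<theta>" "w \<notin> swD V \<theta>"
      using fav unfolding favorable_def by blast
    hence ne: "u \<noteq> w" by auto
    have opp: "(u \<in> A) \<noteq> (w \<in> A)" using same[OF uw(1,2) ne] no uw by blast
    have V: "V \<subseteq> insert u (insert w (swD V \<theta>))"
    proof
      fix t assume t: "t \<in> V"
      show "t \<in> insert u (insert w (swD V \<theta>))"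
        using same[of t u] same[of t w] t uw opp no by blast
    qed
    have card5: "5 \<le> card V" using fav by (simp add: favorable_def)
    have big: "3 \<le> card (swD V \<theta>)" if "finite (swD V \<theta>)"
    proof -
      have "card V \<le> card (insert u (insert w (swD V \<theta>)))" by (rule card_mono[OF _ V]) (use that in simp)
      also have "\<dots> \<le> Suc (Suc (card (swD V \<theta>)))" using that by (simp add: card_insert_if)
      finally show ?thesis using card5 by simp
    qed
    from F show False
    proof (cases rule: in_F_cases)
      case none
      thus ?thesis using big by simp
    next
      case (small x y)
      show ?thesis using big small(3,5) by simp
    next
      case (light v x y)
      have xy: "x \<in> A \<longleftrightarrow> v \<in> B" "y \<in> A \<longleftrightarrow> v \<in> B"
        using adj_opp[of v x] adj_opp[of v y] light AB by (auto simp: adj_iff)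
      \<comment> \<open>\<open>w\<close> lies on the side of \<open>x\<close> and \<open>y\<close>,
        and \<open>v\<close> is strongly anticomplete to it; no neighbour of \<open>w\<close> other
        than \<open>u\<close> can exist, so domination holds vacuously.\<close>
      have main: "even_pair V \<theta> u w" if uw: "u \<in> V" "w \<in> V" "santi \<theta> u w" "w \<notin> {v, x, y}" "w \<in> A \<longleftrightarrow> x \<in> A"
         "V \<subseteq> insert u (insert w {v, x, y})" for u w
      proof (rule even_pair_dominated[OF uw(1-3)])
        fix t assume t: "t \<in> V" "adj \<theta> t w" "t \<noteq> u"
        have "t \<in> A \<longleftrightarrow> w \<notin> A" using adj_opp[OF t(2,1) uw(2)] uw(2) AB(1,2) by blast
        hence "t \<noteq> x" "t \<noteq> y" using uw(5) xy by auto
        hence "t = v" using t uw(6) by auto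
        hence "santi \<theta> t w" using light(10)[of w] uw by auto
        with t(2) show "sadj \<theta> u t" by (auto simp: adj_iff dest: exclusive)
      qed
      have "even_pair V \<theta> u w \<or> even_pair V \<theta> w u"
      proof (cases "w \<in> A \<longleftrightarrow> x \<in> A")
        case True
        thus ?thesis using main[of u w] uw V light(9) by auto
      next
        case False
        hence "u \<in> A \<longleftrightarrow> x \<in> A" using opp by blast
        thus ?thesis using main[of w u] uw V light(9) symm(2)[of u w] by auto
      qed
      with no uw show False by blast
    qed
  qed
  ultimately show ?thesis unfolding has_even_pairs_def by blast
qed

text \<open>Maximality of \<open>F\<close> makes the neighbours in \<open>C F\<close> of any vertex
  outside \<open>F\<close> and \<open>C F\<close> a clique. So a path \<open>u a b v\<close> with
  exactly one of \<open>a\<close>, \<open>b\<close> in \<open>C F\<close> is impossible; with both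
  outside, an induced antipath from \<open>a\<close> to \<open>b\<close> through \<open>F\<close>
  closes up with \<open>u\<close> and \<open>v\<close> to an antihole.\<close>

lemma nonadjacent_without_P4:
  assumes no_semi: "\<And>u v. u \<in> V \<Longrightarrow> v \<in> V \<Longrightarrow> \<not> semiadj \<theta> u v" and no_hole: "\<not> has_antihole V \<theta>"
    and "S \<subseteq> V" "\<not> clique \<theta> S"
  shows "\<exists>u\<in>S. \<exists>v\<in>S. santi \<theta> u v \<and>
    (\<forall>a\<in>S. \<forall>b\<in>S. adj \<theta> u a \<longrightarrow> adj \<theta> a b \<longrightarrow> adj \<theta> b v \<longrightarrow> antiadj \<theta> u b \<longrightarrow> \<not> antiadj \<theta> a v)"
  using assms(3,4)
proof (induction "card S" arbitrary: S rule: less_induct)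
  case less
  have both: "\<not> antiadj \<theta> a b" if "adj \<theta> a b" "a \<in> V" "b \<in> V" for a b
    using that no_semi[of a b] by (auto simp: adj_iff antiadj_iff dest: exclusive)
  have one: "adj \<theta> a b \<or> antiadj \<theta> a b" if "a \<noteq> b" "a \<in> V" "b \<in> V" for a b
    using that trichotomy by (auto simp: adj_iff antiadj_iff)
  obtain u0 v0 where uv0: "u0 \<in> S" "v0 \<in> S" "santi \<theta> u0 v0"
    using less.prems not_adj unfolding clique_def by blast
  show ?case
  proof (cases "\<forall>z\<in>S. clique \<theta> {w \<in> S. adj \<theta> z w}")
    \<comment> \<open>If all neighbourhoods are cliques, there is no induced path on three vertices,
      so any nonadjacent pair will do.\<close>
    case True
    have "\<not> antiadj \<theta> u0 b" if "a \<in> S" "b \<in> S" "adj \<theta> u0 a" "adj \<theta> a b" for a b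
    proof
      assume anti: "antiadj \<theta> u0 b"
      have "adj \<theta> a u0" using that uv0 less.prems(1) symm(4)[of u0 a] by blast
      hence "adj \<theta> u0 b \<or> u0 = b" using True that uv0(1) unfolding clique_def by blast
      with anti both[of u0 b] that uv0(1) less.prems(1) show False by auto
    qed
    with uv0 show ?thesis by blast
  next
    case False
    define conn where "conn F \<longleftrightarrow> (\<forall>a\<in>F. \<forall>b\<in>F. (\<lambda>x y. antiadj \<theta> x y \<and> x \<in> F \<and> y \<in> F)\<^sup>*\<^sup>* a b)" for F
    define C where "C F = {w \<in> S - F. \<forall>z\<in>F. adj \<theta> w z}" for F
    define P where "P F \<longleftrightarrow> F \<subseteq> S \<and> F \<noteq> {} \<and> conn F \<and> \<not> clique \<theta> (C F)" for F
    have finS: "finite S" using less.prems(1) finite_V finite_subset by blast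
    obtain z where z: "z \<in> S" "\<not> clique \<theta> {w \<in> S. adj \<theta> z w}" using False by blast
    have "C {z} = {w \<in> S. adj \<theta> z w}"
      using z(1) less.prems(1) symm(4)[of z] by (auto simp: C_def)
    hence "P {z}" using z by (auto simp: P_def conn_def)
    moreover have "\<forall>F. P F \<longrightarrow> card F < Suc (card S)" using finS card_mono by (auto simp: P_def less_Suc_eq_le)
    ultimately obtain F where F: "P F" and max: "\<And>F'. P F' \<Longrightarrow> card F' \<le> card F"
      using ex_has_greatest_nat[of P "{z}" card "Suc (card S)"] by blast
    have FS: "F \<subseteq> S" "F \<noteq> {}" "conn F" "\<not> clique \<theta> (C F)" using F by (auto simp: P_def)
    have CS: "C F \<subseteq> S" by (auto simp: C_def)
    have attach: "\<exists>y\<in>F. antiadj \<theta> z y" if "z \<in> S - F" "z \<notin> C F" for z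
    proof -
      from that obtain y where "y \<in> F" "\<not> adj \<theta> z y" by (auto simp: C_def)
      moreover from this have "z \<noteq> y" "z \<in> V" "y \<in> V" using that FS(1) less.prems(1) by auto
      ultimately show ?thesis using one by blast
    qed
    \<comment> \<open>Otherwise \<open>insert z F\<close>, anticonnected by \<open>attach\<close>,
      would still have the nonadjacent common neighbours \<open>w\<close> and
      \<open>w'\<close>.\<close>
    have nbr: "adj \<theta> w w'" if z: "z \<in> S - F" "z \<notin> C F" and w: "w \<in> C F" "w' \<in> C F" "adj \<theta> w z" "adj \<theta> w' z" "w \<noteq> w'" for z w w'
    proof (rule ccontr)
      assume nadj: "\<not> adj \<theta> w w'"
      let ?R = "\<lambda>x y. antiadj \<theta> x y \<and> x \<in> insert z F \<and> y \<in> insert z F"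
      obtain y where y: "y \<in> F" "antiadj \<theta> z y" using attach[OF z] by blast
      have yz: "antiadj \<theta> y z" using y z FS(1) less.prems(1) symm(5)[of z y] by blast
      have inF: "?R\<^sup>*\<^sup>* a b" if "a \<in> F" "b \<in> F" for a b
      proof -
        have "(\<lambda>x y. antiadj \<theta> x y \<and> x \<in> F \<and> y \<in> F)\<^sup>*\<^sup>* a b" using FS(3) that by (simp add: conn_def)
        thus ?thesis by (rule rtranclp_mono[THEN predicate2D, rotated]) auto
      qed
      have "?R\<^sup>*\<^sup>* z y" "?R\<^sup>*\<^sup>* y z" using y yz by auto
      hence "conn (insert z F)" unfolding conn_def using inF[OF y(1)] inF[OF _ y(1)]
        by (auto intro: rtranclp_trans)
      moreover have "{w, w'} \<subseteq> C (insert z F)" using w z by (auto simp: C_def)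
      hence "\<not> clique \<theta> (C (insert z F))" using nadj w(5) by (auto simp: clique_def)
      ultimately have "P (insert z F)" using FS z by (simp add: P_def)
      from max[OF this] have "Suc (card F) \<le> card F" using z finite_subset[OF FS(1) finS] by simp
      thus False by simp
    qed
    have "C F \<subset> S" using CS FS(1,2) by (auto simp: C_def)
    hence "card (C F) < card S" using finS by (simp add: psubset_card_mono)
    from less.hyps[OF this _ FS(4)] CS less.prems(1) obtain u v where uv: "u \<in> C F" "v \<in> C F" "santi \<theta> u v"
      and ih: "\<And>a b. a \<in> C F \<Longrightarrow> b \<in> C F \<Longrightarrow> adj \<theta> u a \<Longrightarrow> adj \<theta> a b \<Longrightarrow> adj \<theta> b v \<Longrightarrow> antiadj \<theta> u b \<Longrightarrow> \<not> antiadj \<theta> a v"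
      by blast
    have SV: "x \<in> V" if "x \<in> S" for x using that less.prems(1) by blast
    have uvS: "u \<in> S" "v \<in> S" "u \<in> V" "v \<in> V" using uv CS SV by auto
    have Fuv: "adj \<theta> u z" "adj \<theta> v z" "adj \<theta> z u" "adj \<theta> z v" if "z \<in> F" for z
      using that uv uvS FS(1) SV symm(4)[of z u] symm(4)[of z v] unfolding C_def by blast+
    have "False" if ab: "a \<in> S" "b \<in> S" "adj \<theta> u a" "adj \<theta> a b" "adj \<theta> b v" "antiadj \<theta> u b" "antiadj \<theta> a v" for a b
    proof -
      have abV: "a \<in> V" "b \<in> V" using ab SV by auto
      have sy: "adj \<theta> a u" "adj \<theta> v b" "antiadj \<theta> b u" "antiadj \<theta> v a" "adj \<theta> b a"
        using ab abV uvS symm(4)[of u a] symm(4)[of b v] symm(5)[of u b] symm(5)[of a v] symm(4)[of a b] by simp_all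
      have nF: "a \<notin> F" "b \<notin> F" using Fuv[of a] Fuv[of b] both ab abV uvS by blast+
      have ne: "a \<noteq> v" "u \<noteq> b" "a \<noteq> b" "u \<noteq> v" "a \<noteq> u" "b \<noteq> v" using ab uv by auto
      consider "a \<in> C F" "b \<in> C F" | "a \<in> C F" "b \<notin> C F" | "a \<notin> C F" "b \<in> C F" | "a \<notin> C F" "b \<notin> C F" by blast
      thus False
      proof cases
        case 1
        with ih ab show False by blast
      next
        case 2
        have "adj \<theta> a v" by (rule nbr[of b]) (use 2 ab nF uv sy ne in auto)
        with both ab(7) abV uvS show False by blast
      next
        case 3
        have "adj \<theta> u b" by (rule nbr[of a]) (use 3 ab nF uv sy ne in auto)
        with both ab(6) abV uvS show False by blast
      next
        case 4
        define X where "X = insert a (insert b F)"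
        let ?R = "\<lambda>x y. antiadj \<theta> x y \<and> x \<in> X \<and> y \<in> X"
        obtain y y' where y: "y \<in> F" "antiadj \<theta> a y" "y' \<in> F" "antiadj \<theta> b y'"
          using attach[of a] attach[of b] 4 ab nF by blast
        have "antiadj \<theta> y' b" using y abV FS(1) SV symm(5)[of b y'] by blast
        have "(\<lambda>x y. antiadj \<theta> x y \<and> x \<in> F \<and> y \<in> F)\<^sup>*\<^sup>* y y'" using FS(3) y by (simp add: conn_def)
        hence "?R\<^sup>*\<^sup>* y y'" by (rule rtranclp_mono[THEN predicate2D, rotated]) (auto simp: X_def)
        moreover have "?R\<^sup>*\<^sup>* a y" "?R\<^sup>*\<^sup>* y' b"
          using y \<open>antiadj \<theta> y' b\<close> by (auto simp: X_def intro!: r_into_rtranclp)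
        ultimately have "?R\<^sup>*\<^sup>* a b" by (metis (no_types, lifting) rtranclp_trans)
        then obtain xs where xs: "xs \<noteq> []" "hd xs = a" "last xs = b" "successively ?R xs" "distinct xs"
          "\<And>i j. Suc i < j \<Longrightarrow> j < length xs \<Longrightarrow> \<not> ?R (xs ! i) (xs ! j)" by (rule rtranclp_induced_path) blast
        define m where "m = length xs"
        have x0: "xs ! 0 = a" "xs ! (m - 1) = b" using xs(1-3) by (auto simp: m_def hd_conv_nth last_conv_nth)
        have Rstep: "?R (xs ! i) (xs ! Suc i)" if "Suc i < m" for i
          using xs(4) that by (simp add: m_def successively_conv_nth)
        have "m \<noteq> 0" "m \<noteq> 1" using xs(1) x0 ne by (auto simp: m_def)
        \<comment> \<open>\<open>a\<close> and \<open>b\<close> are adjacent, so the antipath has an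
          inner vertex and the antihole gets at least five vertices.\<close>
        moreover have "m \<noteq> 2" using Rstep[of 0] x0 both[OF ab(4) abV] by auto
        ultimately have m3: "3 \<le> m" by linarith
        have inX: "xs ! i \<in> X" if "i < m" for i
        proof (cases i)
          case 0
          thus ?thesis using x0 by (simp add: X_def)
        next
          case (Suc k)
          thus ?thesis using Rstep[of k] that by simp
        qed
        have xeq: "xs ! i = xs ! j \<longleftrightarrow> i = j" if "i < m" "j < m" for i j
          using xs(5) that by (simp add: m_def nth_eq_iff_index_eq)
        have inF: "xs ! i \<in> F" if "0 < i" "i < m - 1" for i
          using inX[of i] xeq[of i 0] xeq[of i "m - 1"] x0 that by (auto simp: X_def)
        have XV: "X \<subseteq> V" using abV FS(1) SV by (auto simp: X_def)
        have uvX: "u \<notin> X" "v \<notin> X" using uv ne sy uvS ab by (auto simp: X_def C_def)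
        have xV: "xs ! i \<in> V" if "i < m" for i using inX[OF that] XV by blast
        \<comment> \<open>In the complement the hole runs from \<open>a\<close> through
          \<open>F\<close> to \<open>b\<close>, then to \<open>u\<close>, to \<open>v\<close> and
          back to \<open>a\<close>.\<close>
        let ?h = "xs @ [u, v]"
        have hn: "?h ! i = (if i < m then xs ! i else if i = m then u else v)" if "i < m + 2" for i
          using that by (auto simp: nth_append m_def)
        have setxs: "set xs \<subseteq> X" using inX by (auto simp: in_set_conv_nth m_def)
        have "is_hole V (compl \<theta>) ?h"
          unfolding is_hole_def
        proof (intro conjI allI impI)
          show "5 \<le> length ?h" using m3 by (simp add: m_def)
          show "distinct ?h" using xs(5) setxs uvX ne by auto
          show "set ?h \<subseteq> V" using setxs XV uvS by auto
          fix i j assume ij: "i < length ?h" "j < length ?h" "i < j"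
          have len: "length ?h = m + 2" by (simp add: m_def)
          note ij = ij[unfolded len]
          { assume "j - i = 1 \<or> j - i = length ?h - 1"
            hence "j = Suc i \<or> i = 0 \<and> j = m + 1" using ij len by linarith
            thus "adj (compl \<theta>) (?h ! i) (?h ! j)"
            proof
              assume j: "j = Suc i"
              show ?thesis
              proof (cases "j < m")
                case True
                thus ?thesis using Rstep[of i] j hn ij by simp
              next
                case False
                hence "i = m - 1 \<and> j = m \<or> i = m \<and> j = m + 1" using j ij by linarith
                thus ?thesis using hn[of i] hn[of j] x0 sy uv(3) m3 by (auto simp: antiadj_iff)
              qed
            next
              assume "i = 0 \<and> j = m + 1"
              thus ?thesis using hn[of i] hn[of j] x0 ab m3 by simp
            qed }
          { assume "\<not> (j - i = 1 \<or> j - i = length ?h - 1)"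
            hence nc: "Suc i < j" "\<not> (i = 0 \<and> j = m + 1)" using ij len by auto
            have "adj \<theta> (?h ! i) (?h ! j)"
            proof (cases "j < m")
              case True
              hence "\<not> antiadj \<theta> (xs ! i) (xs ! j)" using xs(6)[OF nc(1)] inX nc by (auto simp: m_def)
              moreover have "xs ! i \<noteq> xs ! j" using xeq True nc by auto
              ultimately have "adj \<theta> (xs ! i) (xs ! j)"
                using one[of "xs ! i" "xs ! j"] xV[of i] xV[of j] True nc by auto
              thus ?thesis using True nc hn[of i] hn[of j] by auto
            next
              case False
              hence im: "i < m" "j = m \<or> j = m + 1" using nc ij by auto
              show ?thesis
              proof (cases "i = 0 \<or> i = m - 1")
                case True
                hence "i = 0 \<and> j = m \<or> i = m - 1 \<and> j = m + 1" using nc im m3 by auto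
                thus ?thesis using hn[of i] hn[of j] x0 ab sy m3 by auto
              next
                case False
                hence "xs ! i \<in> F" using inF im by auto
                thus ?thesis using hn[of i] hn[of j] im Fuv by auto
              qed
            qed
            thus "antiadj (compl \<theta>) (?h ! i) (?h ! j)" by simp }
        qed
        with no_hole show False unfolding has_antihole_def is_antihole_def by simp
      qed
    qed
    with uv uvS show ?thesis by blast
  qed
qed

lemma has_even_pairs_if_short_paths:
  assumes "\<And>u v. u \<in> V \<Longrightarrow> v \<in> V \<Longrightarrow> \<not> semiadj \<theta> u v" "swD V \<theta> = {}" "\<not> has_antihole V \<theta>"
    and short: "\<And>p. is_path V \<theta> p \<Longrightarrow> length p \<le> 5"
  shows "has_even_pairs"
proof (rule has_even_pairs_if_no_switch[OF assms(2)])
  fix u v assume uv: "u \<in> V" "v \<in> V" "santi \<theta> u v"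
  moreover from this have "u \<noteq> v" by auto
  ultimately have "\<not> clique \<theta> V" using not_adj[of u v] unfolding clique_def by blast
  from nonadjacent_without_P4[OF assms(1,3) subset_refl this]
  obtain a b where "a \<in> V" "b \<in> V" "santi \<theta> a b"
    "\<And>c d. c \<in> V \<Longrightarrow> d \<in> V \<Longrightarrow> adj \<theta> a c \<Longrightarrow> adj \<theta> c d \<Longrightarrow> adj \<theta> d b \<Longrightarrow> antiadj \<theta> a d \<Longrightarrow> \<not> antiadj \<theta> c b"
    by blast
  with even_pair_short[OF _ _ _ short] show "\<exists>u v. even_pair V \<theta> u v" by blast
qed

end

section \<open>Complements of bipartite and of line trigraphs\<close>

context finite_trigraph
begin

lemma clique_mono: "clique \<theta> X \<Longrightarrow> Y \<subseteq> X \<Longrightarrow> clique \<theta> Y"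
  by (auto simp: clique_def)

lemma antihole6_listI:
  assumes "length h = 6" "distinct h" "set h \<subseteq> V"
    and "\<And>i. i < 5 \<Longrightarrow> antiadj \<theta> (h ! i) (h ! Suc i)" "antiadj \<theta> (h ! 0) (h ! 5)"
    and "\<And>i j. Suc i < j \<Longrightarrow> j < 6 \<Longrightarrow> (i, j) \<noteq> (0, 5) \<Longrightarrow> adj \<theta> (h ! i) (h ! j)"
  shows "has_antihole V \<theta>"
proof -
  have "is_hole V (compl \<theta>) h"
    unfolding is_hole_def
  proof (intro conjI allI impI)
    fix i j assume ij: "i < length h" "j < length h" "i < j"
    { assume "j - i = 1 \<or> j - i = length h - 1"
      hence "j = Suc i \<and> i < 5 \<or> i = 0 \<and> j = 5" using ij assms(1) by linarith
      thus "adj (compl \<theta>) (h ! i) (h ! j)" using assms(4,5) by auto }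
    { assume "\<not> (j - i = 1 \<or> j - i = length h - 1)"
      hence "Suc i < j" "j < 6" "(i, j) \<noteq> (0, 5)" using ij assms(1) by auto
      thus "antiadj (compl \<theta>) (h ! i) (h ! j)" using assms(6) by simp }
  qed (use assms in auto)
  thus ?thesis by (auto simp: has_antihole_def is_antihole_def)
qed

lemma antihole6I:
  assumes "distinct [a, b, c, d, e, g]" "{a, b, c, d, e, g} \<subseteq> V"
    and "antiadj \<theta> a b" "antiadj \<theta> b c" "antiadj \<theta> c d" "antiadj \<theta> d e" "antiadj \<theta> e g" "antiadj \<theta> a g"
    and "adj \<theta> a c" "adj \<theta> a d" "adj \<theta> a e" "adj \<theta> b d" "adj \<theta> b e" "adj \<theta> b g"
      "adj \<theta> c e" "adj \<theta> c g" "adj \<theta> d g"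
  shows "has_antihole V \<theta>"
proof (rule antihole6_listI[of "[a, b, c, d, e, g]"])
  fix i :: nat assume "i < 5"
  hence "i \<in> {0, 1, 2, 3, 4}" by auto
  thus "antiadj \<theta> ([a, b, c, d, e, g] ! i) ([a, b, c, d, e, g] ! Suc i)" using assms by auto
next
  fix i j :: nat assume "Suc i < j" "j < 6" "(i, j) \<noteq> (0, 5)"
  moreover from this have "i \<in> {0, 1, 2, 3}" "j \<in> {2, 3, 4, 5}" by auto
  ultimately show "adj \<theta> ([a, b, c, d, e, g] ! i) ([a, b, c, d, e, g] ! j)"
    using assms(9-) by (elim insertE emptyE) simp_all
qed (use assms in auto)

theorem cobipartite_case:
  assumes F: "in_F V \<theta>" and bip: "bipartite_tg V (compl \<theta>)" and no_hole: "\<not> has_antihole V \<theta>"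
  shows "has_even_pairs"
proof -
  obtain A B where AB: "A \<union> B = V" "A \<inter> B = {}" "strongly_stable (compl \<theta>) A" "strongly_stable (compl \<theta>) B"
    using bip unfolding bipartite_tg_def by blast
  have A: "sadj \<theta> u v" if "u \<in> A" "v \<in> A" "u \<noteq> v" for u v using AB that by (auto simp: strongly_stable_def)
  have B: "sadj \<theta> u v" if "u \<in> B" "v \<in> B" "u \<noteq> v" for u v using AB that by (auto simp: strongly_stable_def)
  \<comment> \<open>Of \<open>p ! 0\<close>, \<open>p ! 2\<close>, \<open>p ! 4\<close> two lie in
    the same strong clique, although they are antiadjacent.\<close>
  have short: "length p \<le> 5" if p: "is_path V \<theta> p" for p
  proof (rule ccontr)
    assume "\<not> length p \<le> 5"
    hence l: "0 < length p" "2 < length p" "4 < length p" by auto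
    have ne: "p ! 0 \<noteq> p ! 2" "p ! 0 \<noteq> p ! 4" "p ! 2 \<noteq> p ! 4" using path_eq[OF p] l by auto
    have "antiadj \<theta> (p ! 0) (p ! 2)" "antiadj \<theta> (p ! 0) (p ! 4)" "antiadj \<theta> (p ! 2) (p ! 4)"
      using path_antiadj[OF p] l by auto
    hence "\<not> sadj \<theta> (p ! 0) (p ! 2)" "\<not> sadj \<theta> (p ! 0) (p ! 4)" "\<not> sadj \<theta> (p ! 2) (p ! 4)"
      by (auto simp: antiadj_iff dest: exclusive)
    moreover have "p ! 0 \<in> V" "p ! 2 \<in> V" "p ! 4 \<in> V" using path_mem[OF p] l by auto
    ultimately show False using A B ne AB(1) by (metis UnE)
  qed
  have opp: "u \<in> A \<longleftrightarrow> v \<in> B" if "semiadj \<theta> u v" "u \<in> V" "v \<in> V" for u v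
  proof -
    have "u \<noteq> v" using that by auto
    moreover have "\<not> sadj \<theta> u v" using that by (auto dest: exclusive)
    ultimately show ?thesis using A[of u v] B[of u v] AB(1,2) that(2,3) by blast
  qed
  from F show ?thesis
  proof (cases rule: in_F_cases)
    case none
    thus ?thesis using has_even_pairs_if_short_paths[OF _ _ no_hole short] by blast
  next
    case (light v x y)
    have "v \<in> A \<longleftrightarrow> x \<in> B" "v \<in> A \<longleftrightarrow> y \<in> B"
      using opp[OF light(7,1,2)] opp[OF light(8,1,3)] by auto
    hence "sadj \<theta> x y" using A[of x y] B[of x y] light(2,3,6) AB(1,2) by blast
    with light(11) show ?thesis by (auto dest: exclusive)
  next
    case (small x y)
    have main: "has_even_pairs" if P: "P \<union> Q = V" "P \<inter> Q = {}" "x \<in> P" "y \<in> Q"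
      and P': "\<And>u v. u \<in> P \<Longrightarrow> v \<in> P \<Longrightarrow> u \<noteq> v \<Longrightarrow> sadj \<theta> u v" and Q': "\<And>u v. u \<in> Q \<Longrightarrow> v \<in> Q \<Longrightarrow> u \<noteq> v \<Longrightarrow> sadj \<theta> u v"
      for P Q
    proof -
      have xyV: "adj \<theta> x y" "adj \<theta> y x" using small(1,2,4) symm(4)[of x y] by (auto simp: adj_iff)
      have yP: "santi \<theta> p y" if "p \<in> P" "p \<noteq> x" for p
      proof -
        have "p \<in> V" "p \<noteq> y" using that P by auto
        moreover have "adj \<theta> p x" using P'[of p x] that P(3) by (simp add: adj_iff)
        ultimately show ?thesis using small(2,6) not_adj[of p y] unfolding nbhd_def by blast
      qed
      have xQ: "santi \<theta> q x" if "q \<in> Q" "q \<noteq> y" for q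
      proof -
        have "q \<in> V" "q \<noteq> x" using that P by auto
        moreover have "adj \<theta> q y" using Q'[of q y] that P(4) by (simp add: adj_iff)
        ultimately show ?thesis using small(1,6) not_adj[of q x] unfolding nbhd_def by blast
      qed
      \<comment> \<open>The non-neighbours of \<open>x\<close> off the pair lie in \<open>Q\<close>
        and those of \<open>y\<close> in \<open>P\<close>, both strong cliques; so the trigraph is
        not favorable and only (1) is left.\<close>
      have clique: "clique \<theta> (V - ({x, y} \<union> nbhd V \<theta> x))" "clique \<theta> (V - ({x, y} \<union> nbhd V \<theta> y))"
      proof -
        have "V - ({x, y} \<union> nbhd V \<theta> x) \<subseteq> Q" "V - ({x, y} \<union> nbhd V \<theta> y) \<subseteq> P"
          using P'[OF _ P(3)] Q'[OF _ P(4)] P(1) by (auto simp: nbhd_def adj_iff)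
        thus "clique \<theta> (V - ({x, y} \<union> nbhd V \<theta> x))" "clique \<theta> (V - ({x, y} \<union> nbhd V \<theta> y))"
          using clique_mono[OF _ \<open>V - ({x, y} \<union> nbhd V \<theta> x) \<subseteq> Q\<close>] clique_mono[OF _ \<open>V - ({x, y} \<union> nbhd V \<theta> y) \<subseteq> P\<close>]
            P' Q' by (simp_all add: clique_def adj_iff)
      qed
      hence nf: "\<not> favorable V \<theta>" using small(3,5) unfolding favorable_def by auto
      \<comment> \<open>\<open>b\<close> is chosen with fewest antineighbours in \<open>P\<close>.
        On a path \<open>x a b' b\<close>, \<open>a\<close> is antiadjacent to \<open>b\<close> but
        not to \<open>b'\<close>, so minimality supplies an \<open>a'\<close> with the opposite
        behaviour, and \<open>x b a y a' b'\<close> is an antihole.\<close>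
      have half: "\<exists>u v. even_pair V \<theta> u v"
        if P: "P \<union> Q = V" "P \<inter> Q = {}" "x \<in> P" "y \<in> Q" "Q \<noteq> {y}"
          and P': "\<And>u v. u \<in> P \<Longrightarrow> v \<in> P \<Longrightarrow> u \<noteq> v \<Longrightarrow> sadj \<theta> u v" and Q': "\<And>u v. u \<in> Q \<Longrightarrow> v \<in> Q \<Longrightarrow> u \<noteq> v \<Longrightarrow> sadj \<theta> u v"
          and yP: "\<And>p. p \<in> P \<Longrightarrow> p \<noteq> x \<Longrightarrow> santi \<theta> p y" and xQ: "\<And>q. q \<in> Q \<Longrightarrow> q \<noteq> y \<Longrightarrow> santi \<theta> q x"
          and xy: "adj \<theta> x y" and semi: "\<And>u v. u \<in> V \<Longrightarrow> v \<in> V \<Longrightarrow> semiadj \<theta> u v \<Longrightarrow> {u, v} = {x, y}"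
        for P Q x y
      proof -
        define N where "N b = {a \<in> P. antiadj \<theta> a b}" for b
        have finN: "finite (N b)" for b using finite_V P(1) by (auto simp: N_def intro: finite_subset[of _ V])
        obtain b0 where b0: "b0 \<in> Q - {y}" using P(4,5) by blast
        obtain b where b: "b \<in> Q - {y}" and min: "\<And>b'. b' \<in> Q - {y} \<Longrightarrow> card (N b) \<le> card (N b')"
          using ex_has_least_nat[of "\<lambda>b. b \<in> Q - {y}" b0 "\<lambda>b. card (N b)"] b0 by blast
        have bV: "b \<in> V" "x \<in> V" "y \<in> V" using b P by auto
        have sa: "santi \<theta> x b" using xQ[of b] b symm(2)[of b x] bV by auto
        have "even_pair V \<theta> x b"
        proof (rule even_pair_short[OF bV(2,1) sa short])
          fix a b' assume ab: "a \<in> V" "b' \<in> V" "adj \<theta> x a" "adj \<theta> a b'" "adj \<theta> b' b" "antiadj \<theta> x b'" "antiadj \<theta> a b"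
          have "a \<noteq> y"
          proof
            assume "a = y"
            hence "sadj \<theta> a b" using Q'[of y b] P(4) b by auto
            with ab(7) show False by (auto simp: antiadj_iff dest: exclusive)
          qed
          have "a \<in> P"
          proof (rule ccontr)
            assume "a \<notin> P"
            hence "santi \<theta> a x" using xQ[of a] \<open>a \<noteq> y\<close> ab P by auto
            with ab(3) symm(2)[of a x] ab(1) bV show False by (auto simp: adj_iff dest: exclusive)
          qed
          have "a \<noteq> x" using ab(3) by auto
          have "b' \<in> Q"
          proof (rule ccontr)
            assume "b' \<notin> Q"
            hence "b' \<in> P" "b' \<noteq> x" using ab P by auto
            hence "sadj \<theta> x b'" using P' P(3) by auto
            with ab(6) show False by (auto simp: antiadj_iff dest: exclusive)
          qed
          have "b' \<noteq> y" using yP[OF \<open>a \<in> P\<close> \<open>a \<noteq> x\<close>] ab(4) by (auto simp: adj_iff dest: exclusive)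
          have cross: "adj \<theta> c d \<longleftrightarrow> \<not> antiadj \<theta> c d" if "c \<in> P" "d \<in> Q" "d \<noteq> y" for c d
          proof -
            have "c \<in> V" "d \<in> V" "c \<noteq> d" "{c, d} \<noteq> {x, y}" using that P by (auto simp: doubleton_eq_iff)
            thus ?thesis using semi trichotomy[of c d] unfolding adj_iff antiadj_iff by (metis exclusive(1))
          qed
          have "a \<in> N b" "a \<notin> N b'" using ab \<open>a \<in> P\<close> \<open>b' \<in> Q\<close> \<open>b' \<noteq> y\<close> cross by (auto simp: N_def)
          have "\<not> N b' \<subseteq> N b"
          proof
            assume "N b' \<subseteq> N b"
            hence "N b' \<subset> N b" using \<open>a \<in> N b\<close> \<open>a \<notin> N b'\<close> by blast
            hence "card (N b') < card (N b)" using finN by (simp add: psubset_card_mono)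
            with min[of b'] \<open>b' \<in> Q\<close> \<open>b' \<noteq> y\<close> show False by simp
          qed
          then obtain a' where a': "a' \<in> P" "antiadj \<theta> a' b'" "\<not> antiadj \<theta> a' b" unfolding N_def by blast
          have "adj \<theta> a' b" using cross[of a' b] a' b by auto
          have "a' \<noteq> x" using sa a'(3) by (auto simp: antiadj_iff)
          have "a' \<noteq> a" using ab(7) a'(3) by auto
          have V: "a' \<in> V" using a' P by auto
          have "b \<noteq> b'" using ab(5) by auto
          have ya: "santi \<theta> a y" "santi \<theta> a' y" using yP \<open>a \<in> P\<close> \<open>a \<noteq> x\<close> a'(1) \<open>a' \<noteq> x\<close> by auto
          have "has_antihole V \<theta>"
          proof (rule antihole6I[of x b a y a' b'])
            show "distinct [x, b, a, y, a', b']"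
              using \<open>a \<in> P\<close> \<open>b' \<in> Q\<close> a'(1) b P \<open>a \<noteq> x\<close> \<open>a' \<noteq> x\<close> \<open>a' \<noteq> a\<close> \<open>b' \<noteq> y\<close> \<open>b \<noteq> b'\<close> by auto
            show "{x, b, a, y, a', b'} \<subseteq> V" using bV ab V by auto
            show "antiadj \<theta> x b" "antiadj \<theta> a y" using sa ya by (auto simp: antiadj_iff)
            show "antiadj \<theta> b a" using ab(7) symm(5)[OF ab(1) bV(1)] by simp
            show "antiadj \<theta> y a'" using ya(2) symm(2)[OF V bV(3)] by (simp add: antiadj_iff)
            show "antiadj \<theta> a' b'" "antiadj \<theta> x b'" using a' ab by auto
            show "adj \<theta> x a" "adj \<theta> x y" "adj \<theta> a b'" using ab xy by auto
            show "adj \<theta> x a'" "adj \<theta> a a'" using P'[OF P(3) a'(1)] P'[OF \<open>a \<in> P\<close> a'(1)] \<open>a' \<noteq> x\<close> \<open>a' \<noteq> a\<close> by (auto simp: adj_iff)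
            show "adj \<theta> b y" "adj \<theta> b b'" "adj \<theta> y b'" using Q' b P(4) \<open>b' \<in> Q\<close> \<open>b' \<noteq> y\<close> \<open>b \<noteq> b'\<close> by (auto simp: adj_iff)
            show "adj \<theta> b a'" using \<open>adj \<theta> a' b\<close> symm(4)[OF V bV(1)] by simp
          qed
          with no_hole show False ..
        qed
        thus ?thesis by blast
      qed
      have "complete_tg V \<theta> \<or> (\<exists>u v. even_pair V \<theta> u v)"
      proof (cases "Q = {y} \<and> P = {x}")
        case True
        hence "V = {x, y}" using P(1) by auto
        thus ?thesis using xyV unfolding complete_tg_def clique_def by auto
      next
        case False
        have semi': "{u, v} = {y, x}" if "u \<in> V" "v \<in> V" "semiadj \<theta> u v" for u v
          using small(7)[OF that] by (simp add: insert_commute)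
        have "Q \<union> P = V" "Q \<inter> P = {}" using P by auto
        show ?thesis
        proof (cases "Q = {y}")
          case True
          with False have "P \<noteq> {x}" by simp
          from half[OF \<open>Q \<union> P = V\<close> \<open>Q \<inter> P = {}\<close> P(4,3) this Q' P' xQ yP xyV(2) semi'] show ?thesis by simp
        next
          case False
          from half[OF P False P' Q' yP xQ xyV(1) small(7)] show ?thesis by simp
        qed
      qed
      with nf show ?thesis unfolding has_even_pairs_def by blast
    qed
    have BA: "B \<union> A = V" "B \<inter> A = {}" using AB(1,2) by auto
    have "x \<in> A \<and> y \<in> B \<or> x \<in> B \<and> y \<in> A"
      using opp[OF small(4,1,2)] small(1,2) AB(1,2) by blast
    thus ?thesis
    proof
      assume "x \<in> A \<and> y \<in> B"
      with main[OF AB(1,2) _ _ A B] show ?thesis by simp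
    next
      assume "x \<in> B \<and> y \<in> A"
      with main[OF BA _ _ B A] show ?thesis by simp
    qed
  qed
qed

text \<open>Ends refer to the bipartite graph behind the complement, so sharing an end means
  antiadjacency. In the small case every further vertex is adjacent to exactly one of
  \<open>x\<close>, \<open>y\<close> and shares the far end of the other one.\<close>

theorem coline_case:
  assumes F: "in_F V \<theta>" and line: "line_trigraph V (compl \<theta>)" and no_hole: "\<not> has_antihole V \<theta>"
  shows "has_even_pairs"
proof -
  from line obtain f :: "'a \<Rightarrow> nat \<times> nat" where f: "inj_on f V"
    "\<forall>u\<in>V. \<forall>v\<in>V. u \<noteq> v \<longrightarrow> adj (compl \<theta>) u v = (fst (f u) = fst (f v) \<or> snd (f u) = snd (f v))"
    "\<forall>X\<subseteq>V. clique (compl \<theta>) X \<and> 3 \<le> card X \<longrightarrow> strong_clique (compl \<theta>) X"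
    unfolding line_trigraph_def by blast
  interpret L: bipartite_line_trigraph V "compl \<theta>" f
    by unfold_locales (use f trigraph_compl in simp_all)
  note anti = L.adj_end[unfolded adj_compl]
  note triangle = L.strong_triangle[unfolded adj_compl sadj_compl]
  \<comment> \<open>Three pairwise meeting edges of a bipartite graph have a common end.\<close>
  have pair: "\<exists>s. L.end_of s w = L.end_of s u \<and> L.end_of s u = L.end_of s v"
    if "u \<in> V" "v \<in> V" "w \<in> V" "u \<noteq> v" "w \<noteq> u" "w \<noteq> v" "antiadj \<theta> u v" "antiadj \<theta> w u" "antiadj \<theta> w v" for u v w
  proof -
    from that obtain s where s: "L.end_of s u = L.end_of s v" using anti[of u v] by blast
    from that obtain t t' where t: "L.end_of t w = L.end_of t u" "L.end_of t' w = L.end_of t' v"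
      using anti[of w u] anti[of w v] by blast
    show ?thesis
    proof (cases "t = s \<or> t' = s")
      case True
      thus ?thesis
      proof
        assume "t = s"
        thus ?thesis using s t by (intro exI[of _ s]) simp
      next
        assume "t' = s"
        thus ?thesis using s t by (intro exI[of _ s]) simp
      qed
    next
      case False
      hence "t = (\<not> s)" "t' = (\<not> s)" by (cases s; simp)+
      hence "L.end_of (\<not> s) u = L.end_of (\<not> s) v" using t by simp
      with L.end_inj[OF that(1,2) s] that(4) show ?thesis by simp
    qed
  qed
  \<comment> \<open>The antiadjacent triples at positions 0, 3, 5 and 1, 3, 5 overlap in two
    vertices, so all four share one end. Then \<open>p ! 0\<close> and \<open>p ! 1\<close> belong
    to a triangle of the complement and are strongly antiadjacent.\<close>
  have short: "length p \<le> 5" if p: "is_path V \<theta> p" for p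
  proof (rule ccontr)
    assume "\<not> length p \<le> 5"
    hence l: "0 < length p" "1 < length p" "3 < length p" "5 < length p" by auto
    have V: "p ! 0 \<in> V" "p ! 1 \<in> V" "p ! 3 \<in> V" "p ! 5 \<in> V" using path_mem[OF p] l by auto
    have ne: "p ! 0 \<noteq> p ! 1" "p ! 0 \<noteq> p ! 3" "p ! 0 \<noteq> p ! 5" "p ! 1 \<noteq> p ! 3" "p ! 1 \<noteq> p ! 5" "p ! 3 \<noteq> p ! 5"
      using path_eq[OF p] l by auto
    have an: "antiadj \<theta> (p ! 0) (p ! 3)" "antiadj \<theta> (p ! 0) (p ! 5)" "antiadj \<theta> (p ! 1) (p ! 3)"
       "antiadj \<theta> (p ! 1) (p ! 5)" "antiadj \<theta> (p ! 3) (p ! 5)" using path_antiadj[OF p] l by auto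
    obtain s where s: "L.end_of s (p ! 0) = L.end_of s (p ! 3)" "L.end_of s (p ! 3) = L.end_of s (p ! 5)"
      using pair[OF V(3,4,1)] ne an by auto
    obtain t where t: "L.end_of t (p ! 1) = L.end_of t (p ! 3)" "L.end_of t (p ! 3) = L.end_of t (p ! 5)"
      using pair[OF V(3,4,2)] ne an by auto
    have "t = s"
    proof (rule ccontr)
      assume "t \<noteq> s"
      hence "t = (\<not> s)" by (cases s) simp_all
      with L.end_inj[OF V(3,4) s(2)] t(2) ne(6) show False by simp
    qed
    hence "L.end_of s (p ! 0) = L.end_of s (p ! 1)" using s t by simp
    hence a01: "antiadj \<theta> (p ! 0) (p ! 1)" using anti[OF V(1,2) ne(1)] by blast
    have "santi \<theta> (p ! 0) (p ! 1)" using triangle(1)[OF V(1,2,3) ne(1,4,2) a01 an(3,1)] .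
    moreover have "adj \<theta> (p ! 0) (p ! 1)" using path_adj[OF p, of 0] l by simp
    ultimately show False by (auto simp: adj_iff dest: exclusive)
  qed
  from F show ?thesis
  proof (cases rule: in_F_cases)
    case none
    thus ?thesis using has_even_pairs_if_short_paths[OF _ _ no_hole short] by blast
  next
    case (light v x y)
    have "antiadj \<theta> v x" "antiadj \<theta> x y" "antiadj \<theta> v y" using light(7,8,11) by (auto simp: antiadj_iff)
    from triangle(1)[OF light(1,2,3,4,6,5) this] light(7) show ?thesis by (auto dest: exclusive)
  next
    case (small x y)
    have semi_sym: "semiadj \<theta> y x" using small(1,2,4) symm(3)[of x y] by simp
    have semi': "{u, v} = {y, x}" if "u \<in> V" "v \<in> V" "semiadj \<theta> u v" for u v
      using small(7)[OF that] by (simp add: insert_commute)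
    \<comment> \<open>Both \<open>u\<close> and \<open>w\<close> use the far end of
      \<open>x\<close>. The inner vertices of a path of length 3 between them would both use the far
      end of \<open>y\<close>, so they would be antiadjacent as well as adjacent; but the only
      switchable pair contains \<open>x\<close>, and neither of them is \<open>x\<close>.\<close>
    have half: "\<exists>u v. even_pair V \<theta> u v \<and> u \<notin> {x, y} \<and> v \<notin> {x, y}"
      if xy: "x \<in> V" "y \<in> V" "x \<noteq> y" "semiadj \<theta> x y" "nbhd V \<theta> x \<inter> nbhd V \<theta> y = {}"
        and semi: "\<And>u v. u \<in> V \<Longrightarrow> v \<in> V \<Longrightarrow> semiadj \<theta> u v \<Longrightarrow> {u, v} = {x, y}"
        and nc: "u \<in> V - ({x, y} \<union> nbhd V \<theta> x)" "w \<in> V - ({x, y} \<union> nbhd V \<theta> x)" "u \<noteq> w" for x y u w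
    proof -
      have strong: "santi \<theta> a b" if "antiadj \<theta> a b" "a \<in> V" "b \<in> V" "a \<notin> {x, y}" for a b
        using that semi[of a b] by (auto simp: antiadj_iff doubleton_eq_iff)
      have uV: "u \<in> V" "w \<in> V" "u \<notin> {x, y}" "w \<notin> {x, y}" using nc by auto
      have ux: "santi \<theta> u x" "santi \<theta> w x" using nc xy(1) not_adj by (auto simp: nbhd_def)
      have axy: "antiadj \<theta> x y" using xy(4) by (simp add: antiadj_iff)
      have not_both: False if a: "a \<in> V" "a \<noteq> x" "a \<noteq> y" "antiadj \<theta> a x" "antiadj \<theta> a y" for a
      proof -
        have "santi \<theta> x y" using triangle(1)[OF xy(1,2) a(1) xy(3)] a axy symm(5)[of a] xy by metis
        with xy(4) show False by (auto dest: exclusive)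
      qed
      obtain s where s: "L.end_of s x = L.end_of s y" using anti[OF xy(1-3)] axy by blast
      have notm: "L.end_of s a \<noteq> L.end_of s x" if "a \<in> V" "a \<noteq> x" "a \<noteq> y" for a
        using not_both[OF that] anti[OF that(1) xy(1) that(2)] anti[OF that(1) xy(2) that(3)] s by metis
      have atx: "L.end_of (\<not> s) a = L.end_of (\<not> s) x" if a: "a \<in> V" "a \<notin> {x, y}" "antiadj \<theta> a x" for a
      proof -
        obtain t where t: "L.end_of t a = L.end_of t x" using anti[of a x] a xy by auto
        have "t \<noteq> s"
        proof
          assume "t = s"
          with notm[of a] a t show False by simp
        qed
        hence "t = (\<not> s)" by (cases s) simp_all
        thus ?thesis using t by simp
      qed
      have aty: "L.end_of (\<not> s) a = L.end_of (\<not> s) y" if a: "a \<in> V" "a \<noteq> x" "\<not> antiadj \<theta> a x" for a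
      proof (cases "a = y")
        case False
        have "adj \<theta> a x" using not_antiadj[of a x] a xy by (auto simp: adj_iff)
        hence "\<not> adj \<theta> a y" using xy(5) a by (auto simp: nbhd_def)
        hence "antiadj \<theta> a y" using not_adj[of a y] a xy False by (auto simp: antiadj_iff)
        then obtain t where t: "L.end_of t a = L.end_of t y" using anti[of a y] a xy False by auto
        have "t \<noteq> s"
        proof
          assume "t = s"
          with notm[of a] a t s False show False by simp
        qed
        hence "t = (\<not> s)" by (cases s) simp_all
        thus ?thesis using t by simp
      qed simp
      have "L.end_of (\<not> s) u = L.end_of (\<not> s) w" using atx[of u] atx[of w] uV ux by (auto simp: antiadj_iff)
      hence "antiadj \<theta> u w" using anti[OF uV(1,2) nc(3)] by blast
      hence uw: "santi \<theta> u w" using strong uV by blast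
      have "even_pair V \<theta> u w"
      proof (rule even_pair_short[OF uV(1,2) uw short])
        fix a b assume ab: "a \<in> V" "b \<in> V" "adj \<theta> u a" "adj \<theta> a b" "adj \<theta> b w" "antiadj \<theta> u b" "antiadj \<theta> a w"
        have ax: "a \<noteq> x" "b \<noteq> x"
          using ux ab symm(4)[of b w] uV by (auto simp: adj_iff dest: exclusive)
        have away: "L.end_of (\<not> s) a = L.end_of (\<not> s) y"
          if a: "a \<in> V" "a \<noteq> x" "adj \<theta> a z" "z \<in> V" "z \<notin> {x, y}" "antiadj \<theta> z x" for a z
        proof (cases "a = y")
          case False
          have "\<not> antiadj \<theta> a x"
          proof
            assume "antiadj \<theta> a x"
            hence "L.end_of (\<not> s) a = L.end_of (\<not> s) z" using atx[of a] atx[of z] a False by auto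
            moreover have "a \<noteq> z" using a by auto
            ultimately have "antiadj \<theta> a z" using anti[of a z] a by blast
            with strong[of a z] a False show False by (auto simp: adj_iff dest: exclusive)
          qed
          with aty a show ?thesis by blast
        qed simp
        have "adj \<theta> a u" using ab(3) symm(4)[OF uV(1) ab(1)] by simp
        hence "L.end_of (\<not> s) a = L.end_of (\<not> s) y"
          by (rule away[OF ab(1) ax(1) _ uV(1,3)]) (use ux in \<open>simp add: antiadj_iff\<close>)
        moreover have "L.end_of (\<not> s) b = L.end_of (\<not> s) y"
          by (rule away[OF ab(2) ax(2) ab(5) uV(2,4)]) (use ux in \<open>simp add: antiadj_iff\<close>)
        ultimately have "L.end_of (\<not> s) a = L.end_of (\<not> s) b" by simp
        moreover have "a \<noteq> b" using ab(4) by auto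
        ultimately have "antiadj \<theta> a b" using anti[OF ab(1,2)] by blast
        with ab(4) have "semiadj \<theta> a b" by (auto simp: adj_iff antiadj_iff dest: exclusive)
        from semi[OF ab(1,2) this] ax show False by (auto simp: doubleton_eq_iff)
      qed
      thus ?thesis using uV by blast
    qed
    \<comment> \<open>Apart from \<open>e\<close>, every vertex off the pair is a neighbour of
      \<open>x\<close>, hence a non-neighbour of \<open>y\<close>, and there is at most one of
      those.\<close>
    have single: "even_pair V \<theta> x e"
      if xy: "x \<in> V" "y \<in> V" "x \<noteq> y" "nbhd V \<theta> x \<inter> nbhd V \<theta> y = {}"
        and e: "e \<in> V - ({x, y} \<union> nbhd V \<theta> x)"
        and one: "\<And>u w. u \<in> V - ({x, y} \<union> nbhd V \<theta> x) \<Longrightarrow> w \<in> V - ({x, y} \<union> nbhd V \<theta> x) \<Longrightarrow> u = w"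
          "\<And>u w. u \<in> V - ({x, y} \<union> nbhd V \<theta> y) \<Longrightarrow> w \<in> V - ({x, y} \<union> nbhd V \<theta> y) \<Longrightarrow> u = w"
      for x y e
    proof -
      have eV: "e \<in> V" "e \<noteq> x" using e by auto
      have ex: "santi \<theta> e x" using e xy(1) not_adj by (auto simp: nbhd_def)
      hence xe: "santi \<theta> x e" using symm(2)[OF xy(1) eV(1)] by simp
      show ?thesis
      proof (rule even_pair_short[OF xy(1) eV(1) xe short])
        fix a b assume ab: "a \<in> V" "b \<in> V" "adj \<theta> x a" "adj \<theta> a b" "adj \<theta> b e" "antiadj \<theta> x b" "antiadj \<theta> a e"
        have ne: "a \<noteq> x" "a \<noteq> e" "b \<noteq> x" "b \<noteq> e" "a \<noteq> b" using ab xe by (auto simp: adj_iff antiadj_iff dest: exclusive)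
        have My: "c \<in> V - ({x, y} \<union> nbhd V \<theta> y)" if "c \<in> V" "c \<noteq> x" "c \<noteq> e" "c \<noteq> y" for c
          using one(1)[of c e] e that xy(4) by (auto simp: nbhd_def)
        consider "a = y" "b \<noteq> y" | "b = y" "a \<noteq> y" | "a \<noteq> y" "b \<noteq> y" using ne by blast
        thus False
        proof cases
          case 1
          with My[of b] ab ne symm(4)[of a b] show False by (auto simp: nbhd_def)
        next
          case 2
          with My[of a] ab ne show False by (auto simp: nbhd_def)
        next
          case 3
          with one(2)[OF My My, of a b] ab ne show False by blast
        qed
      qed
    qed
    have nb: "nbhd V \<theta> y \<inter> nbhd V \<theta> x = {}" using small(6) by blast
    have two: "\<exists>u v. even_pair V \<theta> u v \<and> u \<notin> {x, y} \<and> v \<notin> {x, y}"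
      if "u \<in> V - ({x, y} \<union> nbhd V \<theta> x) \<and> w \<in> V - ({x, y} \<union> nbhd V \<theta> x) \<or>
          u \<in> V - ({x, y} \<union> nbhd V \<theta> y) \<and> w \<in> V - ({x, y} \<union> nbhd V \<theta> y)" "u \<noteq> w" for u w
      using that(1)
    proof
      assume "u \<in> V - ({x, y} \<union> nbhd V \<theta> x) \<and> w \<in> V - ({x, y} \<union> nbhd V \<theta> x)"
      with half[OF small(1,2,3,4,6,7) _ _ that(2)] show ?thesis by blast
    next
      assume "u \<in> V - ({x, y} \<union> nbhd V \<theta> y) \<and> w \<in> V - ({x, y} \<union> nbhd V \<theta> y)"
      hence "\<exists>u v. even_pair V \<theta> u v \<and> u \<notin> {y, x} \<and> v \<notin> {y, x}"
        using half[OF small(2,1) _ semi_sym nb semi' _ _ that(2)] small(3) by (simp add: insert_commute)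
      thus ?thesis by (simp add: insert_commute)
    qed
    have "favorable V \<theta> \<longrightarrow> (\<exists>u v. even_pair V \<theta> u v \<and> u \<notin> swD V \<theta> \<and> v \<notin> swD V \<theta>)"
    proof
      assume "favorable V \<theta>"
      hence "\<not> clique \<theta> (V - ({x, y} \<union> nbhd V \<theta> x)) \<or> \<not> clique \<theta> (V - ({x, y} \<union> nbhd V \<theta> y))"
        using small(3,5) unfolding favorable_def by metis
      then obtain u w where "u \<noteq> w" "u \<in> V - ({x, y} \<union> nbhd V \<theta> x) \<and> w \<in> V - ({x, y} \<union> nbhd V \<theta> x) \<or>
          u \<in> V - ({x, y} \<union> nbhd V \<theta> y) \<and> w \<in> V - ({x, y} \<union> nbhd V \<theta> y)"
        unfolding clique_def by blast
      from two[OF this(2,1)] show "\<exists>u v. even_pair V \<theta> u v \<and> u \<notin> swD V \<theta> \<and> v \<notin> swD V \<theta>"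
        unfolding small(5) .
    qed
    moreover have "complete_tg V \<theta> \<or> (\<exists>u v. even_pair V \<theta> u v)"
    proof (rule ccontr)
      assume no: "\<not> ?thesis"
      have one: "u = w" if "u \<in> V - ({x, y} \<union> nbhd V \<theta> x)" "w \<in> V - ({x, y} \<union> nbhd V \<theta> x)" for u w
        using two[of u w] that no by blast
      have one': "u = w" if "u \<in> V - ({x, y} \<union> nbhd V \<theta> y)" "w \<in> V - ({x, y} \<union> nbhd V \<theta> y)" for u w
        using two[of u w] that no by blast
      have "V - ({x, y} \<union> nbhd V \<theta> x) = {}"
        using single[OF small(1,2,3,6) _ one one'] no by blast
      moreover have "V - ({x, y} \<union> nbhd V \<theta> y) = {}"
        using single[OF small(2,1) _ nb, unfolded insert_commute[of y x], OF _ _ one' one] small(3) no by blast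
      ultimately have "V = {x, y}" using small(1,2,6) by blast
      hence "complete_tg V \<theta>" using small(4) semi_sym by (auto simp: complete_tg_def clique_def adj_iff)
      with no show False by simp
    qed
    ultimately show ?thesis unfolding has_even_pairs_def by simp
  qed
qed

end

section \<open>Doubled graphs\<close>

lemma comp_of_subset: "v \<in> X \<Longrightarrow> comp_of R X v \<subseteq> X"
proof
  fix u assume "v \<in> X" "u \<in> comp_of R X v"
  hence "(v, u) \<in> {(a, b). a \<in> X \<and> b \<in> X \<and> R a b}\<^sup>*" by (simp add: comp_of_def)
  thus "u \<in> X" using \<open>v \<in> X\<close> by (induction rule: rtrancl_induct) auto
qed

lemma comp_of_neighbour: "u \<in> X \<Longrightarrow> v \<in> X \<Longrightarrow> R u v \<Longrightarrow> v \<in> comp_of R X u"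
  by (auto simp: comp_of_def)

lemma comp_of_self: "u \<in> comp_of R X u"
  by (simp add: comp_of_def)

lemma small_component:
  assumes "finite X" "\<forall>C\<in>comp_of R X ` X. card C \<le> 2" "u \<in> X" "a \<in> X" "b \<in> X" "R u a" "R u b" "u \<noteq> a" "u \<noteq> b"
  shows "a = b" "comp_of R X u = {u, a}"
proof -
  have fin: "finite (comp_of R X u)" using comp_of_subset[OF assms(3)] assms(1) finite_subset by blast
  have sub: "{u, a, b} \<subseteq> comp_of R X u" using comp_of_neighbour assms comp_of_self by fastforce
  have card: "card (comp_of R X u) \<le> 2" using assms(2,3) by blast
  have "card {u, a, b} \<le> 2" using card_mono[OF fin sub] card by linarith
  thus "a = b" using assms(8,9) by (cases "a = b") auto
  show "comp_of R X u = {u, a}"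
    by (rule sym, rule card_seteq[OF fin]) (use sub card assms(8) in auto)
qed

lemma card_Collect_pair_le_1:
  assumes "card {z \<in> {a, b}. P z} \<le> 1" "a \<noteq> b"
  shows "\<not> (P a \<and> P b)"
proof
  assume "P a \<and> P b"
  hence "{z \<in> {a, b}. P z} = {a, b}" by auto
  with assms show False by simp
qed

locale doubled_trigraph = finite_trigraph +
  fixes X Y :: "'a set"
  assumes good_partition: "good_partition V \<theta> X Y"
begin

lemma partition: "X \<union> Y = V" "X \<inter> Y = {}"
  using good_partition by (auto simp: good_partition_def)

lemma in_V: "x \<in> X \<Longrightarrow> x \<in> V" "y \<in> Y \<Longrightarrow> y \<in> V"
  using partition by auto

lemma finite_parts: "finite X" "finite Y"
  using partition finite_V by (metis finite_Un)+

lemma cross: "x \<in> X \<Longrightarrow> y \<in> Y \<Longrightarrow> sadj \<theta> x y \<or> santi \<theta> x y"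
  using good_partition trichotomy[of x y] in_V partition unfolding good_partition_def by blast

lemma cross': "x \<in> X \<Longrightarrow> y \<in> Y \<Longrightarrow> sadj \<theta> y x \<or> santi \<theta> y x"
  using cross[of x y] symm[of x y] in_V by simp

lemma X_adj_unique:
  assumes "u \<in> X" "a \<in> X" "b \<in> X" "adj \<theta> u a" "adj \<theta> u b"
  shows "a = b"
  by (rule small_component(1)[where R = "adj \<theta>", OF finite_parts(1) _ assms])
    (use good_partition assms in \<open>auto simp: good_partition_def components_def\<close>)

lemma Y_antiadj_unique:
  assumes "u \<in> Y" "a \<in> Y" "b \<in> Y" "antiadj \<theta> u a" "antiadj \<theta> u b"
  shows "a = b"
  by (rule small_component(1)[where R = "antiadj \<theta>", OF finite_parts(2) _ assms])
    (use good_partition assms in \<open>auto simp: good_partition_def anticomponents_def\<close>)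

text \<open>The component \<open>{u, v}\<close> holds at most one strong neighbour and at most one
  strong antineighbour of \<open>y\<close>, and no pair across the partition is switchable; so it
  holds exactly one of each.\<close>

lemma edge_split:
  assumes "u \<in> X" "v \<in> X" "adj \<theta> u v" "y \<in> Y"
  shows "sadj \<theta> y u \<longleftrightarrow> santi \<theta> y v"
proof -
  have ne: "u \<noteq> v" using assms(3) by auto
  have "comp_of (adj \<theta>) X u = {u, v}"
    by (rule small_component(2)[where R = "adj \<theta>", OF finite_parts(1) _ assms(1,2,2,3,3) ne ne])
      (use good_partition in \<open>simp add: good_partition_def components_def\<close>)
  hence "{u, v} \<in> components \<theta> X" using assms(1) by (auto simp: components_def)
  moreover have "comp_of (antiadj \<theta>) Y y \<in> anticomponents \<theta> Y" using assms(4) by (simp add: anticomponents_def)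
  ultimately have "\<forall>t\<in>comp_of (antiadj \<theta>) Y y. card {z \<in> {u, v}. sadj \<theta> t z} \<le> 1 \<and> card {z \<in> {u, v}. santi \<theta> t z} \<le> 1"
    using good_partition unfolding good_partition_def by blast
  hence "card {z \<in> {u, v}. sadj \<theta> y z} \<le> 1" "card {z \<in> {u, v}. santi \<theta> y z} \<le> 1"
    using comp_of_self[of y] by auto
  from this[THEN card_Collect_pair_le_1, OF ne] show ?thesis
    using cross'[OF assms(1,4)] cross'[OF assms(2,4)] by (auto dest: exclusive)
qed

lemma antiedge_split:
  assumes "z \<in> Y" "w \<in> Y" "antiadj \<theta> z w" "x \<in> X"
  shows "sadj \<theta> x z \<longleftrightarrow> santi \<theta> x w"
proof -
  have ne: "z \<noteq> w" using assms(3) by auto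
  have "comp_of (antiadj \<theta>) Y z = {z, w}"
    by (rule small_component(2)[where R = "antiadj \<theta>", OF finite_parts(2) _ assms(1,2,2,3,3) ne ne])
      (use good_partition in \<open>simp add: good_partition_def anticomponents_def\<close>)
  hence "{z, w} \<in> anticomponents \<theta> Y" using assms(1) by (auto simp: anticomponents_def)
  moreover have "comp_of (adj \<theta>) X x \<in> components \<theta> X" using assms(4) by (simp add: components_def)
  ultimately have "\<forall>s\<in>comp_of (adj \<theta>) X x. card {t \<in> {z, w}. sadj \<theta> s t} \<le> 1 \<and> card {t \<in> {z, w}. santi \<theta> s t} \<le> 1"
    using good_partition unfolding good_partition_def by blast
  hence "card {t \<in> {z, w}. sadj \<theta> x t} \<le> 1" "card {t \<in> {z, w}. santi \<theta> x t} \<le> 1"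
    using comp_of_self[of x] by auto
  from this[THEN card_Collect_pair_le_1, OF ne] show ?thesis
    using cross[OF assms(4,1)] cross[OF assms(4,2)] by (auto dest: exclusive)
qed

lemma symXY:
  assumes "x \<in> X" "y \<in> Y"
  shows "sadj \<theta> y x \<longleftrightarrow> sadj \<theta> x y" "santi \<theta> y x \<longleftrightarrow> santi \<theta> x y" "adj \<theta> y x \<longleftrightarrow> sadj \<theta> x y" "adj \<theta> x y \<longleftrightarrow> sadj \<theta> x y"
  using symm[of x y] in_V assms cross[OF assms] by (auto simp: adj_iff dest: exclusive)

lemma Y_strong: "y \<in> Y \<Longrightarrow> t \<in> Y \<Longrightarrow> y \<noteq> t \<Longrightarrow> \<not> antiadj \<theta> y t \<Longrightarrow> sadj \<theta> y t"
  using not_antiadj in_V by blast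

text \<open>Each vertex of \<open>X\<close> is strongly adjacent to exactly one of \<open>z\<close>,
  \<open>w\<close> and joins the class of the other. By \<open>edge_split\<close> adjacent vertices
  of \<open>X\<close> never fall into the same class.\<close>

lemma bipartite_if_antiedge:
  assumes "z \<in> Y" "w \<in> Y" "antiadj \<theta> z w" "Y = {z, w}"
  shows "bipartite_tg V \<theta>"
proof -
  have wz: "antiadj \<theta> w z" using assms symm(5) in_V by blast
  have ne: "z \<noteq> w" using assms by auto
  have X_anti: "santi \<theta> u v" if "u \<in> X" "v \<in> X" "u \<noteq> v" "sadj \<theta> u y" "sadj \<theta> v y" "y \<in> Y" for u v y
  proof -
    have "\<not> adj \<theta> u v"
      using edge_split[of u v y] that symXY[of u y] symXY[of v y] by (auto dest: exclusive)
    thus ?thesis using not_adj that in_V by blast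
  qed
  have st: "strongly_stable \<theta> (insert z {x \<in> X. sadj \<theta> x w})"
    if "z \<in> Y" "w \<in> Y" "antiadj \<theta> z w" for z w
  proof -
    have "antiadj \<theta> w z" using that symm(5) in_V by blast
    hence "santi \<theta> x z" if "x \<in> X" "sadj \<theta> x w" for x
      using antiedge_split[of w z x] \<open>z \<in> Y\<close> \<open>w \<in> Y\<close> that by blast
    thus ?thesis using X_anti[of _ _ w] \<open>w \<in> Y\<close> symXY(2)[OF _ \<open>z \<in> Y\<close>] unfolding strongly_stable_def by auto
  qed
  have "insert z {x \<in> X. sadj \<theta> x w} \<union> insert w {x \<in> X. sadj \<theta> x z} = V"
    using partition(1) assms antiedge_split[OF assms(1-3)] cross by blast
  moreover have "insert z {x \<in> X. sadj \<theta> x w} \<inter> insert w {x \<in> X. sadj \<theta> x z} = {}"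
    using partition(2) assms antiedge_split[OF assms(1-3)] ne by (auto dest: exclusive)
  ultimately show ?thesis unfolding bipartite_tg_def using st[OF assms(1-3)] st[OF assms(2,1) wz] by blast
qed

lemma even_pair_if_Y_empty:
  assumes "Y = {}" "u \<in> V" "v \<in> V" "santi \<theta> u v"
  shows "even_pair V \<theta> u v"
proof (rule even_pairI[OF assms(2-4)])
  fix p n assume p: "is_path V \<theta> p" "length p = Suc n" "3 \<le> n"
  have X: "p ! 0 \<in> X" "p ! 1 \<in> X" "p ! 2 \<in> X" using path_mem[OF p(1)] p partition(1) assms(1) by auto
  have "adj \<theta> (p ! 0) (p ! 1)" "adj \<theta> (p ! 1) (p ! 2)"
    using path_adj[OF p(1), of 0] path_adj[OF p(1), of 1] p by (auto simp: numeral_2_eq_2)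
  moreover from this have "adj \<theta> (p ! 1) (p ! 0)" using symm(4) X in_V by blast
  ultimately have "p ! 0 = p ! 2" using X_adj_unique X by blast
  thus False using path_eq[OF p(1), of 0 2] p by simp
qed

text \<open>Name the ends of two antiedges so that \<open>u\<close> is strongly adjacent to
  \<open>z\<close> and \<open>z'\<close>. Then \<open>v\<close> is strongly adjacent to
  \<open>w\<close> and \<open>w'\<close>, and \<open>u w z v z' w'\<close> is an antihole.\<close>

lemma antiedge_unique:
  assumes no_hole: "\<not> has_antihole V \<theta>" and u: "u \<in> X" "v \<in> X" "adj \<theta> u v"
    and z: "z \<in> Y" "w \<in> Y" "antiadj \<theta> z w" and z': "z' \<in> Y" "w' \<in> Y" "antiadj \<theta> z' w'"
  shows "{z, w} = {z', w'}"
proof (rule ccontr)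
  assume neq: "{z, w} \<noteq> {z', w'}"
  have main: False
    if z: "z \<in> Y" "w \<in> Y" "antiadj \<theta> z w" "sadj \<theta> u z" and z': "z' \<in> Y" "w' \<in> Y" "antiadj \<theta> z' w'" "sadj \<theta> u z'"
      and neq: "{z, w} \<noteq> {z', w'}" for z w z' w'
  proof -
    have wz: "antiadj \<theta> w z" "antiadj \<theta> w' z'" using z z' symm(5) in_V by blast+
    have ne: "z \<noteq> z'" "z \<noteq> w'" "w \<noteq> z'" "w \<noteq> w'" "z \<noteq> w" "z' \<noteq> w'"
      using Y_antiadj_unique[OF z(1)] Y_antiadj_unique[OF z(2)] z z' wz neq by (auto simp: insert_commute)
    have y: "sadj \<theta> z z'" "sadj \<theta> z w'" "sadj \<theta> w z'" "sadj \<theta> w w'"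
      using Y_strong Y_antiadj_unique[OF z(1,2)] Y_antiadj_unique[OF z(2,1)] z z' wz ne by blast+
    have uw: "santi \<theta> u w" "santi \<theta> u w'" using antiedge_split u(1) z z' by blast+
    have v: "santi \<theta> z v" "santi \<theta> z' v" using edge_split[OF u] symXY(1)[OF u(1)] z z' by blast+
    have vw: "sadj \<theta> v w" "sadj \<theta> v w'"
      using antiedge_split[of w z v] antiedge_split[of w' z' v] wz z z' u(2) v symXY(2)[OF u(2)] by blast+
    have "has_antihole V \<theta>"
    proof (rule antihole6I[of u w z v z' w'])
      show "distinct [u, w, z, v, z', w']" using ne u z z' partition(2) by auto
      show "{u, w, z, v, z', w'} \<subseteq> V" using u z z' in_V by auto
      show "antiadj \<theta> u w" "antiadj \<theta> u w'" "antiadj \<theta> w z" "antiadj \<theta> z' w'" "antiadj \<theta> z v" using uw wz z' v by (auto simp: antiadj_iff)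
      show "antiadj \<theta> v z'" using v symXY(2)[OF u(2) z'(1)] by (auto simp: antiadj_iff)
      show "adj \<theta> u z" "adj \<theta> u v" "adj \<theta> u z'" "adj \<theta> w z'" "adj \<theta> w w'" "adj \<theta> z z'" "adj \<theta> z w'" "adj \<theta> v w'"
        using u z z' y vw by (auto simp: adj_iff)
      show "adj \<theta> w v" using vw symXY(1)[OF u(2) z(2)] by (auto simp: adj_iff)
    qed
    with no_hole show False ..
  qed
  have wz: "antiadj \<theta> w z" "antiadj \<theta> w' z'" using z z' symm(5) in_V by blast+
  have "sadj \<theta> u z \<or> sadj \<theta> u w" "sadj \<theta> u z' \<or> sadj \<theta> u w'"
    using antiedge_split[OF z u(1)] antiedge_split[OF z' u(1)] cross[OF u(1)] z z' by blast+
  thus False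
    using main[OF z _ z' _ neq] main[OF z(2,1) wz(1) _ z'] main[OF z _ z'(2,1) wz(2)] main[OF z(2,1) wz(1) _ z'(2,1) wz(2)] neq
    by (auto simp: insert_commute)
qed

section \<open>Even pairs of doubled graphs\<close>

lemma even_pair_edge:
  assumes y: "y \<in> Y" "\<And>t. t \<in> Y \<Longrightarrow> \<not> antiadj \<theta> y t" and u: "u \<in> X" "v \<in> X" "adj \<theta> u v" "santi \<theta> y u"
  shows "even_pair V \<theta> y u"
proof (rule even_pair_dominated)
  fix t assume t: "t \<in> V" "adj \<theta> t u" "t \<noteq> y"
  show "sadj \<theta> y t"
  proof (cases "t \<in> Y")
    case True
    thus ?thesis using Y_strong y t by blast
  next
    case False
    hence "t \<in> X" using t partition by auto
    moreover have "adj \<theta> u t" using t symm(4) in_V u by blast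
    \<comment> \<open>\<open>v\<close> is the only neighbour of \<open>u\<close> in
      \<open>X\<close>, and \<open>y\<close> is strongly adjacent to it because it is strongly
      antiadjacent to \<open>u\<close>.\<close>
    ultimately have "t = v" using X_adj_unique u by blast
    moreover have "adj \<theta> v u" using u symm(4) in_V by blast
    ultimately show ?thesis using edge_split[of v u y] u y by blast
  qed
qed (use y u in_V in auto)

lemma even_pair_isolated:
  assumes y: "y \<in> Y" "\<And>t. t \<in> Y \<Longrightarrow> \<not> antiadj \<theta> y t" and s: "s \<in> X" "\<And>t. t \<in> X \<Longrightarrow> \<not> adj \<theta> s t" "santi \<theta> y s"
  shows "even_pair V \<theta> y s"
proof (rule even_pair_dominated)
  fix t assume t: "t \<in> V" "adj \<theta> t s" "t \<noteq> y"
  have "adj \<theta> s t" using t symm(4) in_V s by blast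
  hence "t \<in> Y" using s t partition by blast
  thus "sadj \<theta> y t" using Y_strong y t by blast
qed (use y s in_V in auto)

lemma even_pair_full:
  assumes s: "s \<in> X" "\<And>y. y \<in> Y \<Longrightarrow> sadj \<theta> s y" and s': "s' \<in> X" "s \<noteq> s'" "\<And>t. t \<in> X \<Longrightarrow> \<not> adj \<theta> s' t"
  shows "even_pair V \<theta> s s'"
proof (rule even_pair_dominated)
  have "\<not> adj \<theta> s s'" using s'(3)[OF s(1)] symm(4) in_V s s' by blast
  thus "santi \<theta> s s'" using not_adj s s' in_V by blast
  fix t assume t: "t \<in> V" "adj \<theta> t s'" "t \<noteq> s"
  have "adj \<theta> s' t" using t symm(4) in_V s' by blast
  hence "t \<in> Y" using s' t partition by blast
  thus "sadj \<theta> s t" using s by blast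
qed (use s s' in_V in auto)

text \<open>The last inner vertex of an odd path is antiadjacent to \<open>z\<close>, hence in
  \<open>X\<close>. As \<open>X\<close> has no edges, the vertex before it is in \<open>Y\<close>
  and antiadjacent to \<open>w\<close>, so it is \<open>z\<close> itself, too early on the
  path.\<close>

lemma even_pair_antiedge:
  assumes X: "\<And>u v. u \<in> X \<Longrightarrow> v \<in> X \<Longrightarrow> \<not> adj \<theta> u v" and z: "z \<in> Y" "w \<in> Y" "santi \<theta> z w"
  shows "even_pair V \<theta> z w"
proof (rule even_pairI)
  have zw: "antiadj \<theta> z w" "antiadj \<theta> w z" using z symm(5) in_V by (auto simp: antiadj_iff)
  fix p n assume p: "is_path V \<theta> p" "length p = Suc n" "p ! 0 = z" "p ! n = w" "odd n" "3 \<le> n"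
  have s: "Suc (n - 1) = n" "Suc (n - 2) = n - 1" using p by auto
  have mem: "p ! i \<in> V" if "i \<le> n" for i using path_mem[OF p(1)] p(2) that by simp
  have a: "adj \<theta> (p ! (n - 1)) w" "adj \<theta> (p ! (n - 2)) (p ! (n - 1))"
    using path_adj[OF p(1), of "n - 1"] path_adj[OF p(1), of "n - 2"] s p by auto
  have an: "antiadj \<theta> z (p ! (n - 1))" "antiadj \<theta> (p ! (n - 2)) w"
    using path_antiadj[OF p(1), of 0 "n - 1"] path_antiadj[OF p(1), of "n - 2" n] p by auto
  show False
  proof (cases "p ! (n - 1) \<in> Y")
    case True
    hence "p ! (n - 1) = w" using Y_antiadj_unique z zw an by blast
    with a(1) show False by simp
  next
    case False
    hence "p ! (n - 1) \<in> X" using mem[of "n - 1"] partition by auto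
    hence Y: "p ! (n - 2) \<in> Y" using X a(2) mem[of "n - 2"] partition by auto
    hence "antiadj \<theta> w (p ! (n - 2))" using an(2) symm(5) in_V z by blast
    hence "p ! (n - 2) = z" using Y_antiadj_unique z zw Y by blast
    moreover have "n - 2 < length p" "n - 2 \<noteq> 0" using p by linarith+
    ultimately show False using path_eq[OF p(1), of "n - 2" 0] p by auto
  qed
qed (use z in_V in auto)

text \<open>Read an odd path backwards from \<open>s\<close>: the last inner vertex is
  \<open>w\<close>, the one before it, \<open>t2\<close>, is in \<open>X\<close> and strongly
  antiadjacent to \<open>z\<close>, so the path is longer than 3. Then \<open>t3\<close> is in
  \<open>X\<close> too, and by \<open>edge_split\<close> \<open>z\<close> is strongly adjacent to
  it, although the two are not consecutive.\<close>

lemma even_pair_across: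
  assumes z: "z \<in> Y" "w \<in> Y" "antiadj \<theta> z w" and s: "s \<in> X" "\<And>t. t \<in> X \<Longrightarrow> \<not> adj \<theta> s t" "santi \<theta> z s"
    and K: "\<And>t. t \<in> Y \<Longrightarrow> t \<noteq> z \<Longrightarrow> t \<noteq> w \<Longrightarrow> sadj \<theta> t s"
  shows "even_pair V \<theta> z s"
proof (rule even_pairI)
  have wz: "antiadj \<theta> w z" using z symm(5) in_V by blast
  fix p n assume p: "is_path V \<theta> p" "length p = Suc n" "p ! 0 = z" "p ! n = s" "odd n" "3 \<le> n"
  have ss: "Suc (n - 1) = n" "Suc (n - 2) = n - 1" "Suc (n - 3) = n - 2" using p by auto
  have mem: "p ! i \<in> V" if "i \<le> n" for i using path_mem[OF p(1)] p(2) that by simp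
  have eq: "p ! i = z \<longleftrightarrow> i = 0" if "i \<le> n" for i using path_eq[OF p(1), of i 0] p that by simp
  have a: "adj \<theta> (p ! (n - 1)) s" "adj \<theta> (p ! (n - 2)) (p ! (n - 1))" "adj \<theta> (p ! (n - 3)) (p ! (n - 2))"
    using path_adj[OF p(1), of "n - 1"] path_adj[OF p(1), of "n - 2"] path_adj[OF p(1), of "n - 3"] ss p by auto
  have an: "antiadj \<theta> z (p ! (n - 1))" "antiadj \<theta> (p ! (n - 2)) s" "antiadj \<theta> (p ! (n - 3)) (p ! (n - 1))"
    using path_antiadj[OF p(1), of 0 "n - 1"] path_antiadj[OF p(1), of "n - 2" n] path_antiadj[OF p(1), of "n - 3" "n - 1"] p by auto
  have "adj \<theta> s (p ! (n - 1))" using a(1) symm(4) mem[of "n - 1"] in_V s by auto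
  hence "p ! (n - 1) \<in> Y" using s(2) mem[of "n - 1"] partition by auto
  hence t1: "p ! (n - 1) = w" using Y_antiadj_unique z an(1) by blast
  define t2 where "t2 = p ! (n - 2)"
  define t3 where "t3 = p ! (n - 3)"
  have "t2 \<noteq> z" using eq[of "n - 2"] p by (auto simp: t2_def)
  have "t2 \<noteq> w" using a(2) t1 by (auto simp: t2_def)
  have "t2 \<notin> Y"
  proof
    assume "t2 \<in> Y"
    hence "sadj \<theta> t2 s" using K \<open>t2 \<noteq> z\<close> \<open>t2 \<noteq> w\<close> by blast
    with an(2) show False by (auto simp: t2_def antiadj_iff dest: exclusive)
  qed
  hence t2X: "t2 \<in> X" using mem[of "n - 2"] partition by (auto simp: t2_def)
  have "sadj \<theta> t2 w" using a(2) t1 symXY(4)[OF t2X z(2)] by (simp add: t2_def)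
  hence "santi \<theta> t2 z" using antiedge_split[OF z(2,1) wz t2X] by simp
  hence zt2: "santi \<theta> z t2" using symXY[OF t2X z(1)] by simp
  have "n \<noteq> 3" using a(3) zt2 p(3) by (auto simp: t2_def adj_iff dest: exclusive)
  hence n5: "5 \<le> n" using p by presburger
  have "t3 \<noteq> z" using eq[of "n - 3"] n5 by (auto simp: t3_def)
  have "t3 \<notin> Y"
  proof
    assume t3: "t3 \<in> Y"
    hence "antiadj \<theta> w t3" using an(3) t1 symm(5) in_V z by (metis t3_def)
    hence "t3 = z" using Y_antiadj_unique z wz t3 by blast
    with \<open>t3 \<noteq> z\<close> show False ..
  qed
  hence t3X: "t3 \<in> X" using mem[of "n - 3"] partition by (auto simp: t3_def)
  have "sadj \<theta> z t3" using edge_split[OF t3X t2X _ z(1)] a(3) zt2 by (simp add: t2_def t3_def)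
  moreover have "antiadj \<theta> z t3" using path_antiadj[OF p(1), of 0 "n - 3"] p n5 by (auto simp: t3_def)
  ultimately show False by (auto simp: antiadj_iff dest: exclusive)
qed (use z s in_V in auto)

text \<open>If every vertex of \<open>Y\<close> has an antineighbour in \<open>Y\<close>, uniqueness
  of the antiedge reduces \<open>Y\<close> to that antiedge.\<close>

lemma single_vertex_or_bipartite:
  assumes no_hole: "\<not> has_antihole V \<theta>" and u: "u \<in> X" "v \<in> X" "adj \<theta> u v" and Y: "Y \<noteq> {}"
  shows "bipartite_tg V \<theta> \<or> (\<exists>y\<in>Y. \<forall>t\<in>Y. \<not> antiadj \<theta> y t)"
proof (rule ccontr)
  assume "\<not> ?thesis"
  hence nb: "\<not> bipartite_tg V \<theta>" and partner: "\<And>y. y \<in> Y \<Longrightarrow> \<exists>t\<in>Y. antiadj \<theta> y t" by blast+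
  obtain z where z: "z \<in> Y" using Y by blast
  obtain w where w: "w \<in> Y" "antiadj \<theta> z w" using partner[OF z] by blast
  have "y \<in> {z, w}" if y: "y \<in> Y" for y
  proof -
    obtain t where "t \<in> Y" "antiadj \<theta> y t" using partner[OF y] by blast
    from antiedge_unique[OF no_hole u y this z w] show ?thesis by blast
  qed
  hence "Y = {z, w}" using z w by blast
  with bipartite_if_antiedge[OF z w] nb show False by blast
qed

lemma edge_and_single:
  assumes y: "y \<in> Y" "\<forall>t\<in>Y. \<not> antiadj \<theta> y t" and u: "u \<in> X" "v \<in> X" "adj \<theta> u v"
  shows "even_pair V \<theta> y u \<or> even_pair V \<theta> y v"
proof -
  have "adj \<theta> v u" using u symm(4) in_V by blast
  moreover have "santi \<theta> y u \<or> santi \<theta> y v" using edge_split[OF u y(1)] cross'[OF u(1) y(1)] by blast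
  ultimately show ?thesis using even_pair_edge[OF y(1)] y(2) u by blast
qed

lemma even_pair_or_bipartite:
  assumes no_hole: "\<not> has_antihole V \<theta>" and semi: "\<And>z w. z \<in> Y \<Longrightarrow> w \<in> Y \<Longrightarrow> semiadj \<theta> z w \<Longrightarrow> Y = {z, w}"
    and nc: "u \<in> V" "v \<in> V" "santi \<theta> u v"
  shows "bipartite_tg V \<theta> \<or> (\<exists>u v. even_pair V \<theta> u v)"
proof (cases "Y = {}")
  case True
  thus ?thesis using even_pair_if_Y_empty nc by blast
next
  case Y: False
  show ?thesis
  proof (cases "\<exists>u\<in>X. \<exists>v\<in>X. adj \<theta> u v")
    case True
    then obtain u v where uv: "u \<in> X" "v \<in> X" "adj \<theta> u v" by blast
    from single_vertex_or_bipartite[OF no_hole uv Y] show ?thesis using edge_and_single[OF _ _ uv] by blast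
  next
    case False
    hence X: "\<And>u v. u \<in> X \<Longrightarrow> v \<in> X \<Longrightarrow> \<not> adj \<theta> u v" by blast
    show ?thesis
    proof (cases "\<exists>z\<in>Y. \<exists>w\<in>Y. antiadj \<theta> z w")
      case True
      then obtain z w where zw: "z \<in> Y" "w \<in> Y" "antiadj \<theta> z w" by blast
      \<comment> \<open>A strong antiedge is an even pair; a switchable one is all of
        \<open>Y\<close> by \<open>semi\<close> and makes the trigraph bipartite.\<close>
      thus ?thesis using even_pair_antiedge[OF X] bipartite_if_antiedge[OF zw] semi[of z w] by (auto simp: antiadj_iff)
    next
      case single: False
      show ?thesis
      proof (cases "\<exists>x\<in>X. \<exists>y\<in>Y. santi \<theta> x y")
        case True
        then obtain x y where "x \<in> X" "y \<in> Y" "santi \<theta> x y" by blast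
        hence "even_pair V \<theta> y x" using even_pair_isolated[of y x] single X symXY(2) by blast
        thus ?thesis by blast
      next
        case False
        hence full: "\<And>x y. x \<in> X \<Longrightarrow> y \<in> Y \<Longrightarrow> sadj \<theta> x y" using cross by blast
        have "u \<notin> Y \<or> v \<notin> Y" using single nc by (auto simp: antiadj_iff)
        moreover have "\<not> (u \<in> X \<and> v \<in> Y)" "\<not> (u \<in> Y \<and> v \<in> X)"
          using full[of u v] full[of v u] nc symXY(2)[of v u] by (auto dest: exclusive)
        ultimately have uv: "u \<in> X" "v \<in> X" using nc partition by auto
        moreover have "u \<noteq> v" using nc by auto
        ultimately have "even_pair V \<theta> u v" using even_pair_full full X by blast
        thus ?thesis by blast
      qed
    qed
  qed
qed

text \<open>If there is no such pair, the remaining vertices of \<open>X\<close> are isolated in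
  \<open>X\<close>, and this forces the non-neighbours of \<open>x\<close> and of \<open>y\<close>
  off the pair to be cliques, against favorability.\<close>

lemma even_pair_disjoint:
  assumes no_hole: "\<not> has_antihole V \<theta>" and nb: "\<not> bipartite_tg V \<theta>"
    and fav: "favorable V \<theta>" and x: "x \<in> X" "y \<in> X" "semiadj \<theta> x y" "swD V \<theta> = {x, y}"
  shows "\<exists>u v. even_pair V \<theta> u v \<and> u \<notin> {x, y} \<and> v \<notin> {x, y}"
proof (cases "Y = {}")
  case True
  from fav obtain u v where "u \<in> V" "v \<in> V" "santi \<theta> u v" "u \<notin> {x, y}" "v \<notin> {x, y}"
    unfolding favorable_def x(4) by blast
  thus ?thesis using even_pair_if_Y_empty[OF True] by blast
next
  case Y: False
  have xy: "adj \<theta> x y" "adj \<theta> y x" "x \<noteq> y" using x symm(4)[of x y] in_V by (auto simp: adj_iff)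
  have YD: "t \<notin> {x, y}" if "t \<in> Y" for t using that x partition by auto
  obtain k where k: "k \<in> Y" "\<forall>t\<in>Y. \<not> antiadj \<theta> k t"
    using single_vertex_or_bipartite[OF no_hole x(1,2) xy(1) Y] nb by blast
  show ?thesis
  proof (cases "\<exists>u\<in>X - {x, y}. \<exists>v\<in>X. adj \<theta> u v")
    case True
    then obtain u v where uv: "u \<in> X" "u \<notin> {x, y}" "v \<in> X" "adj \<theta> u v" by blast
    have "adj \<theta> v u" using uv symm(4) in_V by blast
    hence "v \<notin> {x, y}" using X_adj_unique[of v u] uv x xy by blast
    thus ?thesis using edge_and_single[OF k uv(1,3,4)] uv(2) YD[OF k(1)] by blast
  next
    case False
    hence iso: "\<not> adj \<theta> s t" if "s \<in> X - {x, y}" "t \<in> X" for s t using that by blast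
    show ?thesis
    proof (rule ccontr)
      assume no: "\<not> ?thesis"
      have full: "sadj \<theta> s t" if "s \<in> X - {x, y}" "t \<in> Y" "\<And>r. r \<in> Y \<Longrightarrow> \<not> antiadj \<theta> t r" for s t
      proof (rule ccontr)
        assume "\<not> sadj \<theta> s t"
        hence "santi \<theta> t s" using cross[of s t] symXY(2)[of s t] that by blast
        hence "even_pair V \<theta> t s" using even_pair_isolated[of t s] that iso by blast
        with no that YD show False by blast
      qed
      have clique: "clique \<theta> (V - ({x, y} \<union> nbhd V \<theta> p))" if p: "p \<in> {x, y}" for p
        unfolding clique_def
      proof (intro ballI impI)
        fix a b assume a: "a \<in> V - ({x, y} \<union> nbhd V \<theta> p)" and b: "b \<in> V - ({x, y} \<union> nbhd V \<theta> p)" and ne: "a \<noteq> b"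
        have pX: "p \<in> X" using p x by auto
        have nadj: "\<not> adj \<theta> a p" "\<not> adj \<theta> b p" using a b by (auto simp: nbhd_def)
        show "adj \<theta> a b"
        proof (cases "\<exists>z\<in>Y. \<exists>w\<in>Y. antiadj \<theta> z w")
          case True
          then obtain z w where zw: "z \<in> Y" "w \<in> Y" "antiadj \<theta> z w" by blast
          have wz: "antiadj \<theta> w z" using zw symm(5) in_V by blast
          have others: "\<not> antiadj \<theta> t r" if "t \<in> Y" "t \<noteq> z" "t \<noteq> w" "r \<in> Y" for t r
            using antiedge_unique[OF no_hole x(1,2) xy(1) zw that(1,4)] that by blast
          \<comment> \<open>A further vertex of \<open>X\<close> is strongly antiadjacent to an end
            of the only antiedge and strongly complete to the rest of \<open>Y\<close>, so
            \<open>even_pair_across\<close> applies.\<close>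
          have "X - {x, y} = {}"
          proof (rule ccontr)
            assume "X - {x, y} \<noteq> {}"
            then obtain s where s: "s \<in> X - {x, y}" by blast
            have main: False if zw: "z \<in> Y" "w \<in> Y" "antiadj \<theta> z w" "santi \<theta> s z"
              and others: "\<And>t r. t \<in> Y \<Longrightarrow> t \<noteq> z \<Longrightarrow> t \<noteq> w \<Longrightarrow> r \<in> Y \<Longrightarrow> \<not> antiadj \<theta> t r" for z w
            proof -
              have "sadj \<theta> t s" if "t \<in> Y" "t \<noteq> z" "t \<noteq> w" for t
                using full[OF s that(1) others[OF that]] symXY(1)[of s t] s that by blast
              hence "even_pair V \<theta> z s"
                using even_pair_across[OF zw(1-3), of s] s iso[OF s] symXY(2)[of s z] zw by blast
              with no s YD[OF zw(1)] show False by blast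
            qed
            have "santi \<theta> s z \<or> santi \<theta> s w" using antiedge_split[OF zw, of s] cross[of s z] s zw by blast
            thus False using main[OF zw _ others] main[OF zw(2,1) wz _ others] by blast
          qed
          hence ab: "a \<in> Y" "b \<in> Y" using a b partition by auto
          show ?thesis
          proof (rule ccontr)
            assume "\<not> adj \<theta> a b"
            hence "antiadj \<theta> a b" using ab ne not_adj in_V by (auto simp: antiadj_iff)
            hence "sadj \<theta> p a \<or> sadj \<theta> p b" using antiedge_split[of a b p] ab pX cross by blast
            thus False using nadj ab symXY(3)[OF pX] by blast
          qed
        next
          case single: False
          \<comment> \<open>Without antiedges in \<open>Y\<close> such vertices are strongly
            complete to \<open>Y\<close>, and two of them would be an even pair.\<close>
          have one: "s = s'" if "s \<in> X - {x, y}" "s' \<in> X - {x, y}" for s s'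
          proof (rule ccontr)
            assume "s \<noteq> s'"
            hence "even_pair V \<theta> s s'" using even_pair_full[of s s'] full single iso that by blast
            with no that show False by blast
          qed
          consider "a \<in> Y" "b \<in> Y" | "a \<in> X - {x, y}" "b \<in> Y" | "a \<in> Y" "b \<in> X - {x, y}" | "a \<in> X - {x, y}" "b \<in> X - {x, y}"
            using a b partition by blast
          thus ?thesis
          proof cases
            case 1
            thus ?thesis using Y_strong[of a b] single ne by (auto simp: adj_iff)
          next
            case 2
            hence "sadj \<theta> a b" using full single by blast
            thus ?thesis by (simp add: adj_iff)
          next
            case 3
            hence "sadj \<theta> b a" using full single by blast
            thus ?thesis using symXY(3)[of b a] 3 by blast
          next
            case 4
            with one ne show ?thesis by blast
          qed
        qed
      qed
      have "\<not> clique \<theta> (V - (swD V \<theta> \<union> nbhd V \<theta> x)) \<or> \<not> clique \<theta> (V - (swD V \<theta> \<union> nbhd V \<theta> y))"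
        using fav x(4) xy(3) unfolding favorable_def by blast
      thus False using clique[of x] clique[of y] unfolding x(4) by blast
    qed
  qed
qed

end

context finite_trigraph
begin

theorem doubled_case:
  assumes F: "in_F V \<theta>" and dbl: "doubled_graph V \<theta>" and no_hole: "\<not> has_antihole V \<theta>"
  shows "has_even_pairs"
proof (cases "bipartite_tg V \<theta>")
  case True
  thus ?thesis by (rule bipartite_case[OF F])
next
  case nb: False
  from dbl obtain X Y where "good_partition V \<theta> X Y" unfolding doubled_graph_def by blast
  then interpret doubled_trigraph V \<theta> X Y by unfold_locales
  have same_part: "u \<in> X \<and> v \<in> X \<or> u \<in> Y \<and> v \<in> Y" if "u \<in> V" "v \<in> V" "semiadj \<theta> u v" for u v
  proof -
    have "\<not> sadj \<theta> u v" "\<not> santi \<theta> u v" using that(3) by (auto dest: exclusive)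
    thus ?thesis using that(1,2) partition(1) cross[of u v] cross'[of v u] by blast
  qed
  from F show ?thesis
  proof (cases rule: in_F_cases)
    case none
    show ?thesis
    proof (rule has_even_pairs_if_no_switch[OF none(2)])
      fix u v assume "u \<in> V" "v \<in> V" "santi \<theta> u v"
      with even_pair_or_bipartite[OF no_hole _ this] none(1) nb in_V show "\<exists>u v. even_pair V \<theta> u v" by blast
    qed
  next
    case (light v x y)
    have "adj \<theta> v x" "adj \<theta> v y" "antiadj \<theta> v x" "antiadj \<theta> v y" using light(7,8) by (auto simp: adj_iff antiadj_iff)
    \<comment> \<open>Inside one part, \<open>v\<close> has at most one neighbour (in
      \<open>X\<close>) or one antineighbour (in \<open>Y\<close>), whereas a switchable partner
      counts as both.\<close>
    hence "x = y" using same_part[OF light(1,2,7)] same_part[OF light(1,3,8)] partition(2)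
      X_adj_unique[of v x y] Y_antiadj_unique[of v x y] by blast
    with light(6) show ?thesis by simp
  next
    case (small x y)
    \<comment> \<open>Any further vertex of \<open>Y\<close> would be strongly adjacent to both ends
      of the switchable pair, which have no common neighbour.\<close>
    have whole: "Y = {z, w}" if "z \<in> Y" "w \<in> Y" "semiadj \<theta> z w" for z w
    proof (rule ccontr)
      assume "Y \<noteq> {z, w}"
      with that obtain t where t: "t \<in> Y" "t \<noteq> z" "t \<noteq> w" by blast
      have a: "antiadj \<theta> z w" "antiadj \<theta> w z" using that symm(5)[of z w] in_V by (auto simp: antiadj_iff)
      have "sadj \<theta> z t" "sadj \<theta> w t"
        using Y_strong[of z t] Y_strong[of w t] Y_antiadj_unique[of z w t] Y_antiadj_unique[of w z t] a t that by blast+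
      hence "t \<in> nbhd V \<theta> z \<inter> nbhd V \<theta> w"
        using t that in_V symm(4)[of z t] symm(4)[of w t] by (auto simp: nbhd_def adj_iff)
      moreover have "{z, w} = {x, y}" using small(7) that in_V by blast
      ultimately show False using small(6) by (auto simp: doubleton_eq_iff)
    qed
    have "x \<in> X \<and> y \<in> X"
    proof (rule ccontr)
      assume "\<not> ?thesis"
      hence xy: "x \<in> Y" "y \<in> Y" using same_part[OF small(1,2,4)] by auto
      have "antiadj \<theta> x y" using small(4) by (simp add: antiadj_iff)
      from bipartite_if_antiedge[OF xy this whole[OF xy small(4)]] nb show False by simp
    qed
    hence X: "x \<in> X" "y \<in> X" by auto
    have "complete_tg V \<theta> \<or> (\<exists>u v. even_pair V \<theta> u v)"
    proof (rule ccontr)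
      assume no: "\<not> ?thesis"
      then obtain u v where "u \<in> V" "v \<in> V" "santi \<theta> u v" using not_complete by blast
      from even_pair_or_bipartite[OF no_hole whole this] nb no show False by blast
    qed
    moreover have "favorable V \<theta> \<longrightarrow> (\<exists>u v. even_pair V \<theta> u v \<and> u \<notin> swD V \<theta> \<and> v \<notin> swD V \<theta>)"
      using even_pair_disjoint[OF no_hole nb _ X small(4,5)] unfolding small(5) by blast
    ultimately show ?thesis unfolding has_even_pairs_def by simp
  qed
qed

end

theorem theorem4p1:
  fixes V :: "'a set" and \<theta> :: "'a \<Rightarrow> 'a \<Rightarrow> int"
  assumes "trigraph V \<theta>"
    and "in_F V \<theta>"
    and "basic V \<theta>"
    and "\<not> has_odd_prism V \<theta>"
    and "\<not> has_antihole V \<theta>"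
  shows "(complete_tg V \<theta> \<or> (\<exists>u v. even_pair V \<theta> u v)) \<and>
         (favorable V \<theta> \<longrightarrow>
            (\<exists>u v. even_pair V \<theta> u v \<and> u \<notin> swD V \<theta> \<and> v \<notin> swD V \<theta>))"
proof -
  interpret finite_trigraph V \<theta> using assms(1) by unfold_locales
  have "has_even_pairs"
    using assms(3) unfolding basic_def
  proof (elim disjE)
    assume "line_trigraph V \<theta>"
    then obtain f :: "'a \<Rightarrow> nat \<times> nat" where f: "inj_on f V"
      "\<forall>u\<in>V. \<forall>v\<in>V. u \<noteq> v \<longrightarrow> adj \<theta> u v = (fst (f u) = fst (f v) \<or> snd (f u) = snd (f v))"
      "\<forall>X\<subseteq>V. clique \<theta> X \<and> 3 \<le> card X \<longrightarrow> strong_clique \<theta> X"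
      unfolding line_trigraph_def by blast
    interpret bipartite_line_trigraph V \<theta> f by unfold_locales (use f in simp_all)
    show ?thesis using line_trigraph_even_pairs[OF assms(2,4)] unfolding has_even_pairs_def .
  qed (use bipartite_case cobipartite_case coline_case doubled_case assms in blast)+
  thus ?thesis unfolding has_even_pairs_def .
qed

end
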